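(* Let $V$ be a positive integer divisible by $4$, and write the prime factorization of $V/4$ as $$\frac{V}{4} = 3^{m}\, p_1^{k_1} p_2^{k_2}\cdots p_r^{k_r}\, q_1^{\ell_1} q_2^{\ell_2}\cdots q_s^{\ell_s},$$ where $p_1,\dots,p_r$ are distinct primes with $p_i \equiv 1 \pmod 3$, $q_1,\dots,q_s$ are distinct primes with $q_j\equiv 2 \pmod 3$, $m\ge 0$, and all $k_i\ge 1$, $\ell_j\ge 1$. If some exponent $\ell_j$ is odd, then the number of trihexes with $V$ vertices is $$\frac13\left(\frac{3^{m+1}-1}{3-1}\prod_{i=1}^{r}\frac{p_i^{k_i+1}-1}{p_i-1}\prod_{j=1}^{s}\frac{q_j^{\ell_j+1}-1}{q_j-1}\right).$$ If all exponents $\ell_j$ are even, then the number of trihexes with $V$ vertices is $$\frac13\left(\frac{3^{m+1}-1}{3-1}\prod_{i=1}^{r}\frac{p_i^{k_i+1}-1}{p_i-1}\prod_{j=1}^{s}\frac{q_j^{\ell_j+1}-1}{q_j-1}\right)+\frac23\prod_{i=1}^{r}(k_i+1).$$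
   Context: A trihex is a 3-regular graph embedded in the plane (equivalently, in the sphere) all of whose faces, including the unbounded one, have exactly 3 or exactly 6 sides. Two trihexes are counted as the same if they are isomorphic as graphs via an isomorphism induced by an orientation-preserving homeomorphism of the plane; in particular, a trihex and its mirror image are counted as distinct unless such a homeomorphism exists. Every trihex has exactly four triangular faces. Known background: every trihex arises as the quotient of the regular hexagonal tiling of the plane (hexagons in vertical columns) by the group generated by the $180^\circ$ rotations about the centers of a set of "special" hexagons whose centers form the vertices of a parallelogram lattice; the quotient is a sphere, special hexagons cover the triangles, other hexagons cover hexagonal faces. Such a trihex is described by a signature $(s,b,f)$ of integers with $s\ge 0$, $b\ge0$, $0\le f\le s$ (spine length, number of belt columns between adjacent spine columns, and offset), and has $V=4(s+1)(b+1)$ vertices. Every such triple is a signature of exactly one trihex, and each trihex has exactly three signatures (one for each of the three column directions of the hexagonal tiling), which are either pairwise distinct or all identical. *)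

theory Defs
  imports
    Complex_Main
    "HOL-Number_Theory.Cong"
    "HOL-Combinatorics.Orbits"
    "Graph_Theory.Graph_Theory"
begin

text \<open>
  A graph embedded in an oriented closed surface with open discs as faces is given, up to
  orientation-preserving homeomorphism, by its rotation system. As usual for bidirected graphs,
  each undirected edge is a pair of opposite arcs, exchanged by \<open>edge_rev\<close> (a loop also
  contributes two arcs), and \<open>edge_succ\<close> sends an arc leaving a vertex to the next arc
  leaving that vertex in counterclockwise order. Loops and parallel edges are not excluded.
\<close>

record ('a, 'b) embedded_graph =
  graph_of :: "('a, 'b) pre_digraph"
  edge_rev :: "'b \<Rightarrow> 'b"
  edge_succ :: "'b \<Rightarrow> 'b"

definition rotation_system :: "('a, 'b) embedded_graph \<Rightarrow> bool" where
  "rotation_system M \<longleftrightarrow>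
     fin_digraph (graph_of M) \<and>
     bidirected_digraph (graph_of M) (edge_rev M) \<and>
     edge_succ M permutes arcs (graph_of M) \<and>
     (\<forall>v \<in> verts (graph_of M). out_arcs (graph_of M) v \<noteq> {} \<longrightarrow>
        cyclic_on (edge_succ M) (out_arcs (graph_of M) v))"

definition edges :: "('a, 'b) embedded_graph \<Rightarrow> 'b set set" where
  "edges M = (\<lambda>a. {a, edge_rev M a}) ` arcs (graph_of M)"

text \<open>
  Walk along an arc to its head and leave by the next arc in counterclockwise order after the
  reversed arc: this keeps one fixed face on the right. A face is recorded as the set of arcs of
  its boundary walk, so its cardinality is the number of sides, an edge with the face on both
  sides being counted twice.
\<close>

definition face_succ :: "('a, 'b) embedded_graph \<Rightarrow> 'b \<Rightarrow> 'b" where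
  "face_succ M a = edge_succ M (edge_rev M a)"

definition faces :: "('a, 'b) embedded_graph \<Rightarrow> 'b set set" where
  "faces M = orbit (face_succ M) ` arcs (graph_of M)"

text \<open>
  The surface is a sphere iff it is connected and has Euler characteristic 2.
\<close>

definition spherical :: "('a, 'b) embedded_graph \<Rightarrow> bool" where
  "spherical M \<longleftrightarrow>
     Digraph_Component.connected (graph_of M) \<and>
     int (card (verts (graph_of M))) - int (card (edges M)) + int (card (faces M)) = 2"

definition trihex :: "('a, 'b) embedded_graph \<Rightarrow> bool" where
  "trihex M \<longleftrightarrow>
     rotation_system M \<and> spherical M \<and>
     (\<forall>v \<in> verts (graph_of M). out_degree (graph_of M) v = 3) \<and>
     (\<forall>F \<in> faces M. card F = 3 \<or> card F = 6)"

text \<open>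
  Graph isomorphisms induced by an orientation-preserving homeomorphism are those preserving the
  counterclockwise order around each vertex; an orientation-reversing one would intertwine
  \<open>edge_succ\<close> with its inverse.
\<close>

definition oriented_iso ::
    "('a, 'b) embedded_graph \<Rightarrow> ('c, 'd) embedded_graph \<Rightarrow> ('a \<Rightarrow> 'c) \<Rightarrow> ('b \<Rightarrow> 'd) \<Rightarrow> bool" where
  "oriented_iso M N f g \<longleftrightarrow>
     bij_betw f (verts (graph_of M)) (verts (graph_of N)) \<and>
     bij_betw g (arcs (graph_of M)) (arcs (graph_of N)) \<and>
     (\<forall>a \<in> arcs (graph_of M).
        tail (graph_of N) (g a) = f (tail (graph_of M) a) \<and>
        head (graph_of N) (g a) = f (head (graph_of M) a) \<and>
        edge_rev N (g a) = g (edge_rev M a) \<and>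
        edge_succ N (g a) = g (edge_succ M a))"

text \<open>
  Every finite embedded graph is isomorphic to one whose vertices and arcs are natural numbers,
  so these suffice to represent all isomorphism classes.
\<close>

definition trihexes :: "nat \<Rightarrow> (nat, nat) embedded_graph set" where
  "trihexes n = {M. trihex M \<and> card (verts (graph_of M)) = n}"

definition trihex_iso :: "nat \<Rightarrow> (nat, nat) embedded_graph rel" where
  "trihex_iso n = {(M, N). M \<in> trihexes n \<and> N \<in> trihexes n \<and> (\<exists>f g. oriented_iso M N f g)}"

definition num_trihexes :: "nat \<Rightarrow> nat" where
  "num_trihexes n = card (trihexes n // trihex_iso n)"

lemma oriented_iso_refl: "oriented_iso M M id id"
  by (simp add: oriented_iso_def)

lemma oriented_iso_sym:
  assumes "rotation_system M" and iso: "oriented_iso M N f g"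
  shows "oriented_iso N M (the_inv_into (verts (graph_of M)) f) (the_inv_into (arcs (graph_of M)) g)"
proof -
  let ?V = "verts (graph_of M)" and ?A = "arcs (graph_of M)"
  interpret bidirected_digraph "graph_of M" "edge_rev M"
    using assms by (simp add: rotation_system_def)
  have succ: "edge_succ M permutes ?A"
    using assms by (simp add: rotation_system_def)
  have f: "bij_betw f ?V (verts (graph_of N))" and g: "bij_betw g ?A (arcs (graph_of N))"
    using iso by (auto simp: oriented_iso_def)
  have inv: "the_inv_into ?V f (f v) = v" if "v \<in> ?V" for v
    using f that by (simp add: bij_betw_def the_inv_into_f_f)
  have inv': "the_inv_into ?A g (g a) = a" if "a \<in> ?A" for a
    using g that by (simp add: bij_betw_def the_inv_into_f_f)
  have "tail (graph_of M) (the_inv_into ?A g b) = the_inv_into ?V f (tail (graph_of N) b) \<and>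
      head (graph_of M) (the_inv_into ?A g b) = the_inv_into ?V f (head (graph_of N) b) \<and>
      edge_rev M (the_inv_into ?A g b) = the_inv_into ?A g (edge_rev N b) \<and>
      edge_succ M (the_inv_into ?A g b) = the_inv_into ?A g (edge_succ N b)"
    if "b \<in> arcs (graph_of N)" for b
  proof -
    obtain a where a: "a \<in> ?A" "b = g a"
      using g \<open>b \<in> arcs (graph_of N)\<close> by (auto simp: bij_betw_def)
    then show ?thesis
      using iso permutes_in_image[OF succ, of a] by (simp add: oriented_iso_def inv inv')
  qed
  then show ?thesis
    using bij_betw_the_inv_into[OF f] bij_betw_the_inv_into[OF g] by (simp add: oriented_iso_def)
qed

lemma oriented_iso_trans:
  assumes "oriented_iso M N f g" "oriented_iso N P f' g'"
  shows "oriented_iso M P (f' \<circ> f) (g' \<circ> g)"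
  using assms by (auto simp: oriented_iso_def intro: bij_betw_trans dest: bij_betwE)

lemma equiv_trihex_iso: "equiv (trihexes n) (trihex_iso n)"
proof (rule equivI)
  show "trihex_iso n \<subseteq> trihexes n \<times> trihexes n"
    by (auto simp: trihex_iso_def)
  show "refl_on (trihexes n) (trihex_iso n)"
    by (auto simp: refl_on_def trihex_iso_def intro: oriented_iso_refl)
  show "sym (trihex_iso n)"
    by (auto simp: sym_def trihex_iso_def trihexes_def trihex_def dest: oriented_iso_sym)
  show "trans (trihex_iso n)"
    by (auto simp: trans_def trihex_iso_def dest: oriented_iso_trans)
qed

end

theory Submission
  imports
    Defs
    "HOL-Number_Theory.Residue_Primitive_Roots"
    "HOL-Computational_Algebra.Nth_Powers"
    "HOL-Library.Product_Plus"
    "HOL-Library.Countable"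
begin

text \<open>
  Write \<open>\<phi>\<close> for the permutation of the arcs that follows a face and \<open>\<alpha>\<close> for the
  reversal. In a trihex \<open>\<alpha>\<^sup>2 = \<phi>\<^sup>6 = (\<phi> \<alpha>)\<^sup>3 = 1\<close>, so the rotation group of the hexagonal tiling
  acts transitively on the arcs. Its translations form the lattice \<open>L\<close> of hexagon centres, and
  by Euler's formula some arc lies on a triangle, which means that it is fixed by a half turn about a
  hexagon centre. Edges and vertices have no stabilizers and no face has one or two sides, hence
  the stabilizer of that arc is generated by the half turns about the points of a sublattice
  \<open>K\<close> of \<open>L\<close>, of index \<open>V / 4\<close>. Every sublattice occurs, and changing the arc only
  replaces \<open>K\<close> by its rotations by multiples of 60 degrees.

  So trihexes correspond to orbits of sublattices of index \<open>n = V / 4\<close> under a group of order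
  3 (the half turn acts trivially), and by Burnside's lemma three times their number is
  \<open>\<sigma>(n)\<close>, the number of all sublattices, plus twice the number of invariant ones. The latter are
  the ideals of norm \<open>n\<close> in the Eisenstein integers.
\<close>

section \<open>Multiplicative functions and ideals of Eisenstein integers\<close>

text \<open>The tiling enters only through labels \<open>(t, u)\<close> of its darts: a map is a
  quotient of it when a function \<open>cov\<close> on such labels satisfies
  \<open>hex_cover\<close>. From a trihex to the tiling, the point is that the three relations make
  two words in \<open>\<phi>\<close> and \<open>\<alpha>\<close> commute and make
  \<open>\<phi>\<close> rotate them by 60 degrees; they are the translations, and the base arc
  develops along them.

  A base arc on a triangle gives the labels \<open>(t, u + 3)\<close> and \<open>(- t, u)\<close>
  the same arc, so three directions remain. The translations in the stabilizer form 2 K, which has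
  index 4 n; this makes 12 n arcs and 4 n vertices.

  In the other direction the sphere is recognised by counting: for a cubic map with faces of 3 and 6
  sides the Euler characteristic is half the number of triangles. In the quotient the arcs on
  triangles are those with t in K, that is, the four classes of K modulo 2 K in three directions
  each.\<close>

definition multiplicative :: "(nat \<Rightarrow> nat) \<Rightarrow> bool" where
  "multiplicative f \<longleftrightarrow>
     f 1 = 1 \<and> (\<forall>m n. m > 0 \<longrightarrow> n > 0 \<longrightarrow> coprime m n \<longrightarrow> f (m * n) = f m * f n)"

definition dirichlet_conv :: "(nat \<Rightarrow> nat) \<Rightarrow> (nat \<Rightarrow> nat) \<Rightarrow> nat \<Rightarrow> nat" where
  "dirichlet_conv f g n = (\<Sum>d | d dvd n. f d * g (n div d))"

lemma multiplicative_mult: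
  "multiplicative f \<Longrightarrow> m > 0 \<Longrightarrow> n > 0 \<Longrightarrow> coprime m n \<Longrightarrow> f (m * n) = f m * f n"
  by (simp add: multiplicative_def)

lemma multiplicative_prod:
  assumes f: "multiplicative f" and "finite I"
    and pos: "\<And>i. i \<in> I \<Longrightarrow> x i > 0"
    and cop: "\<And>i j. i \<in> I \<Longrightarrow> j \<in> I \<Longrightarrow> i \<noteq> j \<Longrightarrow> coprime (x i) (x j)"
  shows "f (\<Prod>i\<in>I. x i) = (\<Prod>i\<in>I. f (x i))"
  using \<open>finite I\<close> pos cop
proof (induction I rule: finite_induct)
  case empty
  then show ?case using f by (simp add: multiplicative_def)
next
  case (insert i I)
  have "coprime (x i) (\<Prod>j\<in>I. x j)"
    by (rule prod_coprime_right) (use insert in auto)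
  moreover have "(\<Prod>j\<in>I. x j) > 0"
    using insert.prems by (intro prod_pos) auto
  ultimately have "f (x i * (\<Prod>j\<in>I. x j)) = f (x i) * f (\<Prod>j\<in>I. x j)"
    using insert.prems by (intro multiplicative_mult[OF f]) auto
  then show ?case using insert by simp
qed

lemma bij_betw_divisors_mult:
  fixes m n :: nat
  assumes "m > 0" "n > 0" "coprime m n"
  shows "bij_betw (\<lambda>(c, d). c * d) ({c. c dvd m} \<times> {d. d dvd n}) {d. d dvd m * n}"
proof (rule bij_betw_imageI)
  have eq: "c = c'" if "c * d = c' * d'" "c dvd m" "d' dvd n" "c' dvd m" "d dvd n" for c d c' d'
  proof (rule dvd_antisym)
    have "coprime c d'" "coprime c' d"
      using that assms by (meson coprime_divisors)+
    then show "c dvd c'" "c' dvd c"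
      using that(1) by (metis coprime_dvd_mult_left_iff dvd_triv_left)+
  qed
  show "inj_on (\<lambda>(c, d). c * d) ({c. c dvd m} \<times> {d. d dvd n})"
  proof (rule inj_onI, clarify)
    fix c d c' d'
    assume *: "c dvd m" "d dvd n" "c' dvd m" "d' dvd n" "c * d = c' * d'"
    then have "c = c'" using eq by blast
    moreover have "c > 0" using * assms by (auto intro: Nat.gr0I)
    ultimately show "c = c' \<and> d = d'" using * by auto
  qed
  show "(\<lambda>(c, d). c * d) ` ({c. c dvd m} \<times> {d. d dvd n}) = {d. d dvd m * n}"
    by (fastforce simp: image_iff intro: mult_dvd_mono elim: dvd_productE)
qed

lemma multiplicative_dirichlet_conv:
  assumes f: "multiplicative f" and g: "multiplicative g"
  shows "multiplicative (dirichlet_conv f g)"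
  unfolding multiplicative_def
proof (intro conjI allI impI)
  show "dirichlet_conv f g 1 = 1"
    using f g by (simp add: dirichlet_conv_def multiplicative_def)
  fix m n :: nat
  assume mn: "m > 0" "n > 0" "coprime m n"
  have "dirichlet_conv f g (m * n) =
      (\<Sum>(c, d) \<in> {c. c dvd m} \<times> {d. d dvd n}. f (c * d) * g (m * n div (c * d)))"
    unfolding dirichlet_conv_def
    by (subst sum.reindex_bij_betw[OF bij_betw_divisors_mult[OF mn], symmetric])
       (simp add: case_prod_unfold)
  also have "\<dots> = (\<Sum>(c, d) \<in> {c. c dvd m} \<times> {d. d dvd n}.
      (f c * g (m div c)) * (f d * g (n div d)))"
  proof (intro sum.cong refl, clarify)
    fix c d assume cd: "c dvd m" "d dvd n"
    then have "m div c dvd m" "n div d dvd n" by (auto simp: dvd_div_iff_mult)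
    then have "coprime c d" "coprime (m div c) (n div d)"
      using cd mn by (meson coprime_divisors)+
    moreover have "c > 0" "d > 0" "m div c > 0" "n div d > 0"
      using cd mn by (auto simp: dvd_div_eq_0_iff intro!: Nat.gr0I)
    moreover have "m * n div (c * d) = (m div c) * (n div d)"
      using cd by (simp add: div_mult_div_if_dvd)
    ultimately show "f (c * d) * g (m * n div (c * d)) = (f c * g (m div c)) * (f d * g (n div d))"
      using multiplicative_mult[OF f] multiplicative_mult[OF g] by simp
  qed
  also have "\<dots> = dirichlet_conv f g m * dirichlet_conv f g n"
    by (simp add: dirichlet_conv_def sum_product sum.cartesian_product)
  finally show "dirichlet_conv f g (m * n) = dirichlet_conv f g m * dirichlet_conv f g n" .
qed

lemma dirichlet_conv_prime_power:
  assumes "prime p"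
  shows "dirichlet_conv f g (p ^ k) = (\<Sum>j\<le>k. f (p ^ j) * g (p ^ (k - j)))"
proof -
  have p: "p > 1" using assms prime_gt_1_nat by blast
  have "{d. d dvd p ^ k} = (\<lambda>j. p ^ j) ` {..k}"
    using divides_primepow_nat[OF assms] by (auto simp: image_iff)
  moreover have "inj_on (\<lambda>j. p ^ j) {..k}"
    using p by (auto simp: inj_on_def)
  moreover have "p ^ k div p ^ j = p ^ (k - j)" if "j \<le> k" for j
    using that p by (simp add: power_diff)
  ultimately show ?thesis
    unfolding dirichlet_conv_def by (simp add: sum.reindex)
qed

definition divisor_sum :: "nat \<Rightarrow> nat" where
  "divisor_sum = dirichlet_conv (\<lambda>d. d) (\<lambda>_. 1)"

lemma multiplicative_divisor_sum: "multiplicative divisor_sum"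
  unfolding divisor_sum_def
  by (rule multiplicative_dirichlet_conv) (auto simp: multiplicative_def)

lemma divisor_sum_prime_power:
  assumes "prime p"
  shows "real (divisor_sum (p ^ k)) = (real p ^ (k + 1) - 1) / (real p - 1)"
proof -
  have "real p \<noteq> 1" using assms by auto
  then show ?thesis
    using geometric_sum[of "real p" "Suc k"]
    by (simp add: divisor_sum_def dirichlet_conv_prime_power[OF assms] lessThan_Suc_atMost)
qed

section \<open>Roots of x^2 - x + 1 modulo n\<close>

definition eisenstein_roots :: "nat \<Rightarrow> nat set" where
  "eisenstein_roots n = {b. b < n \<and> int n dvd (int b)\<^sup>2 - int b + 1}"

lemma finite_eisenstein_roots [simp]: "finite (eisenstein_roots n)"
  by (simp add: eisenstein_roots_def)

lemma eisenstein_polynomial_mod: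
  "int n dvd (int (b mod n))\<^sup>2 - int (b mod n) + 1 \<longleftrightarrow> int n dvd (int b)\<^sup>2 - int b + 1"
proof -
  have "[(int b mod int n)\<^sup>2 - int b mod int n + 1 = (int b)\<^sup>2 - int b + 1] (mod int n)"
    by (intro cong_add cong_diff cong_pow cong_refl cong_mod_leftI)
  then show ?thesis by (simp add: zmod_int cong_dvd_iff)
qed

text \<open>Chinese remainder theorem: reduction modulo m and n is a bijection on the roots. The
  polynomial is the minimal polynomial of a primitive sixth root of unity, so the roots are the
  homomorphisms from the Eisenstein integers to the integers modulo n.\<close>

lemma multiplicative_card_eisenstein_roots: "multiplicative (\<lambda>n. card (eisenstein_roots n))"
  unfolding multiplicative_def
proof (intro conjI allI impI)
  have "eisenstein_roots 1 = {0}" by (auto simp: eisenstein_roots_def)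
  then show "card (eisenstein_roots 1) = 1" by simp
  fix m n :: nat
  assume mn: "m > 0" "n > 0" "coprime m n"
  have "bij_betw (\<lambda>b. (b mod m, b mod n)) (eisenstein_roots (m * n)) (eisenstein_roots m \<times> eisenstein_roots n)"
  proof (rule bij_betw_imageI)
    show "inj_on (\<lambda>b. (b mod m, b mod n)) (eisenstein_roots (m * n))"
    proof (rule inj_onI)
      fix x y
      assume xy: "x \<in> eisenstein_roots (m * n)" "y \<in> eisenstein_roots (m * n)"
        "(x mod m, x mod n) = (y mod m, y mod n)"
      then have "[x = y] (mod m * n)"
        using mn by (intro coprime_cong_mult_nat) (auto simp: cong_def)
      then show "x = y"
        using xy by (auto simp: eisenstein_roots_def cong_def)
    qed
    show "(\<lambda>b. (b mod m, b mod n)) ` eisenstein_roots (m * n) = eisenstein_roots m \<times> eisenstein_roots n"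
    proof safe
      fix b assume "b \<in> eisenstein_roots (m * n)"
      then have "int m dvd (int b)\<^sup>2 - int b + 1" "int n dvd (int b)\<^sup>2 - int b + 1"
        by (auto simp: eisenstein_roots_def dest: dvd_mult_left dvd_mult_right)
      then show "b mod m \<in> eisenstein_roots m" "b mod n \<in> eisenstein_roots n"
        using mn eisenstein_polynomial_mod[of m b] eisenstein_polynomial_mod[of n b]
        by (simp_all add: eisenstein_roots_def)
    next
      fix b c assume bc: "b \<in> eisenstein_roots m" "c \<in> eisenstein_roots n"
      obtain x where x: "x < m * n" "[x = b] (mod m)" "[x = c] (mod n)"
        using binary_chinese_remainder_unique_nat[of m n b c] mn by auto
      have xm: "x mod m = b" "x mod n = c"
        using x bc by (auto simp: cong_def eisenstein_roots_def)
      then have "int m dvd (int x)\<^sup>2 - int x + 1" "int n dvd (int x)\<^sup>2 - int x + 1"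
        using bc eisenstein_polynomial_mod[of m x] eisenstein_polynomial_mod[of n x]
        by (auto simp: eisenstein_roots_def)
      then have "x \<in> eisenstein_roots (m * n)"
        using x mn by (auto simp: eisenstein_roots_def intro!: divides_mult)
      then show "(b, c) \<in> (\<lambda>b. (b mod m, b mod n)) ` eisenstein_roots (m * n)"
        using xm by force
    qed
  qed
  then show "card (eisenstein_roots (m * n)) = card (eisenstein_roots m) * card (eisenstein_roots n)"
    by (simp add: bij_betw_same_card card_cartesian_product)
qed

text \<open>A root b satisfies b^3 = -1 modulo q. With q - 1 = 3 j + 1, Fermat's theorem gives
  (-1)^j b = 1, so b is 1 or -1. There the polynomial takes the values 1 and 3, neither divisible by
  q.\<close>

lemma eisenstein_roots_power_2_mod_3:
  assumes "prime q" "[q = 2] (mod 3)" "k > 0"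
  shows "eisenstein_roots (q ^ k) = {}"
proof (rule equals0I)
  fix b assume "b \<in> eisenstein_roots (q ^ k)"
  then have "int (q ^ k) dvd (int b)\<^sup>2 - int b + 1"
    by (simp only: eisenstein_roots_def mem_Collect_eq)
  moreover have "int q dvd int (q ^ k)" using assms by (simp add: dvd_power)
  ultimately have q: "int q dvd (int b)\<^sup>2 - int b + 1" by (rule dvd_trans[rotated])
  have "q mod 3 = 2" using assms by (simp add: cong_def)
  then obtain j where j: "q = 3 * j + 2" by (metis mult_div_mod_eq)
  have "(int b) ^ 3 + 1 = (int b + 1) * ((int b)\<^sup>2 - int b + 1)"
    by (simp add: power2_eq_square power3_eq_cube algebra_simps)
  then have b3: "[(int b) ^ 3 = -1] (mod int q)"
    using q by (simp add: cong_iff_dvd_diff)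
  have q1: "int q \<noteq> 1" and q0: "\<not> int q dvd 1" using assms by auto
  have "\<not> q dvd b"
  proof
    assume "q dvd b"
    then have "int q dvd (int b)\<^sup>2 - int b" by (simp add: power2_eq_square)
    then show False using q q0 by (metis dvd_add_right_iff)
  qed
  then have "[b ^ (q - 1) = 1] (mod q)" using fermat_theorem assms by blast
  then have "[(int b) ^ (3 * j + 1) = 1] (mod int q)"
    using j by (simp flip: cong_int_iff)
  moreover have "(int b) ^ (3 * j + 1) = ((int b) ^ 3) ^ j * int b"
    by (simp only: power_add power_mult power_one_right)
  then have "[(int b) ^ (3 * j + 1) = (-1) ^ j * int b] (mod int q)"
    using cong_mult[OF cong_pow[OF b3, of j] cong_refl[of "int b"]] by (simp only:)
  ultimately have c: "[(-1) ^ j * int b = 1] (mod int q)" by (metis cong_sym cong_trans)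
  show False
  proof (cases "even j")
    case True
    then have "int q dvd int b - 1" using c by (simp add: cong_iff_dvd_diff)
    then have "int q dvd (int b - 1) * int b" by simp
    then have "int q dvd ((int b)\<^sup>2 - int b + 1) - (int b - 1) * int b" using q by (rule dvd_diff[rotated])
    then show False using q0 by (simp add: algebra_simps power2_eq_square)
  next
    case False
    then have "int q dvd - int b - 1" using c by (simp add: cong_iff_dvd_diff)
    then have "int q dvd (- int b - 1) * (int b - 2)" by simp
    then have "int q dvd ((int b)\<^sup>2 - int b + 1) + (- int b - 1) * (int b - 2)" using q by (rule dvd_add[rotated])
    then have "int q dvd 3" by (simp add: algebra_simps power2_eq_square)
    then have "int q dvd int 3" by simp
    then have "q dvd 3" by (simp only: int_dvd_int_iff)
    then have "q \<le> 3" by (rule dvd_imp_le) simp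
    then have "q = 2" using j by simp
    then show False using \<open>q dvd 3\<close> by simp
  qed
qed

text \<open>The prime 3 ramifies: x^2 - x + 1 is (x + 1)^2 modulo 3, and at x = 3 y - 1 its value is
  3 modulo 9, so the double root 2 does not lift.\<close>

lemma card_eisenstein_roots_power_3:
  "card (eisenstein_roots (3 ^ k)) = (if k \<le> 1 then 1 else 0)"
proof -
  consider "k = 0" | "k = 1" | "k \<ge> 2" by linarith
  then show ?thesis
  proof cases
    case 1
    then show ?thesis using multiplicative_card_eisenstein_roots by (simp add: multiplicative_def)
  next
    case 2
    have "b \<in> eisenstein_roots 3 \<longleftrightarrow> b = 2" for b
      by (cases "b = 0 \<or> b = 1 \<or> b = 2") (auto simp: eisenstein_roots_def cong_def)
    then have "eisenstein_roots 3 = {2}" by auto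
    then show ?thesis using 2 by simp
  next
    case 3
    have "\<not> 9 dvd (int b)\<^sup>2 - int b + 1" for b
    proof
      assume "9 dvd (int b)\<^sup>2 - int b + 1"
      then have "9 dvd (int (b mod 9))\<^sup>2 - int (b mod 9) + 1"
        using eisenstein_polynomial_mod[of 9 b] by (simp only: of_nat_numeral)
      moreover have "b mod 9 < 9" by simp
      then have "b mod 9 \<in> {0,1,2,3,4,5,6,7,8}" by auto
      ultimately show False by auto
    qed
    moreover have "(9::int) dvd int (3 ^ k)"
      using le_imp_power_dvd[OF 3, of "3::int"] by simp
    ultimately have "eisenstein_roots (3 ^ k) = {}"
      by (auto simp: eisenstein_roots_def intro: dvd_trans)
    then show ?thesis using 3 by simp
  qed
qed

lemma prime_1_mod_3_not_dvd_3:
  assumes "prime p" "[p = 1] (mod 3)"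
  shows "\<not> int p dvd 3"
proof
  assume "int p dvd 3"
  then have "int p dvd int 3" by simp
  then have "p dvd 3" by (simp only: int_dvd_int_iff)
  then have "p \<le> 3" by (rule dvd_imp_le) simp
  then have "p = 2 \<or> p = 3" using prime_ge_2_nat[OF assms(1)] by auto
  then show False using assms(2) by (auto simp: cong_def)
qed

text \<open>Since 6 divides p - 1, there is an element of order 6 modulo p; Hensel lifting carries
  it to higher powers. Lifting works from exponent 1 on, so the induction step at
  \<open>k = 0\<close> is the base case \<open>base\<close>.\<close>

lemma eisenstein_root_prime_power_exists:
  assumes p: "prime p" "[p = 1] (mod 3)"
  shows "\<exists>b::int. int p ^ k dvd b\<^sup>2 - b + 1"
proof -
  have p3: "p mod 3 = 1" using p by (simp add: cong_def)
  have "p \<noteq> 2" using p3 by auto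
  then have "odd p" using p primes_dvd_imp_eq two_is_prime_nat by blast
  then have "6 dvd p - 1" using p3 by presburger
  have pp: "prime (int p)" using p by simp
  have p_ndvd3: "\<not> int p dvd 3" using prime_1_mod_3_not_dvd_3[OF p] .
  have base: "\<exists>b::int. int p dvd b\<^sup>2 - b + 1"
  proof -
    have "card {x \<in> totatives p. ord p x = 6} = totient 6"
      using prime_card_elements_with_ord_eq_totient[of p 6] p \<open>6 dvd p - 1\<close> prime_gt_1_nat by simp
    also have "totient 6 > 0" by simp
    finally have "{x \<in> totatives p. ord p x = 6} \<noteq> {}" by (metis card.empty less_irrefl)
    then obtain b where b: "ord p b = 6" by auto
    have b6: "[b ^ 6 = 1] (mod p)" using ord[of b p] b by simp
    have nb: "\<not> [b ^ d = 1] (mod p)" if "0 < d" "d < 6" for d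
      using ord_minimal[of d p b] b that by auto
    define z where "z = int b"
    have "int p dvd z ^ 6 - 1"
      using b6 by (simp add: z_def cong_iff_dvd_diff flip: cong_int_iff)
    moreover have "z ^ 6 - 1 = (z ^ 3 - 1) * (z ^ 3 + 1)"
      using power_mult[of z 3 2] by (simp add: power2_eq_square algebra_simps)
    moreover have "z ^ 3 + 1 = (z\<^sup>2 - z + 1) * (z + 1)"
      by (simp add: power2_eq_square power3_eq_cube algebra_simps)
    ultimately have "int p dvd z ^ 3 - 1 \<or> int p dvd z\<^sup>2 - z + 1 \<or> int p dvd z + 1"
      using pp by (simp add: prime_dvd_mult_iff)
    moreover have "\<not> int p dvd z ^ 3 - 1"
      using nb[of 3] by (simp add: z_def cong_iff_dvd_diff flip: cong_int_iff)
    moreover have "\<not> int p dvd z + 1"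
    proof
      assume "int p dvd z + 1"
      then have "int p dvd (z + 1) * (z - 1)" by simp
      also have "(z + 1) * (z - 1) = z\<^sup>2 - 1" by (simp add: power2_eq_square algebra_simps)
      finally show False
        using nb[of 2] by (simp add: z_def cong_iff_dvd_diff flip: cong_int_iff)
    qed
    ultimately show ?thesis by blast
  qed
  show ?thesis
  proof (induction k)
    case 0
    then show ?case by simp
  next
    case (Suc k)
    show ?case
    proof (cases "k = 0")
      case True
      then show ?thesis using base by simp
    next
      case False
      obtain b c where b: "b\<^sup>2 - b + 1 = int p ^ k * c" using Suc by (auto elim: dvdE)
      \<comment> \<open>2 b - 1 is the derivative of the polynomial at b, and (2 b - 1)^2 = 4 (b^2 -
        b + 1) - 3, so p would divide 3.\<close>
      have "\<not> int p dvd 2 * b - 1"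
      proof
        assume "int p dvd 2 * b - 1"
        then have "int p dvd (2 * b - 1) * (2 * b - 1)" by simp
        moreover have "int p dvd 4 * (int p ^ k * c)" using False by (simp add: dvd_power)
        ultimately have "int p dvd 4 * (int p ^ k * c) - (2 * b - 1) * (2 * b - 1)" by (rule dvd_diff[rotated])
        also have "4 * (int p ^ k * c) - (2 * b - 1) * (2 * b - 1) = 3"
          unfolding b[symmetric] by (simp add: power2_eq_square algebra_simps)
        finally show False using p_ndvd3 by simp
      qed
      then have "coprime (2 * b - 1) (int p)"
        using pp by (simp add: prime_imp_coprime coprime_commute)
      then obtain x where "[(2 * b - 1) * x = 1] (mod int p)"
        using cong_solve_coprime_int by blast
      then have x: "int p dvd (2 * b - 1) * x - 1" by (simp add: cong_iff_dvd_diff)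
      \<comment> \<open>Newton's step: x inverts the derivative modulo p, so the linear term cancels
        p^k c modulo p^(k+1). The quadratic term is divisible by p^(2k), which suffices as k is
        positive.\<close>
      define b' where "b' = b - int p ^ k * (c * x)"
      have "b'\<^sup>2 - b' + 1 = (b\<^sup>2 - b + 1) - int p ^ k * (c * x) * (2 * b - 1) + (int p ^ k * (c * x))\<^sup>2"
        unfolding b'_def by (simp add: power2_eq_square algebra_simps)
      also have "\<dots> = int p ^ k * (- c * ((2 * b - 1) * x - 1)) + int p ^ k * int p ^ k * (c * x)\<^sup>2"
        unfolding b by (simp add: power2_eq_square algebra_simps)
      finally have "b'\<^sup>2 - b' + 1 = \<dots>" .
      moreover have "int p ^ Suc k dvd int p ^ k * (- c * ((2 * b - 1) * x - 1))"
        using x by (simp add: mult.commute mult_dvd_mono)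
      moreover have "int p ^ Suc k dvd int p ^ k * int p ^ k * (c * x)\<^sup>2"
        unfolding power_Suc2 using False by (intro dvd_mult2 mult_dvd_mono dvd_refl dvd_power) simp_all
      ultimately have "int p ^ Suc k dvd b'\<^sup>2 - b' + 1" by (simp only: dvd_add)
      then show ?thesis by blast
    qed
  qed
qed

text \<open>With b also 1 - b is a root, and the values at c and b differ by (c - b) (c - (1 - b)).
  The factors differ by 2 b - 1, which is prime to p, so p^k divides one of them.\<close>

lemma card_eisenstein_roots_power_1_mod_3:
  assumes p: "prime p" "[p = 1] (mod 3)" and k: "k > 0"
  shows "card (eisenstein_roots (p ^ k)) = 2"
proof -
  define n where "n = int (p ^ k)"
  have pp: "prime (int p)" using p by simp
  have n: "n > 1" using p k prime_gt_1_nat[of p] by (simp add: n_def one_less_power)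
  have p_n: "int p dvd n" using k by (simp add: n_def dvd_power)
  have p_ndvd3: "\<not> int p dvd 3" using prime_1_mod_3_not_dvd_3[OF p] .
  have disc: "\<not> int p dvd 2 * b - 1" if "n dvd b\<^sup>2 - b + 1" for b :: int
  proof
    assume "int p dvd 2 * b - 1"
    then have "int p dvd (2 * b - 1) * (2 * b - 1)" by simp
    moreover have "int p dvd 4 * (b\<^sup>2 - b + 1)" using dvd_trans[OF p_n that] by (rule dvd_mult)
    ultimately have "int p dvd 4 * (b\<^sup>2 - b + 1) - (2 * b - 1) * (2 * b - 1)" by (rule dvd_diff[rotated])
    also have "4 * (b\<^sup>2 - b + 1) - (2 * b - 1) * (2 * b - 1) = 3"
      by (simp add: power2_eq_square algebra_simps)
    finally show False using p_ndvd3 by simp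
  qed
  obtain b0 where b0: "n dvd b0\<^sup>2 - b0 + 1"
    using eisenstein_root_prime_power_exists[OF p, of k] by (auto simp: n_def)
  define b where "b = b0 mod n"
  define b' where "b' = (1 - b) mod n"
  have "[b\<^sup>2 - b + 1 = b0\<^sup>2 - b0 + 1] (mod n)"
    unfolding b_def by (intro cong_add cong_diff cong_pow cong_refl cong_mod_leftI)
  then have b: "n dvd b\<^sup>2 - b + 1" "0 \<le> b" "b < n"
    using b0 n by (auto simp: cong_dvd_iff b_def)
  have "[b'\<^sup>2 - b' + 1 = (1 - b)\<^sup>2 - (1 - b) + 1] (mod n)"
    unfolding b'_def by (intro cong_add cong_diff cong_pow cong_refl cong_mod_leftI)
  moreover have "(1 - b)\<^sup>2 - (1 - b) + 1 = b\<^sup>2 - b + 1" by (simp add: power2_eq_square algebra_simps)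
  ultimately have b': "n dvd b'\<^sup>2 - b' + 1" "0 \<le> b'" "b' < n"
    using b n by (auto simp: cong_dvd_iff b'_def)
  have b'_cong: "n dvd b' - (1 - b)"
    by (simp add: b'_def flip: cong_iff_dvd_diff)
  have "b \<noteq> b'"
  proof
    assume "b = b'"
    then have "n dvd 2 * b - 1" using b'_cong by (simp add: algebra_simps)
    then show False using disc[OF b(1)] dvd_trans[OF p_n] by blast
  qed
  have "c = b \<or> c = b'" if c: "n dvd c\<^sup>2 - c + 1" "0 \<le> c" "c < n" for c
  proof -
    have "n dvd (c\<^sup>2 - c + 1) - (b\<^sup>2 - b + 1)" using b c by (intro dvd_diff)
    also have "(c\<^sup>2 - c + 1) - (b\<^sup>2 - b + 1) = (c - b) * (c - (1 - b))"
      by (simp add: power2_eq_square algebra_simps)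
    finally have prod: "n dvd (c - b) * (c - (1 - b))" .
    have "\<not> (int p dvd c - b \<and> int p dvd c - (1 - b))"
    proof
      assume "int p dvd c - b \<and> int p dvd c - (1 - b)"
      then have "int p dvd (c - (1 - b)) - (c - b)" using dvd_diff by blast
      then show False using disc[OF b(1)] by (simp add: algebra_simps)
    qed
    then have "coprime n (c - b) \<or> coprime n (c - (1 - b))"
      using prime_imp_coprime[OF pp, of "c - b"] prime_imp_coprime[OF pp, of "c - (1 - b)"] by (auto simp: n_def)
    then have "n dvd c - b \<or> n dvd c - (1 - b)"
      using prod by (auto simp: coprime_dvd_mult_right_iff coprime_dvd_mult_left_iff)
    moreover have "n dvd c - b'" if "n dvd c - (1 - b)"
      using dvd_diff[OF that b'_cong] by simp
    ultimately have "[c = b] (mod n) \<or> [c = b'] (mod n)" by (auto simp: cong_iff_dvd_diff)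
    then show ?thesis using b b' c cong_less_imp_eq_int by blast
  qed
  then have "{c. 0 \<le> c \<and> c < n \<and> n dvd c\<^sup>2 - c + 1} = {b, b'}" using b b' by auto
  moreover have "int ` eisenstein_roots (p ^ k) = {c. 0 \<le> c \<and> c < n \<and> n dvd c\<^sup>2 - c + 1}"
  proof safe
    fix c :: int assume c: "0 \<le> c" "c < n" "n dvd c\<^sup>2 - c + 1"
    then have "nat c \<in> eisenstein_roots (p ^ k)"
      by (simp add: eisenstein_roots_def nat_less_iff n_def)
    then show "c \<in> int ` eisenstein_roots (p ^ k)"
      using c(1) by (intro image_eqI[of _ _ "nat c"]) auto
  qed (auto simp: eisenstein_roots_def n_def)
  ultimately have "card (int ` eisenstein_roots (p ^ k)) = 2" using \<open>b \<noteq> b'\<close> by simp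
  then show ?thesis by (simp add: card_image)
qed

text \<open>An ideal of norm \<open>n\<close> is \<open>d\<close> times a primitive ideal of norm \<open>n / d\<^sup>2\<close>, and primitive ideals
  of norm \<open>a\<close> correspond to the roots of \<open>x\<^sup>2 - x + 1\<close> modulo \<open>a\<close>.\<close>

definition eisenstein_ideals :: "nat \<Rightarrow> nat" where
  "eisenstein_ideals =
     dirichlet_conv (\<lambda>d. if is_square d then 1 else 0) (\<lambda>n. card (eisenstein_roots n))"

lemma multiplicative_eisenstein_ideals: "multiplicative eisenstein_ideals"
  unfolding eisenstein_ideals_def
proof (rule multiplicative_dirichlet_conv)
  show "multiplicative (\<lambda>d. if is_square d then 1 else 0)"
    by (auto simp: multiplicative_def is_nth_power_mult_coprime_nat_iff)
qed (rule multiplicative_card_eisenstein_roots)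

lemma is_square_prime_power: "prime p \<Longrightarrow> is_square (p ^ j) \<longleftrightarrow> even j" for p :: nat
  by (simp add: is_nth_power_prime_power_nat_iff)

lemma eisenstein_ideals_prime_power:
  assumes "prime p"
  shows "eisenstein_ideals (p ^ k) = (\<Sum>j\<le>k. if even j then card (eisenstein_roots (p ^ (k - j))) else 0)"
  unfolding eisenstein_ideals_def dirichlet_conv_prime_power[OF assms]
  by (intro sum.cong) (auto simp: is_square_prime_power[OF assms])

text \<open>An ideal of norm p^(k+2) is primitive or p times an ideal of norm p^k. In the sum, j = 0
  gives the primitive ones, j = 1 vanishes and the rest is the sum for k.\<close>

lemma eisenstein_ideals_power_reduce:
  assumes "prime p"
  shows "eisenstein_ideals (p ^ Suc (Suc k)) = card (eisenstein_roots (p ^ Suc (Suc k))) + eisenstein_ideals (p ^ k)"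
proof -
  have "(\<Sum>j\<le>Suc (Suc k). if even j then card (eisenstein_roots (p ^ (Suc (Suc k) - j))) else 0)
    = card (eisenstein_roots (p ^ Suc (Suc k))) + (\<Sum>j\<le>k. if even j then card (eisenstein_roots (p ^ (k - j))) else 0)"
    by (simp add: sum.atMost_Suc_shift del: sum.atMost_Suc cong: if_cong)
  then show ?thesis by (simp only: eisenstein_ideals_prime_power[OF assms])
qed

lemma card_eisenstein_roots_1: "card (eisenstein_roots (Suc 0)) = 1"
  using multiplicative_card_eisenstein_roots by (simp add: multiplicative_def)

lemma eisenstein_ideals_power_3: "eisenstein_ideals (3 ^ k) = 1"
proof (induction k rule: induct_nat_012)
  case (ge2 n)
  then show ?case
    using eisenstein_ideals_power_reduce[of 3 n] by (simp add: card_eisenstein_roots_power_3 del: power_Suc)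
qed (use card_eisenstein_roots_power_3[of 1] card_eisenstein_roots_1 in
      \<open>simp_all add: eisenstein_ideals_prime_power[of 3 0, simplified] eisenstein_ideals_prime_power[of 3 1, simplified]\<close>)

lemma eisenstein_ideals_power_1_mod_3:
  assumes "prime p" "[p = 1] (mod 3)"
  shows "eisenstein_ideals (p ^ k) = k + 1"
proof (induction k rule: induct_nat_012)
  case (ge2 n)
  then show ?case
    using eisenstein_ideals_power_reduce[of p n] card_eisenstein_roots_power_1_mod_3[OF assms, of "Suc (Suc n)"] assms
    by (simp del: power_Suc)
qed (use card_eisenstein_roots_power_1_mod_3[OF assms, of 1] card_eisenstein_roots_1 assms in
      \<open>simp_all add: eisenstein_ideals_prime_power[of p 0, simplified] eisenstein_ideals_prime_power[of p 1, simplified]\<close>)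

text \<open>An inert prime has no primitive ideal whose norm is a positive power of q; only the
  powers of (q), of norm q^(2j), remain.\<close>

lemma eisenstein_ideals_power_2_mod_3:
  assumes "prime q" "[q = 2] (mod 3)"
  shows "eisenstein_ideals (q ^ k) = (if even k then 1 else 0)"
proof (induction k rule: induct_nat_012)
  case (ge2 n)
  then show ?case
    using eisenstein_ideals_power_reduce[of q n] eisenstein_roots_power_2_mod_3[OF assms, of "Suc (Suc n)"] assms
    by (simp del: power_Suc)
qed (use eisenstein_roots_power_2_mod_3[OF assms, of 1] card_eisenstein_roots_1 assms in
      \<open>simp_all add: eisenstein_ideals_prime_power[of q 0, simplified] eisenstein_ideals_prime_power[of q 1, simplified]\<close>)

text \<open>Stated for arbitrary \<open>f\<close> because it is applied both to
  \<open>divisor_sum\<close> and to \<open>eisenstein_ideals\<close>.\<close>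

lemma multiplicative_factorization_mod_3:
  fixes p k q l :: "nat \<Rightarrow> nat"
  assumes f: "multiplicative f"
    and p: "inj_on p {1..r}" "\<And>i. i \<in> {1..r} \<Longrightarrow> prime (p i) \<and> [p i = 1] (mod 3)"
    and q: "inj_on q {1..s}" "\<And>j. j \<in> {1..s} \<Longrightarrow> prime (q j) \<and> [q j = 2] (mod 3)"
  shows "f (3 ^ m * (\<Prod>i=1..r. p i ^ k i) * (\<Prod>j=1..s. q j ^ l j)) =
    f (3 ^ m) * (\<Prod>i=1..r. f (p i ^ k i)) * (\<Prod>j=1..s. f (q j ^ l j))"
proof -
  have cop: "coprime (x ^ a) (y ^ b)" if "prime x" "prime y" "x \<noteq> y" for x y a b :: nat
    using that by (simp add: primes_coprime)
  have p3: "p i \<noteq> 3" if "i \<in> {1..r}" for i using p(2)[OF that] by (auto simp: cong_def)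
  have q3: "q j \<noteq> 3" if "j \<in> {1..s}" for j using q(2)[OF that] by (auto simp: cong_def)
  have pq: "p i \<noteq> q j" if "i \<in> {1..r}" "j \<in> {1..s}" for i j
    using p(2)[OF that(1)] q(2)[OF that(2)] by (auto simp: cong_def)
  have pos: "p i ^ k i > 0" if "i \<in> {1..r}" for i using prime_gt_0_nat p(2)[OF that] by simp
  have pos': "q j ^ l j > 0" if "j \<in> {1..s}" for j using prime_gt_0_nat q(2)[OF that] by simp
  let ?P = "\<Prod>i=1..r. p i ^ k i" and ?Q = "\<Prod>j=1..s. q j ^ l j"
  have P: "?P > 0" and Q: "?Q > 0" using pos pos' by (blast intro: prod_pos)+
  have "f ?P = (\<Prod>i=1..r. f (p i ^ k i))"
  proof (rule multiplicative_prod[OF f _ pos])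
    fix i j assume ij: "i \<in> {1..r}" "j \<in> {1..r}" "i \<noteq> j"
    show "coprime (p i ^ k i) (p j ^ k j)"
      using p(2)[OF ij(1)] p(2)[OF ij(2)] inj_onD[OF p(1) _ ij(1,2)] ij(3) by (blast intro: cop)
  qed simp
  moreover have "f ?Q = (\<Prod>j=1..s. f (q j ^ l j))"
  proof (rule multiplicative_prod[OF f _ pos'])
    fix i j assume ij: "i \<in> {1..s}" "j \<in> {1..s}" "i \<noteq> j"
    show "coprime (q i ^ l i) (q j ^ l j)"
      using q(2)[OF ij(1)] q(2)[OF ij(2)] inj_onD[OF q(1) _ ij(1,2)] ij(3) by (blast intro: cop)
  qed simp
  moreover have "coprime (3 ^ m * ?P) ?Q"
  proof (rule prod_coprime_right)
    fix j assume j: "j \<in> {1..s}"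
    have "coprime ?P (q j ^ l j)"
    proof (rule prod_coprime_left)
      fix i assume i: "i \<in> {1..r}"
      show "coprime (p i ^ k i) (q j ^ l j)"
        using p(2)[OF i] q(2)[OF j] pq[OF i j] by (blast intro: cop)
    qed
    moreover have "coprime (3 ^ m) (q j ^ l j)"
      using q(2)[OF j] q3[OF j] by (intro cop) auto
    ultimately show "coprime (3 ^ m * ?P) (q j ^ l j)" by (simp only: coprime_mult_left_iff)
  qed
  then have "f (3 ^ m * ?P * ?Q) = f (3 ^ m * ?P) * f ?Q"
    using P Q by (intro multiplicative_mult[OF f]) simp_all
  moreover have "coprime (3 ^ m) ?P"
  proof (rule prod_coprime_right)
    fix i assume i: "i \<in> {1..r}"
    show "coprime (3 ^ m) (p i ^ k i)"
      using p(2)[OF i] p3[OF i] by (intro cop) auto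
  qed
  then have "f (3 ^ m * ?P) = f (3 ^ m) * f ?P"
    using P by (intro multiplicative_mult[OF f]) simp_all
  ultimately show ?thesis by simp
qed

section \<open>Sublattices of the triangular lattice\<close>

definition subgroup2 :: "(int \<times> int) set \<Rightarrow> bool" where
  "subgroup2 K \<longleftrightarrow> 0 \<in> K \<and> (\<forall>s\<in>K. \<forall>t\<in>K. s - t \<in> K)"

lemma subgroup2_0: "subgroup2 K \<Longrightarrow> 0 \<in> K"
  and subgroup2_diff: "subgroup2 K \<Longrightarrow> s \<in> K \<Longrightarrow> t \<in> K \<Longrightarrow> s - t \<in> K"
  by (simp_all add: subgroup2_def)

lemma subgroup2_uminus: "subgroup2 K \<Longrightarrow> t \<in> K \<Longrightarrow> - t \<in> K"
  using subgroup2_diff[of K 0 t] subgroup2_0[of K] by simp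

lemma subgroup2_uminus_iff: "subgroup2 K \<Longrightarrow> - t \<in> K \<longleftrightarrow> t \<in> K"
  using subgroup2_uminus[of K t] subgroup2_uminus[of K "- t"] by auto

lemma subgroup2_add: "subgroup2 K \<Longrightarrow> s \<in> K \<Longrightarrow> t \<in> K \<Longrightarrow> s + t \<in> K"
  using subgroup2_diff[of K s "- t"] subgroup2_uminus[of K t] by simp

text \<open>The lattice generated by \<open>(a, 0)\<close> and \<open>(b, d)\<close>.\<close>

definition lattice :: "int \<Rightarrow> int \<Rightarrow> int \<Rightarrow> (int \<times> int) set" where
  "lattice a b d = {(x, y). \<exists>j. y = j * d \<and> a dvd x - j * b}"

text \<open>Sublattices of index n in Hermite normal form: a d is the determinant of the generators,
  and the bounds on b leave one triple per sublattice (\<open>lattice_inject\<close>).\<close>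

definition lattices :: "nat \<Rightarrow> (int \<times> int) set set" where
  "lattices n = {lattice a b d | a b d. 0 < a \<and> 0 < d \<and> 0 \<le> b \<and> b < a \<and> a * d = int n}"

lemma in_latticeI: "y = j * d \<Longrightarrow> a dvd x - j * b \<Longrightarrow> (x, y) \<in> lattice a b d"
  by (auto simp: lattice_def)

lemma in_lattice_iff: "t \<in> lattice a b d \<longleftrightarrow> (\<exists>j. snd t = j * d \<and> a dvd fst t - j * b)"
  by (simp add: lattice_def case_prod_unfold)

lemma in_latticeE:
  assumes "t \<in> lattice a b d"
  obtains j where "snd t = j * d" "a dvd fst t - j * b"
  using assms that unfolding in_lattice_iff by blast

lemma lattice_generators: "(a, 0) \<in> lattice a b d" "(b, d) \<in> lattice a b d"
  by (auto intro: in_latticeI[of _ 0] in_latticeI[of _ 1])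

lemma subgroup2_lattice: "subgroup2 (lattice a b d)"
  unfolding subgroup2_def
proof (intro conjI ballI)
  show "0 \<in> lattice a b d" unfolding zero_prod_def by (rule in_latticeI[of _ 0]) auto
  fix s t assume "s \<in> lattice a b d" "t \<in> lattice a b d"
  then obtain i j where "snd s = i * d" "a dvd fst s - i * b" "snd t = j * d" "a dvd fst t - j * b"
    by (auto elim!: in_latticeE)
  then have "snd (s - t) = (i - j) * d \<and> a dvd fst (s - t) - (i - j) * b"
    using dvd_diff[of a "fst s - i * b" "fst t - j * b"] by (simp add: algebra_simps)
  then show "s - t \<in> lattice a b d" unfolding in_lattice_iff by blast
qed

lemma subgroup2_lattices: "K \<in> lattices n \<Longrightarrow> subgroup2 K"
  by (auto simp: lattices_def subgroup2_lattice)

lemma int_subgroup_principal: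
  fixes S :: "int set"
  assumes diff: "\<And>x y. x \<in> S \<Longrightarrow> y \<in> S \<Longrightarrow> x - y \<in> S" and N: "N \<in> S" "N > 0"
  shows "\<exists>d>0. S = {x. d dvd x}"
proof -
  define d where "d = int (LEAST n. n > 0 \<and> int n \<in> S)"
  have "d > 0 \<and> d \<in> S"
    using LeastI[of "\<lambda>n. n > 0 \<and> int n \<in> S" "nat N"] N by (simp add: d_def)
  then have d: "d > 0" "d \<in> S" by auto
  have least: "d \<le> x" if "x > 0" "x \<in> S" for x
    using Least_le[of "\<lambda>n. n > 0 \<and> int n \<in> S" "nat x"] that by (simp add: d_def)
  have zero: "0 \<in> S" using diff[OF d(2) d(2)] by simp
  have neg: "- x \<in> S" if "x \<in> S" for x using diff[OF zero that] by simp
  have mult_nat: "int k * d \<in> S" for k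
  proof (induction k)
    case (Suc k)
    then show ?case using diff[OF Suc neg[OF d(2)]] by (simp add: algebra_simps)
  qed (simp add: zero)
  have mult: "k * d \<in> S" for k
    using mult_nat[of "nat k"] neg[OF mult_nat[of "nat (- k)"]] by (cases "k \<ge> 0") auto
  have "d dvd x" if "x \<in> S" for x
  proof -
    have "x mod d = x - (x div d) * d" by (simp add: minus_div_mult_eq_mod)
    then have "x mod d \<in> S" using diff[OF that mult] by simp
    moreover have "x mod d < d" "x mod d \<ge> 0" using d by auto
    ultimately have "x mod d = 0" using least[of "x mod d"] by force
    then show ?thesis by auto
  qed
  moreover have "x \<in> S" if "d dvd x" for x using that mult by (auto simp: mult.commute)
  ultimately show ?thesis using d by blast
qed

text \<open>The two axis vectors express finite index: they make the intersection with the first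
  axis and the projection to the second coordinate nonzero subgroups of the integers. These are
  generated by a and d, and b comes from a vector of K above d, reduced modulo a.\<close>

lemma hermite_normal_form_exists:
  assumes K: "subgroup2 K" and "(M, 0) \<in> K" "M > 0" "(0, N) \<in> K" "N > 0"
  shows "\<exists>a b d. 0 < a \<and> 0 < d \<and> 0 \<le> b \<and> b < a \<and> K = lattice a b d"
proof -
  have diff: "(x - x', y - y') \<in> K" if "(x, y) \<in> K" "(x', y') \<in> K" for x y x' y'
    using subgroup2_diff[OF K that] by simp
  have "\<exists>a>0. {x. (x, 0) \<in> K} = {x. a dvd x}"
  proof (rule int_subgroup_principal)
    show "x - y \<in> {x. (x, 0) \<in> K}" if "x \<in> {x. (x, 0) \<in> K}" "y \<in> {x. (x, 0) \<in> K}" for x y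
      using diff[of x 0 y 0] that by simp
  qed (use assms in simp_all)
  then obtain a where a: "a > 0" "{x. (x, 0) \<in> K} = {x. a dvd x}" by blast
  have "\<exists>d>0. {y. \<exists>x. (x, y) \<in> K} = {y. d dvd y}"
  proof (rule int_subgroup_principal)
    show "y - y' \<in> {y. \<exists>x. (x, y) \<in> K}" if y: "y \<in> {y. \<exists>x. (x, y) \<in> K}" "y' \<in> {y. \<exists>x. (x, y) \<in> K}" for y y'
    proof -
      obtain x x' where "(x, y) \<in> K" "(x', y') \<in> K" using y by blast
      then show ?thesis using diff by blast
    qed
    show "N \<in> {y. \<exists>x. (x, y) \<in> K}" using assms by blast
  qed (fact \<open>N > 0\<close>)
  then obtain d where d: "d > 0" "{y. \<exists>x. (x, y) \<in> K} = {y. d dvd y}" by blast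
  have "d \<in> {y. \<exists>x. (x, y) \<in> K}" unfolding d(2) by simp
  then obtain b0 where b0: "(b0, d) \<in> K" by blast
  define b where "b = b0 mod a"
  have "b0 div a * a \<in> {x. (x, 0) \<in> K}" unfolding a(2) by simp
  then have "(b0 div a * a, 0) \<in> K" by simp
  then have b: "(b, d) \<in> K" using diff[OF b0, of "b0 div a * a" 0] by (simp add: b_def minus_div_mult_eq_mod)
  have mult_nat: "(int k * b, int k * d) \<in> K" for k
  proof (induction k)
    case 0
    then show ?case using subgroup2_0[OF K] by (simp add: zero_prod_def)
  next
    case (Suc k)
    then show ?case using subgroup2_add[OF K Suc b] by (simp add: algebra_simps)
  qed
  have mult: "(k * b, k * d) \<in> K" for k
    using mult_nat[of "nat k"] subgroup2_uminus[OF K mult_nat[of "nat (- k)"]] by (cases "k \<ge> 0") auto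
  have "(x, y) \<in> K \<longleftrightarrow> (x, y) \<in> lattice a b d" for x y
  proof
    assume xy: "(x, y) \<in> K"
    then have "d dvd y" using d(2) by blast
    then obtain j where j: "y = j * d" by (metis dvdE mult.commute)
    have "(x - j * b, 0) \<in> K" using diff[OF xy mult[of j]] j by simp
    then have "a dvd x - j * b" using a(2) by auto
    then show "(x, y) \<in> lattice a b d" using j by (intro in_latticeI)
  next
    assume "(x, y) \<in> lattice a b d"
    then have "\<exists>j. y = j * d \<and> a dvd x - j * b" by (simp only: in_lattice_iff fst_conv snd_conv)
    then obtain j where j: "y = j * d" "a dvd x - j * b" by blast
    then have "(x - j * b, 0) \<in> K" using a(2) by auto
    then show "(x, y) \<in> K" using subgroup2_add[OF K _ mult[of j], of "(x - j * b, 0)"] j by simp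
  qed
  then have "K = lattice a b d" by auto
  then show ?thesis using a d by (intro exI[of _ a] exI[of _ b] exI[of _ d]) (simp add: b_def)
qed

lemma lattice_inject:
  assumes "0 < a" "0 < d" "0 \<le> b" "b < a" "0 < a'" "0 < d'" "0 \<le> b'" "b' < a'"
    and eq: "lattice a b d = lattice a' b' d'"
  shows "a = a' \<and> b = b' \<and> d = d'"
proof -
  have *: "d' dvd d \<and> a' dvd a" if "lattice a b d = lattice a' b' d'" "d' > 0" for a b d a' b' d'
  proof -
    have "(b, d) \<in> lattice a' b' d'" "(a, 0) \<in> lattice a' b' d'"
      unfolding that(1)[symmetric] by (rule lattice_generators)+
    then show ?thesis using that(2) by (auto elim!: in_latticeE)
  qed
  have d: "d = d'" and a: "a = a'"
    using *[OF eq] *[OF eq[symmetric]] assms by (auto intro: zdvd_antisym_nonneg)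
  have "(b, d) \<in> lattice a' b' d'" unfolding eq[symmetric] by (rule lattice_generators)
  then have "a dvd b - b'" using d a assms by (auto elim!: in_latticeE)
  then have "[b = b'] (mod a)" by (simp add: cong_iff_dvd_diff)
  then have "b = b'" using assms a cong_less_imp_eq_int by blast
  then show ?thesis using d a by simp
qed

text \<open>A divisor a of n determines d and leaves a choices for b.\<close>

lemma card_lattices:
  assumes "n > 0"
  shows "card (lattices n) = divisor_sum n"
proof -
  let ?I = "SIGMA a:{a. a dvd n}. {..<a}"
  let ?f = "\<lambda>(a, b). lattice (int a) (int b) (int (n div a))"
  have pos: "0 < a \<and> 0 < n div a" if "a dvd n" for a
    using that assms by (auto intro!: Nat.gr0I simp: dvd_div_eq_0_iff)
  have "inj_on ?f ?I"
  proof (rule inj_onI, clarify)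
    fix a b a' b'
    assume *: "a dvd n" "a' dvd n" "b < a" "b' < a'"
      "lattice (int a) (int b) (int (n div a)) = lattice (int a') (int b') (int (n div a'))"
    then show "a = a' \<and> b = b'"
      using lattice_inject[OF _ _ _ _ _ _ _ _ *(5)] pos[of a] pos[of a'] by auto
  qed
  moreover have "?f ` ?I = lattices n"
  proof (intro equalityI subsetI)
    fix K assume "K \<in> ?f ` ?I"
    then obtain a b where ab: "a dvd n" "b < a" "K = lattice (int a) (int b) (int (n div a))" by auto
    then show "K \<in> lattices n"
      using pos[of a] unfolding lattices_def
      by (intro CollectI exI[of _ "int a"] exI[of _ "int b"] exI[of _ "int (n div a)"])
         (simp flip: of_nat_mult)
  next
    fix K assume "K \<in> lattices n"
    then obtain a b d where K: "0 < a" "0 < d" "0 \<le> b" "b < a" "a * d = int n" "K = lattice a b d"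
      by (auto simp: lattices_def)
    define A B D where "A = nat a" and "B = nat b" and "D = nat d"
    have ABD: "a = int A" "b = int B" "d = int D" using K by (auto simp: A_def B_def D_def)
    have "A * D = n" using K(5) unfolding ABD by (simp flip: of_nat_mult)
    then have "A dvd n" "n div A = D" using K(1) ABD by auto
    then show "K \<in> ?f ` ?I"
      using K ABD by (intro image_eqI[of _ _ "(A, B)"]) auto
  qed
  ultimately have "card (lattices n) = card ?I" using card_image by fastforce
  also have "\<dots> = (\<Sum>a | a dvd n. a)" using assms by (subst card_SigmaI) auto
  finally show ?thesis by (simp add: divisor_sum_def dirichlet_conv_def)
qed

text \<open>Rotation by \<open>60\<close> degrees of the triangular lattice, in the basis of two unit vectors at
  an angle of \<open>120\<close> degrees.\<close>

definition rot :: "int \<times> int \<Rightarrow> int \<times> int" where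
  "rot t = (fst t - snd t, fst t)"

lemma rot_add: "rot (s + t) = rot s + rot t"
  and rot_diff: "rot (s - t) = rot s - rot t"
  and rot_uminus: "rot (- t) = - rot t"
  and rot_zero: "rot 0 = 0"
  by (simp_all add: rot_def prod_eq_iff)

lemma rot_rot_rot: "rot (rot (rot t)) = - t"
  by (simp add: rot_def prod_eq_iff)

lemma bij_rot: "bij rot"
proof (rule o_bij)
  show "(\<lambda>t. - rot (rot t)) \<circ> rot = id" "rot \<circ> (\<lambda>t. - rot (rot t)) = id"
    by (auto simp: rot_def prod_eq_iff)
qed

lemma subgroup2_vimage_rot: "subgroup2 K \<Longrightarrow> subgroup2 (rot -` K)"
  by (simp add: subgroup2_def rot_diff rot_zero)

lemma vimage_rot_cubed:
  assumes "subgroup2 K"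
  shows "rot -` (rot -` (rot -` K)) = K"
proof (rule Set.set_eqI)
  fix t
  show "t \<in> rot -` (rot -` (rot -` K)) \<longleftrightarrow> t \<in> K"
    by (simp only: vimage_eq rot_rot_rot subgroup2_uminus_iff[OF assms])
qed

text \<open>The generators go to (a, a) and (b - d, b). Their second coordinates force a = d i and b
  = d j. For the second image it remains that d i divides b - d - j b, which is -d (j^2 - j +
  1).\<close>

lemma rot_invariant_lattice_iff:
  assumes "0 < a" "0 < d"
  shows "rot -` lattice a b d = lattice a b d \<longleftrightarrow>
    d dvd a \<and> d dvd b \<and> a div d dvd (b div d)\<^sup>2 - b div d + 1" (is "?L \<longleftrightarrow> ?R")
proof
  assume L: ?L
  have "(a, 0) \<in> rot -` lattice a b d" "(b, d) \<in> rot -` lattice a b d"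
    unfolding L by (rule lattice_generators)+
  then have "rot (a, 0) \<in> lattice a b d" "rot (b, d) \<in> lattice a b d" by simp_all
  then have "\<exists>i. a = i * d" "\<exists>j. b = j * d \<and> a dvd b - d - j * b"
    unfolding in_lattice_iff rot_def fst_conv snd_conv by blast+
  then obtain i j where ij: "a = i * d" "b = j * d" "a dvd b - d - j * b" by blast
  have "d * (j\<^sup>2 - j + 1) = - (b - d - j * b)"
    unfolding ij(2) by (simp add: power2_eq_square algebra_simps)
  then have "d * i dvd d * (j\<^sup>2 - j + 1)"
    using ij(1,3) by (simp only: dvd_minus_iff mult.commute)
  then have "i dvd j\<^sup>2 - j + 1" using assms by simp
  then show ?R using ij assms by simp
next
  assume R: ?R
  define i j where "i = a div d" and "j = b div d"
  have ij: "a = d * i" "b = d * j" "i dvd j\<^sup>2 - j + 1"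
    using R by (simp_all add: i_def j_def)
  have rot_in: "rot t \<in> lattice a b d" if "t \<in> lattice a b d" for t
  proof -
    obtain k l where kl: "snd t = k * d" "fst t - k * b = a * l"
      using \<open>t \<in> lattice a b d\<close> unfolding in_lattice_iff dvd_def by blast
    then have fst_t: "fst t = k * b + a * l" by simp
    have "fst t - snd t - (k * j + i * l) * b = d * (- k * (j\<^sup>2 - j + 1) + i * l * (1 - j))"
      unfolding kl(1) fst_t ij(1,2) by (simp add: power2_eq_square algebra_simps)
    moreover have "i dvd - k * (j\<^sup>2 - j + 1) + i * l * (1 - j)" using ij by simp
    ultimately have "a dvd fst t - snd t - (k * j + i * l) * b" by (simp add: ij(1) mult_dvd_mono)
    moreover have "fst t = (k * j + i * l) * d" unfolding fst_t ij(1,2) by (simp add: algebra_simps)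
    ultimately show ?thesis unfolding rot_def by (intro in_latticeI)
  qed
  \<comment> \<open>Two further rotations take \<open>rot t\<close> to \<open>- t\<close>, so
    invariance in one direction gives the other.\<close>
  have "t \<in> lattice a b d" if "rot t \<in> lattice a b d" for t
    using rot_in[OF rot_in[OF that]] subgroup2_uminus_iff[OF subgroup2_lattice] by (simp add: rot_rot_rot)
  then show ?L using rot_in by auto
qed

text \<open>An invariant lattice is d times one with normal form (i, j, 1), where j is a root modulo
  i and n = i d^2. Reindexing the sum over d by the squares e = d^2 dividing n turns it into the
  convolution \<open>eisenstein_ideals\<close>.\<close>

lemma card_rot_invariant_lattices:
  assumes "n > 0"
  shows "card {K \<in> lattices n. rot -` K = K} = eisenstein_ideals n"
proof -
  let ?D = "{d. d\<^sup>2 dvd n}"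
  let ?I = "SIGMA d:?D. eisenstein_roots (n div d\<^sup>2)"
  let ?f = "\<lambda>(d, b). lattice (int (d * (n div d\<^sup>2))) (int (d * b)) (int d)"
  have pos: "0 < d \<and> 0 < n div d\<^sup>2" if "d\<^sup>2 dvd n" for d
    using that assms by (auto intro!: Nat.gr0I simp: dvd_div_eq_0_iff)
  have finD: "finite ?D"
  proof (rule finite_subset)
    show "?D \<subseteq> {..n}"
    proof
      fix d assume "d \<in> ?D"
      then have "d\<^sup>2 \<le> n" using assms by (auto intro: dvd_imp_le)
      then show "d \<in> {..n}" using self_le_power[of d 2] by (cases "d = 0") auto
    qed
  qed simp
  have "inj_on ?f ?I"
  proof (rule inj_onI, clarify)
    fix d b d' b'
    assume *: "d\<^sup>2 dvd n" "d'\<^sup>2 dvd n" "b \<in> eisenstein_roots (n div d\<^sup>2)" "b' \<in> eisenstein_roots (n div d'\<^sup>2)"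
      "lattice (int (d * (n div d\<^sup>2))) (int (d * b)) (int d) = lattice (int (d' * (n div d'\<^sup>2))) (int (d' * b')) (int d')"
    show "d = d' \<and> b = b'"
      using lattice_inject[OF _ _ _ _ _ _ _ _ *(5)] pos[of d] pos[of d'] *(1-4)
      by (auto simp: eisenstein_roots_def)
  qed
  moreover have "?f ` ?I = {K \<in> lattices n. rot -` K = K}"
  proof (intro equalityI subsetI)
    fix K assume "K \<in> ?f ` ?I"
    then obtain d b where db: "d\<^sup>2 dvd n" "b \<in> eisenstein_roots (n div d\<^sup>2)"
      "K = lattice (int (d * (n div d\<^sup>2))) (int (d * b)) (int d)" by auto
    define a where "a = n div d\<^sup>2"
    have "n = a * d\<^sup>2" using dvd_div_mult_self[OF db(1)] by (simp add: a_def)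
    then have a: "n = d * a * d" by (simp add: power2_eq_square mult_ac)
    have da: "d > 0" "a > 0" using pos[OF db(1)] by (auto simp: a_def)
    have b: "b < a" "int a dvd (int b)\<^sup>2 - int b + 1" using db(2) by (auto simp: eisenstein_roots_def a_def)
    have K: "K = lattice (int (d * a)) (int (d * b)) (int d)" using db(3) by (simp add: a_def)
    have "K \<in> lattices n"
      unfolding lattices_def K a using da b
      by (intro CollectI exI[of _ "int (d * a)"] exI[of _ "int (d * b)"] exI[of _ "int d"]) simp
    moreover have "rot -` K = K"
      unfolding K using da b by (subst rot_invariant_lattice_iff) auto
    ultimately show "K \<in> {K \<in> lattices n. rot -` K = K}" by simp
  next
    fix K assume "K \<in> {K \<in> lattices n. rot -` K = K}"
    then have "K \<in> lattices n" and inv: "rot -` K = K" by simp_all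
    then obtain a b d where K: "0 < a" "0 < d" "0 \<le> b" "b < a" "a * d = int n" "K = lattice a b d"
      unfolding lattices_def by blast
    have dvd: "d dvd a" "d dvd b" "a div d dvd (b div d)\<^sup>2 - b div d + 1"
      using inv rot_invariant_lattice_iff[OF K(1,2)] unfolding K(6) by blast+
    define i j where "i = a div d" and "j = b div d"
    have ij: "a = d * i" "b = d * j" "i dvd j\<^sup>2 - j + 1"
      using dvd by (simp_all add: i_def j_def)
    have ij_pos: "i > 0" "j \<ge> 0" "j < i"
      using K(1,2) ij(1) K(3,4) ij(2) by (simp_all add: zero_less_mult_iff zero_le_mult_iff)
    define D I J where "D = nat d" and "I = nat i" and "J = nat j"
    have DIJ: "d = int D" "i = int I" "j = int J" using K ij_pos by (auto simp: D_def I_def J_def)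
    have "int (D * I * D) = int n" using K(5) ij(1) DIJ by simp
    then have n: "n = D * I * D" by (simp only: of_nat_eq_iff)
    have D: "D > 0" using K(2) DIJ by simp
    have "D\<^sup>2 dvd n" and I: "n div D\<^sup>2 = I" using D by (auto simp: n power2_eq_square)
    moreover have "J \<in> eisenstein_roots I" using ij ij_pos DIJ by (auto simp: eisenstein_roots_def)
    ultimately show "K \<in> ?f ` ?I"
      using K ij DIJ by (intro image_eqI[of _ _ "(D, J)"]) auto
  qed
  ultimately have "card {K \<in> lattices n. rot -` K = K} = card ?I" using card_image by fastforce
  also have "\<dots> = (\<Sum>d\<in>?D. card (eisenstein_roots (n div d\<^sup>2)))" using finD by (subst card_SigmaI) auto
  also have "\<dots> = (\<Sum>e\<in>(\<lambda>d. d\<^sup>2) ` ?D. card (eisenstein_roots (n div e)))"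
    by (subst sum.reindex) (auto simp: inj_on_def)
  also have "(\<lambda>d. d\<^sup>2) ` ?D = {e \<in> {e. e dvd n}. is_square e}"
    by (auto simp: is_nth_power_def)
  also have "(\<Sum>e\<in>{e \<in> {e. e dvd n}. is_square e}. card (eisenstein_roots (n div e))) = eisenstein_ideals n"
    unfolding eisenstein_ideals_def dirichlet_conv_def using assms
    by (subst sum.inter_filter) (auto intro!: sum.cong)
  finally show ?thesis .
qed

section \<open>Cubic maps\<close>

lemma card_orbit_funpow_dist1:
  assumes "x \<in> orbit f x"
  shows "card (orbit f x) = funpow_dist1 f x x"
  unfolding orbit_conv_funpow_dist1[OF assms]
  using card_image[OF inj_on_funpow_dist1[OF assms]] by simp

lemma card_orbit_eqI:
  assumes "(f ^^ k) x = x" "k > 0" "\<And>j. 0 < j \<Longrightarrow> j < k \<Longrightarrow> (f ^^ j) x \<noteq> x"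
  shows "card (orbit f x) = k"
proof -
  have x: "x \<in> orbit f x" using assms(1,2) funpow_in_orbit[of x f] unfolding orbit_altdef by force
  have "\<not> funpow_dist1 f x x < k" using assms(3) funpow_dist1_prop[OF x] by blast
  moreover have "\<not> k < funpow_dist1 f x x" using funpow_dist1_least assms(1,2) by metis
  ultimately show ?thesis using card_orbit_funpow_dist1[OF x] by simp
qed

lemma funpow_card_orbit:
  assumes "x \<in> orbit f x"
  shows "(f ^^ card (orbit f x)) x = x"
  using funpow_dist1_prop[OF assms] card_orbit_funpow_dist1[OF assms] by simp

lemma funpow_less_card_orbit:
  assumes "x \<in> orbit f x" "0 < j" "j < card (orbit f x)"
  shows "(f ^^ j) x \<noteq> x"
  using funpow_dist1_least[OF assms(2), of f x x] assms(3) card_orbit_funpow_dist1[OF assms(1)] by simp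

text \<open>Double counting with disjoint orbits. It serves for edges (size 2), faces (3 and 6) and
  rotation classes of sublattices (1 and 3).\<close>

lemma card_orbits_of_size:
  assumes "finite A" and f: "f permutes A"
  shows "c * card {X \<in> orbit f ` A. card X = c} = card {x \<in> A. card (orbit f x) = c}"
proof -
  have self: "x \<in> orbit f x" for x
    using assms permutation_permutes permutation_self_in_orbit by metis
  have eq: "orbit f y = orbit f x" if "y \<in> orbit f x" for x y
    using orbit_cyclic_eq3[OF cyclic_on_orbit[OF f \<open>finite A\<close>] that] .
  have sub: "orbit f x \<subseteq> A" if "x \<in> A" for x
    using permutes_orbit_subset[OF f that] .
  have Un: "\<Union>{X \<in> orbit f ` A. card X = c} = {x \<in> A. card (orbit f x) = c}"
  proof (intro equalityI subsetI)
    fix y assume "y \<in> \<Union>{X \<in> orbit f ` A. card X = c}"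
    then obtain x where x: "x \<in> A" "y \<in> orbit f x" "card (orbit f x) = c" by blast
    then show "y \<in> {x \<in> A. card (orbit f x) = c}" using eq[OF x(2)] sub[OF x(1)] by auto
  next
    fix y assume "y \<in> {x \<in> A. card (orbit f x) = c}"
    then show "y \<in> \<Union>{X \<in> orbit f ` A. card X = c}" using self by blast
  qed
  show ?thesis
    unfolding Un[symmetric]
  proof (rule card_partition)
    show "finite (\<Union>{X \<in> orbit f ` A. card X = c})" unfolding Un using assms by simp
    show "X \<inter> Y = {}" if XY: "X \<in> {X \<in> orbit f ` A. card X = c}" "Y \<in> {X \<in> orbit f ` A. card X = c}" "X \<noteq> Y" for X Y
    proof -
      obtain x y where "X = orbit f x" "Y = orbit f y" using XY by blast
      then show ?thesis using eq XY(3) by blast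
    qed
  qed (use assms in auto)
qed

text \<open>Sphericity and face sizes stay outside, so that the locale can be used both for a given
  trihex and for a quotient whose sphericity is still to be proved.\<close>

locale cubic_map =
  fixes M :: "('a, 'b) embedded_graph"
  assumes rotation_system: "rotation_system M"
    and cubic: "\<And>v. v \<in> verts (graph_of M) \<Longrightarrow> out_degree (graph_of M) v = 3"

sublocale cubic_map \<subseteq> bidirected_digraph "graph_of M" "edge_rev M"
  using rotation_system by (simp add: rotation_system_def)

sublocale cubic_map \<subseteq> fin_digraph "graph_of M"
  using rotation_system by (simp add: rotation_system_def)

context cubic_map
begin

abbreviation "A \<equiv> arcs (graph_of M)"
abbreviation "\<alpha> \<equiv> edge_rev M"
abbreviation "\<sigma> \<equiv> edge_succ M"
abbreviation "\<phi> \<equiv> face_succ M"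

lemma succ_permutes: "\<sigma> permutes A"
  using rotation_system by (simp add: rotation_system_def)

lemma face_permutes: "\<phi> permutes A"
proof -
  have "\<phi> = \<sigma> \<circ> \<alpha>" by (simp add: fun_eq_iff face_succ_def)
  then show ?thesis using permutes_compose[OF arev_permutes_arcs succ_permutes] by simp
qed

lemma face_in_arcs_iff: "\<phi> x \<in> A \<longleftrightarrow> x \<in> A"
  using permutes_in_image[OF face_permutes] .

lemma rev_in_arcs_iff: "\<alpha> x \<in> A \<longleftrightarrow> x \<in> A"
  using permutes_in_image[OF arev_permutes_arcs] .

lemma face_rev: "\<phi> (\<alpha> x) = \<sigma> x"
  by (simp add: face_succ_def)

lemma orbit_succ:
  assumes "x \<in> A"
  shows "orbit \<sigma> x = out_arcs (graph_of M) (tail (graph_of M) x)"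
proof (rule orbit_cyclic_eq3)
  show x: "x \<in> out_arcs (graph_of M) (tail (graph_of M) x)" using assms by simp
  have "\<forall>v\<in>verts (graph_of M). out_arcs (graph_of M) v \<noteq> {} \<longrightarrow> cyclic_on \<sigma> (out_arcs (graph_of M) v)"
    using rotation_system by (simp add: rotation_system_def)
  from bspec[OF this tail_in_verts[OF assms]] x
  show "cyclic_on \<sigma> (out_arcs (graph_of M) (tail (graph_of M) x))" by blast
qed

lemma self_in_orbit_succ: "x \<in> A \<Longrightarrow> x \<in> orbit \<sigma> x"
  by (simp add: orbit_succ)

lemma card_orbit_succ: "x \<in> A \<Longrightarrow> card (orbit \<sigma> x) = 3"
  using cubic[of "tail (graph_of M) x"] by (simp add: orbit_succ out_degree_def)

lemma succ_cubed: "\<sigma> (\<sigma> (\<sigma> x)) = x"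
proof (cases "x \<in> A")
  case True
  then show ?thesis
    using funpow_card_orbit[OF self_in_orbit_succ[OF True]]
    by (simp add: card_orbit_succ numeral_3_eq_3)
next
  case False
  then show ?thesis using permutes_not_in[OF succ_permutes] by simp
qed

lemma succ_neq: "x \<in> A \<Longrightarrow> \<sigma> x \<noteq> x"
  using funpow_less_card_orbit[OF self_in_orbit_succ, of x 1] by (simp add: card_orbit_succ)

lemma tail_succ: "x \<in> A \<Longrightarrow> tail (graph_of M) (\<sigma> x) = tail (graph_of M) x"
  using orbit.base[of \<sigma> x] by (simp add: orbit_succ)

text \<open>Vertices are recovered from the arcs as the 3-cycles of \<open>\<sigma>\<close>, so
  later constructions need to handle arcs only.\<close>

lemma tail_eq_iff:
  assumes "x \<in> A" "y \<in> A"
  shows "tail (graph_of M) x = tail (graph_of M) y \<longleftrightarrow> y = x \<or> y = \<sigma> x \<or> y = \<sigma> (\<sigma> x)"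
proof -
  have "tail (graph_of M) x = tail (graph_of M) y \<longleftrightarrow> y \<in> orbit \<sigma> x"
    using assms by (auto simp: orbit_succ)
  also have "orbit \<sigma> x = {x, \<sigma> x, \<sigma> (\<sigma> x)}"
  proof -
    have "orbit \<sigma> x = (\<lambda>n. (\<sigma> ^^ n) x) ` {0..<3}"
      using orbit_conv_funpow_dist1[OF self_in_orbit_succ] card_orbit_funpow_dist1[OF self_in_orbit_succ]
        card_orbit_succ assms(1) by metis
    also have "{0..<3} = {0, 1, 2::nat}" by auto
    finally show ?thesis by (simp add: numeral_2_eq_2)
  qed
  finally show ?thesis by simp
qed

lemma out_arc_exists:
  assumes "v \<in> verts (graph_of M)"
  obtains x where "x \<in> A" "tail (graph_of M) x = v"
proof -
  have "out_arcs (graph_of M) v \<noteq> {}"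
    using cubic[OF assms] by (auto simp: out_degree_def)
  then obtain x where "x \<in> out_arcs (graph_of M) v" by blast
  then show thesis using that[of x] by simp
qed

lemma card_arcs: "card A = 3 * card (verts (graph_of M))"
proof -
  have "card A = card (\<Union>v\<in>verts (graph_of M). out_arcs (graph_of M) v)"
    by (rule arg_cong[of _ _ card]) auto
  also have "\<dots> = (\<Sum>v\<in>verts (graph_of M). card (out_arcs (graph_of M) v))"
    by (rule card_UN_disjoint) auto
  also have "\<dots> = (\<Sum>v\<in>verts (graph_of M). 3)"
    using cubic by (intro sum.cong) (auto simp: out_degree_def)
  finally show ?thesis by simp
qed

lemma card_edges: "2 * card (edges M) = card A"
proof -
  have rev_orbit: "orbit \<alpha> x = {x, \<alpha> x}" for x
  proof -
    have "orbit \<alpha> x = {\<alpha> x, \<alpha> (\<alpha> x)}"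
    proof (intro equalityI subsetI)
      fix y assume "y \<in> orbit \<alpha> x"
      then show "y \<in> {\<alpha> x, \<alpha> (\<alpha> x)}" by induction auto
    next
      fix y assume "y \<in> {\<alpha> x, \<alpha> (\<alpha> x)}"
      then show "y \<in> orbit \<alpha> x" by (metis insertE orbit.intros singletonD)
    qed
    then show ?thesis by auto
  qed
  have card: "card (orbit \<alpha> x) = 2" if "x \<in> A" for x
    using arev_neq[OF that] by (simp add: rev_orbit)
  have "{X \<in> orbit \<alpha> ` A. card X = 2} = edges M"
    using card by (auto simp: edges_def rev_orbit)
  moreover have "{x \<in> A. card (orbit \<alpha> x) = 2} = A" using card by auto
  ultimately show ?thesis
    using card_orbits_of_size[OF finite_arcs arev_permutes_arcs, of 2] by simp
qed

lemma self_in_orbit_face: "x \<in> orbit \<phi> x"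
  using face_permutes finite_arcs permutation_permutes permutation_self_in_orbit by metis

text \<open>With x triangles and y hexagons there are 3 x + 6 y arcs, a third as many vertices and
  half as many edges, so the characteristic is x / 2. It equals 2 iff x = 4, that is, iff 12 arcs
  lie on triangles.\<close>

lemma euler_characteristic_iff:
  assumes faces: "\<And>F. F \<in> faces M \<Longrightarrow> card F = 3 \<or> card F = 6"
  shows "int (card (verts (graph_of M))) - int (card (edges M)) + int (card (faces M)) = 2 \<longleftrightarrow>
    card {x \<in> A. \<phi> (\<phi> (\<phi> x)) = x} = 12"
proof -
  let ?F = "\<lambda>c. {X \<in> faces M. card X = c}" and ?A = "\<lambda>c. {x \<in> A. card (orbit \<phi> x) = c}"
  have fin: "finite (faces M)" by (simp add: faces_def)
  have F: "c * card (?F c) = card (?A c)" for c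
    using card_orbits_of_size[OF finite_arcs face_permutes] by (simp add: faces_def)
  have "faces M = ?F 3 \<union> ?F 6" using faces by auto
  then have "card (faces M) = card (?F 3 \<union> ?F 6)" by (rule arg_cong)
  also have "\<dots> = card (?F 3) + card (?F 6)"
    using fin by (intro card_Un_disjoint) auto
  finally have cF: "card (faces M) = card (?F 3) + card (?F 6)" .
  have AF: "card (orbit \<phi> x) = 3 \<or> card (orbit \<phi> x) = 6" if "x \<in> A" for x
    using faces that by (auto simp: faces_def)
  then have "A = ?A 3 \<union> ?A 6" by auto
  then have "card A = card (?A 3 \<union> ?A 6)" by (rule arg_cong)
  also have "\<dots> = card (?A 3) + card (?A 6)"
    using finite_arcs by (intro card_Un_disjoint) auto
  finally have cA: "card A = card (?A 3) + card (?A 6)" .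
  have "?A 3 = {x \<in> A. \<phi> (\<phi> (\<phi> x)) = x}"
  proof (intro Collect_cong conj_cong refl)
    fix x assume x: "x \<in> A"
    have "(\<phi> ^^ 3) x = x" if "card (orbit \<phi> x) = 3"
      using funpow_card_orbit[OF self_in_orbit_face, of x] that by simp
    moreover have "(\<phi> ^^ 3) x \<noteq> x" if "card (orbit \<phi> x) = 6"
      using funpow_less_card_orbit[OF self_in_orbit_face, of 3 x] that by simp
    ultimately show "card (orbit \<phi> x) = 3 \<longleftrightarrow> \<phi> (\<phi> (\<phi> x)) = x"
      using AF[OF x] by (auto simp: numeral_3_eq_3)
  qed
  then have "card {x \<in> A. \<phi> (\<phi> (\<phi> x)) = x} = 3 * card (?F 3)" using F[of 3] by simp
  moreover have "card A = 3 * card (?F 3) + 6 * card (?F 6)" using cA F[of 3] F[of 6] by simp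
  ultimately show ?thesis
    using cF card_arcs card_edges by linarith
qed

text \<open>A set closed under \<open>\<phi>\<close> and \<open>\<alpha>\<close> is closed under
  \<open>\<sigma>\<close>, so it contains all arcs at a vertex as soon as it contains one; reversal
  then carries it to the neighbours.\<close>

lemma connected_closed_set:
  assumes conn: "Digraph_Component.connected (graph_of M)"
    and S: "S \<subseteq> A" "x \<in> S" "\<And>y. y \<in> S \<Longrightarrow> \<phi> y \<in> S" "\<And>y. y \<in> S \<Longrightarrow> \<alpha> y \<in> S"
  shows "S = A"
proof -
  have succ: "\<sigma> y \<in> S" if "y \<in> S" for y using S(3)[OF S(4)[OF that]] by (simp add: face_rev)
  have vertex: "z \<in> S" if "y \<in> S" "z \<in> A" "tail (graph_of M) z = tail (graph_of M) y" for y z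
    using that tail_eq_iff[of y z] succ S(1) by auto
  have "strongly_connected (graph_of M)"
    using symmetric_connected_imp_strongly_connected[OF sym_arcs conn] .
  have "z \<in> S" if z: "z \<in> A" for z
  proof -
    have "tail (graph_of M) x \<rightarrow>\<^sup>*\<^bsub>graph_of M\<^esub> tail (graph_of M) z"
      using \<open>strongly_connected _\<close> z S by (auto simp: strongly_connected_def)
    then have "\<forall>y\<in>A. tail (graph_of M) y = tail (graph_of M) z \<longrightarrow> y \<in> S"
    proof (induction rule: reachable_induct)
      case base
      then show ?case using vertex[OF S(2)] by auto
    next
      case (step u v)
      then obtain a where a: "a \<in> A" "tail (graph_of M) a = u" "head (graph_of M) a = v"
        by (auto simp: arcs_ends_def arc_to_ends_def)
      then have "\<alpha> a \<in> S" using step S(4) by auto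
      then show ?case using vertex[of "\<alpha> a"] a by auto
    qed
    then show ?thesis using z by blast
  qed
  then show ?thesis using S(1) by auto
qed

text \<open>A converse of \<open>connected_closed_set\<close>: the set in question is that of the
  arcs whose tails are reachable from the tail of \<open>x\<close>.\<close>

lemma connectedI:
  assumes x: "x \<in> A"
    and S: "\<And>S. x \<in> S \<Longrightarrow> (\<And>y. y \<in> S \<Longrightarrow> y \<in> A \<Longrightarrow> \<phi> y \<in> S) \<Longrightarrow> (\<And>y. y \<in> S \<Longrightarrow> y \<in> A \<Longrightarrow> \<alpha> y \<in> S) \<Longrightarrow> A \<subseteq> S"
  shows "Digraph_Component.connected (graph_of M)"
proof -
  let ?r = "tail (graph_of M) x"
  have "A \<subseteq> {y. ?r \<rightarrow>\<^sup>*\<^bsub>graph_of M\<^esub> tail (graph_of M) y}"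
  proof (rule S)
    show "x \<in> {y. ?r \<rightarrow>\<^sup>*\<^bsub>graph_of M\<^esub> tail (graph_of M) y}" using x by simp
    fix y assume y: "y \<in> {y. ?r \<rightarrow>\<^sup>*\<^bsub>graph_of M\<^esub> tail (graph_of M) y}" "y \<in> A"
    have "tail (graph_of M) y \<rightarrow>\<^bsub>graph_of M\<^esub> head (graph_of M) y"
      using y(2) by (rule in_arcs_imp_in_arcs_ends)
    then have "?r \<rightarrow>\<^sup>*\<^bsub>graph_of M\<^esub> head (graph_of M) y"
      using y(1) reachable_adj_trans by blast
    then show "\<alpha> y \<in> {y. ?r \<rightarrow>\<^sup>*\<^bsub>graph_of M\<^esub> tail (graph_of M) y}"
      and "\<phi> y \<in> {y. ?r \<rightarrow>\<^sup>*\<^bsub>graph_of M\<^esub> tail (graph_of M) y}"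
      using y(2) tail_succ[of "\<alpha> y"] by (simp_all add: face_succ_def)
  qed
  then have r: "?r \<rightarrow>\<^sup>*\<^bsub>graph_of M\<^esub> v" if "v \<in> verts (graph_of M)" for v
    using that out_arc_exists[OF that] by blast
  have "u \<rightarrow>\<^sup>*\<^bsub>mk_symmetric (graph_of M)\<^esub> v" if "u \<in> verts (graph_of M)" "v \<in> verts (graph_of M)" for u v
    using reachable_mk_symmetricI[OF reachable_trans[OF symmetric_reachable'[OF r[OF that(1)]] r[OF that(2)]]] .
  then show ?thesis
    using tail_in_verts[OF x] unfolding connected_def
    by (intro strongly_connectedI) (auto simp del: tail_in_verts)
qed

end

section \<open>Quotients of the hexagonal tiling\<close>

definition dir :: "nat \<Rightarrow> int \<times> int" where
  "dir u = (rot ^^ u) (1, 0)"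

lemma dir_0: "dir 0 = (1, 0)" and dir_Suc: "dir (Suc u) = rot (dir u)"
  by (simp_all add: dir_def)

lemma dir_add: "dir (u + v) = (rot ^^ u) (dir v)"
  by (simp add: dir_def funpow_add)

lemma dir_add_3: "dir (u + 3) = - dir u"
  by (simp add: dir_Suc numeral_3_eq_3 rot_rot_rot)

text \<open>Going around a vertex of the tiling closes up after three edges; this yields
  \<open>succ_cubed\<close>.\<close>

lemma dir_relation: "dir u - dir (Suc u) + dir (Suc (Suc u)) = 0"
  by (simp add: dir_Suc rot_def prod_eq_iff)

text \<open>No unit vector is twice a lattice vector: the midpoint of an edge is never a hexagon
  centre. Hence no half turn of the covering group fixes an edge.\<close>

lemma dir_odd: "odd (fst (dir u)) \<or> odd (snd (dir u))"
  by (induction u) (auto simp: dir_0 dir_Suc rot_def)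

lemma funpow_rot_add: "(rot ^^ u) (s + t) = (rot ^^ u) s + (rot ^^ u) t"
  by (induction u) (simp_all add: rot_add)

lemma funpow_rot_zero: "(rot ^^ u) 0 = 0"
  by (induction u) (simp_all add: rot_zero)

lemma int2_induct [case_names zero right left up down]:
  fixes P :: "int \<times> int \<Rightarrow> bool"
  assumes zero: "P 0" and right: "\<And>t. P t \<Longrightarrow> P (t + (1, 0))" and left: "\<And>t. P t \<Longrightarrow> P (t - (1, 0))"
    and up: "\<And>t. P t \<Longrightarrow> P (t + (0, 1))" and down: "\<And>t. P t \<Longrightarrow> P (t - (0, 1))"
  shows "P t"
proof -
  have x: "P (x, 0)" for x
  proof (induction x rule: int_induct[where k = 0])
    case base
    then show ?case using zero by (simp add: zero_prod_def)
  next
    case (step1 i)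
    then show ?case using right[of "(i, 0)"] by simp
  next
    case (step2 i)
    then show ?case using left[of "(i, 0)"] by simp
  qed
  have "P (x, y)" for x y
  proof (induction y rule: int_induct[where k = 0])
    case base
    then show ?case using x by simp
  next
    case (step1 i)
    then show ?case using up[of "(x, i)"] by simp
  next
    case (step2 i)
    then show ?case using down[of "(x, i)"] by simp
  qed
  then show ?thesis by (cases t) simp
qed

lemma dir_induct [case_names zero step]:
  assumes zero: "P 0" and step: "\<And>t w. P t \<Longrightarrow> P (t + dir w)"
  shows "P t"
proof -
  have d2: "dir 2 = (0, 1)" by (simp add: numeral_2_eq_2 dir_Suc dir_0 rot_def)
  have d3: "dir 3 = - (1, 0)" using dir_add_3[of 0] by (simp add: dir_0)
  have d5: "dir 5 = - (0, 1)" using dir_add_3[of 2] by (simp add: d2)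
  show ?thesis
  proof (induction t rule: int2_induct)
    case (right t)
    then show ?case using step[of t 0] by (simp add: dir_0)
  next
    case (left t)
    then show ?case using step[of t 3] unfolding d3 add_uminus_conv_diff by blast
  next
    case (up t)
    then show ?case using step[of t 2] by (simp add: d2)
  next
    case (down t)
    then show ?case using step[of t 5] unfolding d5 add_uminus_conv_diff by blast
  qed (rule zero)
qed

text \<open>
  The darts of the hexagonal tiling are the pairs of a hexagon centre \<open>t\<close> and a direction
  \<open>u\<close> modulo 6. A cover identifies the darts of a map with their classes under the group
  generated by the half turns about the points of \<open>K\<close>, that is by
  \<open>(t, u) \<mapsto> (-t, u + 3)\<close> and \<open>(t, u) \<mapsto> (t + 2 k, u)\<close> for \<open>k \<in> K\<close>.
\<close>

locale hex_cover =
  fixes A :: "'b set" and \<phi> \<alpha> :: "'b \<Rightarrow> 'b" and K :: "(int \<times> int) set"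
    and cov :: "int \<times> int \<Rightarrow> nat \<Rightarrow> 'b"
  assumes subgroup: "subgroup2 K"
    and cov_in: "\<And>t u. cov t u \<in> A"
    and cov_surj: "\<And>x. x \<in> A \<Longrightarrow> \<exists>t u. x = cov t u"
    and cov_face: "\<And>t u. \<phi> (cov t u) = cov t (Suc u)"
    and cov_shift: "\<And>t u. cov t (u + 3) = cov (- t) u"
    and cov_rev: "\<And>t u. \<alpha> (cov t u) = cov (- t - dir u) u"
    and cov_eq_iff: "\<And>t t' u. cov t u = cov t' u \<longleftrightarrow> (\<exists>s\<in>K. t - t' = s + s)"
    and cov_mod: "\<And>t t' u u'. cov t u = cov t' u' \<Longrightarrow> u mod 3 = u' mod 3"
begin

lemma cov_period: "cov t (u + 6) = cov t u"
  using cov_shift[of t "u + 3"] cov_shift[of "- t" u] by (simp add: numeral_eq_Suc)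

lemma cov_face3: "\<phi> (\<phi> (\<phi> (cov t u))) = cov (- t) u"
  using cov_shift[of t u] by (simp add: cov_face numeral_3_eq_3)

text \<open>Crossing the edge of \<open>(t, u)\<close> leads to the dart
  \<open>(t + dir u, u + 3)\<close>, which \<open>cov_shift\<close> rewrites into the form in
  \<open>cov_rev\<close>. Three face steps restore the direction, so the whole word is a
  translation.\<close>

lemma cov_translate: "\<phi> (\<phi> (\<phi> (\<alpha> (cov t u)))) = cov (t + dir u) u"
  by (simp add: cov_rev cov_face3 add.commute)

lemma cov_succ: "\<phi> (\<alpha> (cov t u)) = cov (- t - dir u) (Suc u)"
  by (simp add: cov_rev cov_face)

lemma cov_face_funpow: "(\<phi> ^^ k) (cov t u) = cov t (u + k)"
  by (induction k) (simp_all add: cov_face)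

lemma cov_reduce: "cov t u = cov (if even (u div 3) then t else - t) (u mod 3)"
proof (induction u arbitrary: t rule: less_induct)
  case (less u)
  show ?case
  proof (cases "u < 3")
    case False
    then obtain v where v: "u = v + 3" by (metis add.commute le_Suc_ex not_less)
    have "cov t u = cov (- t) v" by (simp only: v cov_shift)
    also have "\<dots> = cov (if even (v div 3) then - t else - (- t)) (v mod 3)"
      by (rule less.IH) (simp add: v)
    finally show ?thesis by (simp add: v)
  qed simp
qed

lemma cov_canonical:
  assumes "x \<in> A"
  obtains t u where "u < 3" "x = cov t u"
proof -
  obtain t u where "x = cov t u" using cov_surj[OF assms] by blast
  then show thesis using cov_reduce[of t u] that[of "u mod 3"] by simp
qed

text \<open>The right-hand side depends on \<open>K\<close> only; hence two covers with the same
  \<open>K\<close> identify the same labels.\<close>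

lemma cov_eq_cov_iff:
  "cov t u = cov t' u' \<longleftrightarrow> u mod 3 = u' mod 3 \<and>
     (\<exists>s\<in>K. (if even (u div 3) then t else - t) - (if even (u' div 3) then t' else - t') = s + s)"
proof (cases "u mod 3 = u' mod 3")
  case True
  then show ?thesis
    using cov_reduce[of t u] cov_reduce[of t' u'] by (simp only: cov_eq_iff simp_thms)
next
  case False
  then show ?thesis using cov_mod by blast
qed

text \<open>Turning the labels of the tiling by 60 degrees describes the same map from another base
  arc, the next one on the base face.\<close>

lemma rotate: "hex_cover A \<phi> \<alpha> (rot -` K) (\<lambda>t u. cov (rot t) (Suc u))"
proof (unfold_locales)
  show "subgroup2 (rot -` K)" using subgroup by (rule subgroup2_vimage_rot)
  show "cov (rot t) (Suc u) \<in> A" for t u by (rule cov_in)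
  show "\<exists>t u. x = cov (rot t) (Suc u)" if "x \<in> A" for x
  proof -
    obtain t u where x: "x = cov t u" using cov_surj[OF \<open>x \<in> A\<close>] by blast
    \<comment> \<open>The label of x in the new coordinates is \<open>(rot (rot t), u + 2)\<close>:
      it is turned to \<open>(- t, u + 3)\<close>, which is the dart \<open>(t, u)\<close>.\<close>
    have "cov (rot (rot (rot t))) (Suc (u + 2)) = x"
      using cov_shift[of "- t" u] by (simp add: rot_rot_rot x numeral_3_eq_3)
    then show ?thesis by metis
  qed
  show "\<phi> (cov (rot t) (Suc u)) = cov (rot t) (Suc (Suc u))" for t u by (rule cov_face)
  show "cov (rot t) (Suc (u + 3)) = cov (rot (- t)) (Suc u)" for t u
    using cov_shift[of "rot t" "Suc u"] by (simp add: rot_uminus)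
  show "\<alpha> (cov (rot t) (Suc u)) = cov (rot (- t - dir u)) (Suc u)" for t u
    by (simp add: cov_rev rot_diff rot_uminus dir_Suc)
  show "cov (rot t) (Suc u) = cov (rot t') (Suc u) \<longleftrightarrow> (\<exists>s\<in>rot -` K. t - t' = s + s)" for t t' u
  proof -
    have inj: "rot x = rot y \<longleftrightarrow> x = y" for x y using bij_rot by (simp add: bij_def inj_eq)
    have "(\<exists>s\<in>K. rot t - rot t' = s + s) \<longleftrightarrow> (\<exists>s\<in>rot -` K. rot t - rot t' = rot s + rot s)"
    proof
      assume "\<exists>s\<in>K. rot t - rot t' = s + s"
      then obtain s where s: "s \<in> K" "rot t - rot t' = s + s" by blast
      obtain s' where "s = rot s'" using bij_is_surj[OF bij_rot] by (rule surjE)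
      then show "\<exists>s\<in>rot -` K. rot t - rot t' = rot s + rot s" using s by (intro bexI[of _ s']) simp_all
    next
      assume "\<exists>s\<in>rot -` K. rot t - rot t' = rot s + rot s"
      then obtain s where "s \<in> rot -` K" "rot t - rot t' = rot s + rot s" by blast
      then show "\<exists>s\<in>K. rot t - rot t' = s + s" by (intro bexI[of _ "rot s"]) simp_all
    qed
    then show ?thesis by (simp only: cov_eq_iff inj rot_add[symmetric] rot_diff[symmetric])
  qed
  show "u mod 3 = u' mod 3" if "cov (rot t) (Suc u) = cov (rot t') (Suc u')" for t t' u u'
    using cov_mod[OF that] by (auto simp: mod_Suc split: if_splits)
qed

lemma rev_rev: "x \<in> A \<Longrightarrow> \<alpha> (\<alpha> x) = x"
  by (auto dest!: cov_surj simp: cov_rev)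

lemma rev_neq:
  assumes "x \<in> A"
  shows "\<alpha> x \<noteq> x"
proof
  assume "\<alpha> x = x"
  moreover obtain t u where x: "x = cov t u" using cov_surj[OF assms] by blast
  ultimately obtain s where "- t - dir u - t = s + s"
    by (auto simp: cov_rev cov_eq_iff)
  then have "fst (- t - dir u - t) = fst (s + s)" "snd (- t - dir u - t) = snd (s + s)" by simp_all
  then have "fst (dir u) = 2 * (- fst t - fst s)" "snd (dir u) = 2 * (- snd t - snd s)" by simp_all
  then show False using dir_odd[of u] by simp
qed

lemma succ_neq: "x \<in> A \<Longrightarrow> \<phi> (\<alpha> x) \<noteq> x"
proof
  assume "x \<in> A" "\<phi> (\<alpha> x) = x"
  then obtain t u where "cov (- t - dir u) (Suc u) = cov t u"
    using cov_surj by (metis cov_succ)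
  then have "Suc u mod 3 = u mod 3" by (rule cov_mod)
  then show False by presburger
qed

lemma succ_cubed:
  assumes "x \<in> A"
  shows "\<phi> (\<alpha> (\<phi> (\<alpha> (\<phi> (\<alpha> x))))) = x"
proof -
  obtain t u where x: "x = cov t u" using cov_surj[OF assms] by blast
  have "\<phi> (\<alpha> (\<phi> (\<alpha> (\<phi> (\<alpha> x))))) =
      cov (- (- (- t - dir u) - dir (Suc u)) - dir (Suc (Suc u))) (u + 3)"
    by (simp add: x cov_succ numeral_3_eq_3)
  also have "\<dots> = cov (t + (dir u - dir (Suc u) + dir (Suc (Suc u)))) u"
    unfolding cov_shift by (simp add: algebra_simps)
  finally show ?thesis by (simp add: dir_relation x)
qed

text \<open>By \<open>cov_mod\<close> the walk returns only after a multiple of three steps, and by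
  \<open>cov_period\<close> it has returned after six.\<close>

lemma card_orbit_face:
  assumes "x \<in> A"
  shows "card (orbit \<phi> x) = 3 \<or> card (orbit \<phi> x) = 6"
proof -
  obtain t u where x: "x = cov t u" using cov_surj[OF assms] by blast
  have neq: "(\<phi> ^^ j) x \<noteq> x" if "j mod 3 \<noteq> 0" for j
  proof
    assume "(\<phi> ^^ j) x = x"
    then have "(u + j) mod 3 = u mod 3" unfolding x cov_face_funpow by (rule cov_mod)
    then show False using that by presburger
  qed
  have six: "(\<phi> ^^ 6) x = x" by (simp only: x cov_face_funpow cov_period)
  show ?thesis
  proof (cases "(\<phi> ^^ 3) x = x")
    case True
    then have "card (orbit \<phi> x) = 3"
    proof (rule card_orbit_eqI)
      fix j :: nat assume "0 < j" "j < 3"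
      then show "(\<phi> ^^ j) x \<noteq> x" by (intro neq) simp
    qed simp
    then show ?thesis ..
  next
    case False
    from six have "card (orbit \<phi> x) = 6"
    proof (rule card_orbit_eqI)
      fix j :: nat assume j: "0 < j" "j < 6"
      show "(\<phi> ^^ j) x \<noteq> x"
      proof (cases "j = 3")
        case True
        then show ?thesis using False by simp
      next
        case False
        then have "j mod 3 \<noteq> 0" using j by presburger
        then show ?thesis by (rule neq)
      qed
    qed simp
    then show ?thesis ..
  qed
qed

lemma arcs_subset_closed:
  assumes base: "cov 0 0 \<in> S"
    and face: "\<And>y. y \<in> S \<Longrightarrow> y \<in> A \<Longrightarrow> \<phi> y \<in> S" and rev: "\<And>y. y \<in> S \<Longrightarrow> y \<in> A \<Longrightarrow> \<alpha> y \<in> S"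
  shows "A \<subseteq> S"
proof -
  have up: "cov t (u + k) \<in> S" if "cov t u \<in> S" for t u k
  proof (induction k)
    case (Suc k)
    then show ?case using face[OF Suc cov_in] by (simp add: cov_face)
  qed (simp add: that)
  have all: "cov t v \<in> S" if "cov t u \<in> S" for t u v
  proof -
    have period: "cov t (v + 6 * n) = cov t v" for n
      by (induction n) (use cov_period[of t "v + 6 * n" for n] in \<open>simp_all add: add_ac\<close>)
    \<comment> \<open>Face steps only increase the direction, so \<open>v\<close> is replaced by
      \<open>v + 6 * u\<close>, which is at least \<open>u\<close> and names the same dart.\<close>
    have "cov t (u + (v + 6 * u - u)) \<in> S" using that by (rule up)
    also have "u + (v + 6 * u - u) = v + 6 * u" by simp
    finally show ?thesis by (simp only: period)
  qed
  have "\<forall>u. cov t u \<in> S" for t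
  proof (induction t rule: dir_induct)
    case zero
    then show ?case using all[OF base] by blast
  next
    case (step t w)
    then have "cov (- t - dir w) w \<in> S" using rev[OF _ cov_in] unfolding cov_rev by blast
    then have "cov (- t - dir w) (w + 3) \<in> S" by (rule up)
    then have "cov (t + dir w) w \<in> S" by (simp add: cov_shift add.commute)
    then show ?case using all by blast
  qed
  then show ?thesis using cov_surj by blast
qed

text \<open>\<open>?I\<close> is a fundamental domain: a box for the lattice 2 K of index 4 a d,
  times the directions modulo 3. An arc returns after three face steps iff its face centre t lies in
  K, since this means that -2 t is in 2 K; \<open>?J\<close> lists the four classes of K modulo 2
  K.\<close>

lemma lattice_card:
  assumes K: "K = lattice a b d" and "0 < a" "0 < d"
  shows "finite A" and "int (card A) = 12 * (a * d)"
    and "card {x \<in> A. \<phi> (\<phi> (\<phi> x)) = x} = 12"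
proof -
  let ?I = "({0..<2 * a} \<times> {0..<2 * d}) \<times> {..<3::nat}"
  have bij: "bij_betw (\<lambda>(t, u). cov t u) ?I A"
  proof (rule bij_betw_imageI)
    show "inj_on (\<lambda>(t, u). cov t u) ?I"
    proof (rule inj_onI, clarsimp)
      fix x y u x' y' u'
      assume bounds: "0 \<le> x" "x < 2 * a" "0 \<le> y" "y < 2 * d" "u < 3"
          "0 \<le> x'" "x' < 2 * a" "0 \<le> y'" "y' < 2 * d" "u' < 3"
        and eq: "cov (x, y) u = cov (x', y') u'"
      have u: "u = u'" using cov_mod[OF eq] bounds by simp
      obtain s where s: "s \<in> K" "(x, y) - (x', y') = s + s" using eq u cov_eq_iff by blast
      obtain j where j: "snd s = j * d" "a dvd fst s - j * b"
        using s(1) unfolding K by (rule in_latticeE)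
      have xy: "x - x' = 2 * fst s" "y - y' = 2 * snd s" using s(2) by (auto simp: prod_eq_iff)
      have "[y = y'] (mod 2 * d)" using xy j by (simp add: cong_iff_dvd_diff)
      then have y: "y = y'" using bounds cong_less_imp_eq_int by blast
      then have "j = 0" using xy j assms by simp
      then have "[x = x'] (mod 2 * a)" using xy j by (simp add: cong_iff_dvd_diff)
      then have "x = x'" using bounds cong_less_imp_eq_int by blast
      then show "x = x' \<and> y = y' \<and> u = u'" using y u by simp
    qed
    show "(\<lambda>(t, u). cov t u) ` ?I = A"
    proof (intro equalityI subsetI)
      fix z assume "z \<in> A"
      then obtain t u where tu: "u < 3" "z = cov t u" by (rule cov_canonical)
      \<comment> \<open>Reduction into the box: first subtract a multiple of 2 (b, d) to fix the
        second coordinate, then one of 2 (a, 0) for the first.\<close>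
      define j where "j = snd t div (2 * d)"
      define i where "i = (fst t - j * (2 * b)) div (2 * a)"
      define s where "s = (i * a + j * b, j * d)"
      have "s \<in> K" unfolding K s_def by (rule in_latticeI[of _ j]) simp_all
      define t' where "t' = ((fst t - j * (2 * b)) mod (2 * a), snd t mod (2 * d))"
      have "fst t - j * (2 * b) = i * (2 * a) + fst t'"
        by (simp only: i_def t'_def fst_conv div_mult_mod_eq)
      moreover have "snd t = j * (2 * d) + snd t'"
        by (simp only: j_def t'_def snd_conv div_mult_mod_eq)
      ultimately have "t - t' = s + s" by (simp add: s_def prod_eq_iff algebra_simps)
      then have "cov t u = cov t' u" using \<open>s \<in> K\<close> cov_eq_iff by blast
      moreover have "t' \<in> {0..<2 * a} \<times> {0..<2 * d}" using assms by (simp add: t'_def)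
      ultimately show "z \<in> (\<lambda>(t, u). cov t u) ` ?I"
        using tu by (intro image_eqI[of _ _ "(t', u)"]) auto
    qed (auto simp: cov_in)
  qed
  show "finite A" using bij_betw_finite[OF bij] by simp
  have "card A = card ?I" using bij_betw_same_card[OF bij] by simp
  then show "int (card A) = 12 * (a * d)" using assms by (simp add: card_cartesian_product)
  let ?J = "({0, 1::int} \<times> {0, 1::int}) \<times> {..<3::nat}"
  let ?g = "\<lambda>((i, j), u). cov (i * a + j * b, j * d) u"
  have "bij_betw ?g ?J {x \<in> A. \<phi> (\<phi> (\<phi> x)) = x}"
  proof (rule bij_betw_imageI)
    show "inj_on ?g ?J"
    proof (rule inj_onI)
      fix v w assume vw: "v \<in> ?J" "w \<in> ?J" "?g v = ?g w"
      obtain i j u where v: "v = ((i, j), u)" by (metis surj_pair)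
      obtain i' j' u' where w: "w = ((i', j'), u')" by (metis surj_pair)
      have bounds: "i = 0 \<or> i = 1" "j = 0 \<or> j = 1" "u < 3" "i' = 0 \<or> i' = 1" "j' = 0 \<or> j' = 1" "u' < 3"
        using vw(1,2) unfolding v w by auto
      have eq: "cov (i * a + j * b, j * d) u = cov (i' * a + j' * b, j' * d) u'"
        using vw(3) unfolding v w by simp
      have u: "u = u'" using cov_mod[OF eq] bounds by simp
      obtain s where s: "s \<in> K" "(i * a + j * b, j * d) - (i' * a + j' * b, j' * d) = s + s"
        using eq u cov_eq_iff by blast
      obtain k where k: "snd s = k * d" "a dvd fst s - k * b"
        using s(1) unfolding K by (rule in_latticeE)
      have "(j - j') * d = (2 * k) * d" using s(2) k(1) by (simp add: prod_eq_iff algebra_simps)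
      then have "j - j' = 2 * k" using assms by simp
      then have j: "j = j'" "k = 0" using bounds by presburger+
      obtain l where "fst s = a * l" using k(2) j by auto
      then have "(i - i') * a = (2 * l) * a" using s(2) j by (simp add: prod_eq_iff algebra_simps)
      then have "i - i' = 2 * l" using assms by simp
      then have "i = i'" using bounds by presburger
      then show "v = w" using j u v w by simp
    qed
    have fix_iff: "\<phi> (\<phi> (\<phi> (cov t u))) = cov t u \<longleftrightarrow> t \<in> K" for t u
    proof -
      have "cov (- t) u = cov t u \<longleftrightarrow> (\<exists>s\<in>K. - t - t = s + s)" by (rule cov_eq_iff)
      also have "\<dots> \<longleftrightarrow> (\<exists>s\<in>K. s = - t)"
        by (intro bex_cong refl) (auto simp: prod_eq_iff)
      also have "\<dots> \<longleftrightarrow> t \<in> K" using subgroup2_uminus_iff[OF subgroup] by simp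
      finally show ?thesis by (simp add: cov_face3)
    qed
    show "?g ` ?J = {x \<in> A. \<phi> (\<phi> (\<phi> x)) = x}"
    proof (intro equalityI subsetI)
      fix z assume "z \<in> ?g ` ?J"
      then obtain i j u where z: "z = cov (i * a + j * b, j * d) u" by auto
      have "(i * a + j * b, j * d) \<in> K" unfolding K by (rule in_latticeI[of _ j]) simp_all
      then show "z \<in> {x \<in> A. \<phi> (\<phi> (\<phi> x)) = x}" unfolding z using fix_iff cov_in by simp
    next
      fix z assume z: "z \<in> {x \<in> A. \<phi> (\<phi> (\<phi> x)) = x}"
      then have "z \<in> A" by simp
      then obtain t u where tu: "u < 3" "z = cov t u" by (rule cov_canonical)
      then have "t \<in> K" using z fix_iff[of t u] by simp
      then obtain j where j: "snd t = j * d" "a dvd fst t - j * b" unfolding K by (rule in_latticeE)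
      then obtain i where i: "fst t - j * b = a * i" by (elim dvdE)
      define s where "s = (i div 2 * a + j div 2 * b, j div 2 * d)"
      have "s \<in> K" unfolding K s_def by (rule in_latticeI[of _ "j div 2"]) simp_all
      define t' where "t' = (i mod 2 * a + j mod 2 * b, j mod 2 * d)"
      have half: "n * c = n mod 2 * c + n div 2 * c + n div 2 * c" for n c :: int
      proof -
        have "n = q * 2 + r \<longrightarrow> n * c = r * c + q * c + q * c" for q r by (simp add: algebra_simps)
        then show ?thesis using div_mult_mod_eq[of n 2, symmetric] by blast
      qed
      have "t = (i * a + j * b, j * d)" using i j by (simp add: prod_eq_iff algebra_simps)
      also have "\<dots> = t' + s + s"
        unfolding t'_def s_def using half[of i a] half[of j b] half[of j d] by simp
      finally have "t - t' = s + s" by simp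
      then have "cov t u = cov t' u" using \<open>s \<in> K\<close> cov_eq_iff by blast
      moreover have "i mod 2 \<in> {0, 1}" "j mod 2 \<in> {0, 1}" by auto
      ultimately show "z \<in> ?g ` ?J"
        using tu by (intro image_eqI[of _ _ "((i mod 2, j mod 2), u)"]) (auto simp: t'_def)
    qed
  qed
  then have "card {x \<in> A. \<phi> (\<phi> (\<phi> x)) = x} = card ?J" by (simp add: bij_betw_same_card)
  also have "\<dots> = 12" by (simp only: card_cartesian_product) simp
  finally show "card {x \<in> A. \<phi> (\<phi> (\<phi> x)) = x} = 12" .
qed

end

text \<open>The base arc of \<open>cov'\<close> has some label \<open>(s, u)\<close> in
  \<open>cov\<close>. Face steps and edge crossings extend this to \<open>dev\<close> on all labels.
  The shift \<open>s\<close> cancels in differences, so only the rotation by \<open>u\<close> acts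
  on the lattice.\<close>

lemma hex_cover_unique_up_to_rot:
  assumes "hex_cover A \<phi> \<alpha> K cov" "hex_cover A \<phi> \<alpha> K' cov'"
  shows "\<exists>u<3. K' = (rot ^^ u) -` K"
proof -
  interpret C: hex_cover A \<phi> \<alpha> K cov by fact
  interpret D: hex_cover A \<phi> \<alpha> K' cov' by fact
  obtain s u where su: "u < 3" "cov' 0 0 = cov s u" using C.cov_canonical[OF D.cov_in] .
  have all: "cov' x v = cov y (u + v)" if "cov' x w = cov y (u + w)" for x y v w
  proof -
    have period: "cov' x (v + 6 * n) = cov' x v" "cov y (u + v + 6 * n) = cov y (u + v)" for n
      using D.cov_period[of x "v + 6 * n" for n] C.cov_period[of y "u + v + 6 * n" for n]
      by (induction n) (simp_all add: add_ac)
    have "(\<phi> ^^ (v + 6 * w - w)) (cov' x w) = (\<phi> ^^ (v + 6 * w - w)) (cov y (u + w))"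
      using that by simp
    then have "cov' x (v + 6 * w) = cov y (u + v + 6 * w)"
      unfolding D.cov_face_funpow C.cov_face_funpow by (simp add: add_ac)
    then show ?thesis by (simp only: period)
  qed
  have dev: "cov' t v = cov (s + (rot ^^ u) t) (u + v)" for t v
  proof (induction t arbitrary: v rule: dir_induct)
    case zero
    then show ?case using all[of 0 0 s] su by (simp add: funpow_rot_zero)
  next
    case (step t w)
    have "\<phi> (\<phi> (\<phi> (\<alpha> (cov' t w)))) = \<phi> (\<phi> (\<phi> (\<alpha> (cov (s + (rot ^^ u) t) (u + w)))))"
      by (simp only: step)
    then have "cov' (t + dir w) w = cov (s + (rot ^^ u) (t + dir w)) (u + w)"
      by (simp only: C.cov_translate D.cov_translate dir_add funpow_rot_add add.assoc)
    then show ?case by (rule all)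
  qed
  have double: "t + t = s + s \<longleftrightarrow> t = s" for s t :: "int \<times> int"
    by (auto simp: prod_eq_iff)
  \<comment> \<open>A cover sees a lattice through the translations by t + t that preserve darts;
    doubling is injective, so t itself is determined.\<close>
  have "t \<in> K' \<longleftrightarrow> (rot ^^ u) t \<in> K" for t
  proof -
    have "t \<in> K' \<longleftrightarrow> cov' (t + t) 0 = cov' 0 0"
      by (simp add: D.cov_eq_iff double)
    also have "\<dots> \<longleftrightarrow> cov (s + (rot ^^ u) (t + t)) u = cov s u"
      by (simp add: dev funpow_rot_zero)
    also have "\<dots> \<longleftrightarrow> (rot ^^ u) t \<in> K"
      by (simp add: C.cov_eq_iff funpow_rot_add double)
    finally show ?thesis .
  qed
  then show ?thesis using su(1) by blast
qed

lemma hex_cover_eq_iff: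
  assumes "hex_cover A \<phi> \<alpha> K cov" "hex_cover A' \<phi>' \<alpha>' K cov'"
  shows "cov t u = cov t' u' \<longleftrightarrow> cov' t u = cov' t' u'"
  using hex_cover.cov_eq_cov_iff[OF assms(1), of t u t' u'] hex_cover.cov_eq_cov_iff[OF assms(2), of t u t' u']
  by blast

lemma hex_cover_map:
  assumes "hex_cover A \<phi> \<alpha> K cov" and g: "bij_betw g A A'"
    and "\<And>x. x \<in> A \<Longrightarrow> \<phi>' (g x) = g (\<phi> x)" "\<And>x. x \<in> A \<Longrightarrow> \<alpha>' (g x) = g (\<alpha> x)"
  shows "hex_cover A' \<phi>' \<alpha>' K (\<lambda>t u. g (cov t u))"
proof -
  interpret C: hex_cover A \<phi> \<alpha> K cov by fact
  have inj: "g (cov t u) = g (cov t' u') \<longleftrightarrow> cov t u = cov t' u'" for t u t' u'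
    using inj_on_eq_iff[OF bij_betw_imp_inj_on[OF g] C.cov_in C.cov_in] .
  show ?thesis
  proof (unfold_locales)
    show "subgroup2 K" by (rule C.subgroup)
    show "g (cov t u) \<in> A'" for t u using bij_betwE[OF g] C.cov_in by blast
    show "\<exists>t u. x = g (cov t u)" if x: "x \<in> A'" for x
    proof -
      obtain y where "y \<in> A" "x = g y" using g x by (auto simp: bij_betw_def)
      then show ?thesis using C.cov_surj by blast
    qed
    show "u mod 3 = u' mod 3" if "g (cov t u) = g (cov t' u')" for t t' u u'
      using that C.cov_mod unfolding inj by blast
  qed (simp_all add: inj assms(3,4) C.cov_in C.cov_face C.cov_rev C.cov_shift C.cov_eq_iff)
qed

section \<open>The sublattices that cover a map\<close>

definition hex_covered :: "('a, 'b) embedded_graph \<Rightarrow> (int \<times> int) set \<Rightarrow> bool" where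
  "hex_covered M K \<longleftrightarrow> (\<exists>cov. hex_cover (arcs (graph_of M)) (face_succ M) (edge_rev M) K cov)"

lemma hex_covered_rot: "hex_covered M K \<Longrightarrow> hex_covered M (rot -` K)"
  unfolding hex_covered_def using hex_cover.rotate by blast

lemma hex_covered_oriented_iso:
  assumes "rotation_system M" "oriented_iso M N f g" "hex_covered M K"
  shows "hex_covered N K"
proof -
  interpret bidirected_digraph "graph_of M" "edge_rev M"
    using assms(1) by (simp add: rotation_system_def)
  obtain cov where cov: "hex_cover (arcs (graph_of M)) (face_succ M) (edge_rev M) K cov"
    using assms(3) by (auto simp: hex_covered_def)
  have "hex_cover (arcs (graph_of N)) (face_succ N) (edge_rev N) K (\<lambda>t u. g (cov t u))"
    using assms(2) by (intro hex_cover_map[OF cov]) (auto simp: oriented_iso_def face_succ_def)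
  then show ?thesis by (auto simp: hex_covered_def)
qed

text \<open>Both maps are the same quotient of the tiling, so arcs with equal labels correspond; the
  vertex map is then forced, vertices being the cycles of \<open>\<sigma>\<close>.\<close>

lemma hex_covered_imp_oriented_iso:
  assumes "cubic_map M" "cubic_map N" "hex_covered M K" "hex_covered N K"
  shows "\<exists>f g. oriented_iso M N f g"
proof -
  interpret M: cubic_map M by fact
  interpret N: cubic_map N by fact
  obtain cov where cov: "hex_cover M.A M.\<phi> M.\<alpha> K cov" using assms(3) by (auto simp: hex_covered_def)
  obtain cov' where cov': "hex_cover N.A N.\<phi> N.\<alpha> K cov'" using assms(4) by (auto simp: hex_covered_def)
  interpret C: hex_cover M.A M.\<phi> M.\<alpha> K cov by fact
  interpret D: hex_cover N.A N.\<phi> N.\<alpha> K cov' by fact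
  \<comment> \<open>The result does not depend on the label chosen for \<open>x\<close>, by
    \<open>hex_cover_eq_iff\<close>.\<close>
  define g where "g x = (SOME y. \<exists>t u. x = cov t u \<and> y = cov' t u)" for x
  have g: "g (cov t u) = cov' t u" for t u
  proof -
    have "\<exists>t' u'. cov t u = cov t' u' \<and> g (cov t u) = cov' t' u'"
      unfolding g_def by (rule someI_ex) blast
    then show ?thesis using hex_cover_eq_iff[OF cov cov'] by metis
  qed
  have g_bij: "bij_betw g M.A N.A"
  proof (rule bij_betw_imageI)
    show "inj_on g M.A"
    proof (rule inj_onI)
      fix x y assume "x \<in> M.A" "y \<in> M.A" "g x = g y"
      then show "x = y" using C.cov_surj hex_cover_eq_iff[OF cov cov'] by (metis g)
    qed
    show "g ` M.A = N.A"
    proof (intro equalityI subsetI)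
      fix y assume "y \<in> g ` M.A"
      then obtain t u where "y = g (cov t u)" using C.cov_surj by blast
      then show "y \<in> N.A" using D.cov_in by (simp add: g)
    next
      fix y assume "y \<in> N.A"
      then obtain t u where "y = cov' t u" using D.cov_surj by blast
      then show "y \<in> g ` M.A" using C.cov_in g by (metis imageI)
    qed
  qed
  have g_in: "g x \<in> N.A" if "x \<in> M.A" for x using g_bij that by (auto simp: bij_betw_def)
  have g_rev: "N.\<alpha> (g x) = g (M.\<alpha> x)" if "x \<in> M.A" for x
    using C.cov_surj[OF that] by (auto simp: g C.cov_rev D.cov_rev)
  have g_face: "N.\<phi> (g x) = g (M.\<phi> x)" if "x \<in> M.A" for x
    using C.cov_surj[OF that] by (auto simp: g C.cov_face D.cov_face)
  have g_succ: "N.\<sigma> (g x) = g (M.\<sigma> x)" if "x \<in> M.A" for x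
    using g_face[of "M.\<alpha> x"] g_rev[OF that] that by (simp flip: M.face_rev N.face_rev)
  have succ_in: "M.\<sigma> x \<in> M.A" if "x \<in> M.A" for x
    using permutes_in_image[OF M.succ_permutes] that by simp
  let ?t = "tail (graph_of M)" and ?t' = "tail (graph_of N)"
  have tail_iff: "?t' (g x) = ?t' (g y) \<longleftrightarrow> ?t x = ?t y" if "x \<in> M.A" "y \<in> M.A" for x y
  proof -
    have "?t' (g x) = ?t' (g y) \<longleftrightarrow> g y = g x \<or> g y = g (M.\<sigma> x) \<or> g y = g (M.\<sigma> (M.\<sigma> x))"
      using that g_in by (simp add: N.tail_eq_iff g_succ succ_in)
    also have "\<dots> \<longleftrightarrow> y = x \<or> y = M.\<sigma> x \<or> y = M.\<sigma> (M.\<sigma> x)"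
      using g_bij that succ_in by (auto simp: bij_betw_def inj_on_eq_iff)
    finally show ?thesis using that by (simp add: M.tail_eq_iff)
  qed
  \<comment> \<open>Any arc leaving \<open>v\<close> gives the same value by
    \<open>tail_iff\<close>.\<close>
  define f where "f v = ?t' (g (SOME x. x \<in> M.A \<and> ?t x = v))" for v
  have f: "f (?t x) = ?t' (g x)" if "x \<in> M.A" for x
  proof -
    let ?y = "SOME y. y \<in> M.A \<and> ?t y = ?t x"
    have "?y \<in> M.A \<and> ?t ?y = ?t x" by (rule someI[of _ x]) (simp add: that)
    then show ?thesis unfolding f_def using tail_iff that by blast
  qed
  have "bij_betw f (verts (graph_of M)) (verts (graph_of N))"
  proof (rule bij_betw_imageI)
    show "inj_on f (verts (graph_of M))"
    proof (rule inj_onI)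
      fix v w assume vw: "v \<in> verts (graph_of M)" "w \<in> verts (graph_of M)" "f v = f w"
      obtain x where x: "x \<in> M.A" "?t x = v" using M.out_arc_exists[OF vw(1)] .
      obtain y where y: "y \<in> M.A" "?t y = w" using M.out_arc_exists[OF vw(2)] .
      show "v = w" using vw(3) x y f tail_iff by metis
    qed
    show "f ` verts (graph_of M) = verts (graph_of N)"
    proof (intro equalityI subsetI)
      fix w assume "w \<in> f ` verts (graph_of M)"
      then obtain v where v: "v \<in> verts (graph_of M)" "w = f v" by blast
      obtain x where "x \<in> M.A" "?t x = v" using M.out_arc_exists[OF v(1)] .
      then show "w \<in> verts (graph_of N)" using v f g_in N.tail_in_verts by metis
    next
      fix w assume w: "w \<in> verts (graph_of N)"
      obtain y where y: "y \<in> N.A" "?t' y = w" using N.out_arc_exists[OF w] .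
      then obtain x where x: "x \<in> M.A" "y = g x" using g_bij by (auto simp: bij_betw_def)
      then show "w \<in> f ` verts (graph_of M)"
        using f[OF x(1)] y M.tail_in_verts[OF x(1)] by (intro image_eqI[of _ _ "?t x"]) auto
    qed
  qed
  moreover have "head (graph_of N) (g x) = f (head (graph_of M) x)" if "x \<in> M.A" for x
  proof -
    have "head (graph_of N) (g x) = ?t' (g (M.\<alpha> x))" using that g_in by (simp flip: g_rev)
    also have "\<dots> = f (head (graph_of M) x)" using f[of "M.\<alpha> x"] that by simp
    finally show ?thesis .
  qed
  ultimately have "oriented_iso M N f g"
    using g_bij f g_rev g_succ by (simp add: oriented_iso_def)
  then show ?thesis by blast
qed

section \<open>Trihexes from sublattices\<close>

lemma subgroup2_double_cong:
  assumes "subgroup2 K"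
  shows "\<exists>s\<in>K. t - t = s + s"
    and "\<exists>s\<in>K. t - t' = s + s \<Longrightarrow> \<exists>s\<in>K. t' - t = s + s"
    and "\<exists>s\<in>K. t - t' = s + s \<Longrightarrow> \<exists>s\<in>K. t' - t'' = s + s \<Longrightarrow> \<exists>s\<in>K. t - t'' = s + s"
proof -
  show "\<exists>s\<in>K. t - t = s + s"
    by (rule bexI[of _ 0]) (simp_all add: subgroup2_0[OF assms])
  show "\<exists>s\<in>K. t' - t = s + s" if st: "\<exists>s\<in>K. t - t' = s + s"
  proof -
    obtain s where s: "s \<in> K" "t - t' = s + s" using st by blast
    have "t' - t = - (t - t')" by simp
    also have "\<dots> = - s + - s" unfolding s(2) by simp
    finally show ?thesis using subgroup2_uminus[OF assms s(1)] by blast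
  qed
  show "\<exists>s\<in>K. t - t'' = s + s" if st: "\<exists>s\<in>K. t - t' = s + s" "\<exists>s\<in>K. t' - t'' = s + s"
  proof -
    obtain r s where rs: "r \<in> K" "s \<in> K" "t - t' = r + r" "t' - t'' = s + s" using st by blast
    have "t - t'' = (t - t') + (t' - t'')" by simp
    also have "\<dots> = (r + s) + (r + s)" unfolding rs by (simp add: add_ac)
    finally show ?thesis using subgroup2_add[OF assms rs(1,2)] by blast
  qed
qed

text \<open>The quotient is built concretely: a dart is a chosen representative modulo 2 K with a
  direction below 3, coded as a natural number. Outside \<open>A\<close> both functions are the
  identity, as \<open>permutes\<close> requires later.\<close>

lemma hex_cover_exists:
  assumes K: "subgroup2 K"
  shows "\<exists>(A :: nat set) \<phi> \<alpha> cov. hex_cover A \<phi> \<alpha> K cov \<and> (\<forall>x. x \<notin> A \<longrightarrow> \<phi> x = x \<and> \<alpha> x = x)"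
proof -
  define eqv where "eqv t t' \<longleftrightarrow> (\<exists>s\<in>K. t - t' = s + s)" for t t' :: "int \<times> int"
  have eqv: "eqv t t" "eqv t t' \<Longrightarrow> eqv t' t" "eqv t t' \<Longrightarrow> eqv t' t'' \<Longrightarrow> eqv t t''" for t t' t''
    using subgroup2_double_cong[OF K] unfolding eqv_def by blast+
  \<comment> \<open>Equivalent arguments give \<open>SOME\<close> the same predicate and hence the
    same representative.\<close>
  define red where "red t = (SOME s. eqv t s)" for t
  have red: "eqv t (red t)" for t unfolding red_def by (rule someI) (rule eqv(1))
  have red_iff: "red t = red t' \<longleftrightarrow> eqv t t'" for t t'
  proof
    assume "red t = red t'"
    then show "eqv t t'" using red[of t] red[of t'] eqv by metis
  next
    assume tt': "eqv t t'"
    have "eqv t s \<longleftrightarrow> eqv t' s" for s using tt' eqv by blast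
    then show "red t = red t'" by (simp add: red_def)
  qed
  have eqv_uminus: "eqv t t' \<Longrightarrow> eqv (- t) (- t')" for t t'
    using eqv(2)[of t t'] unfolding eqv_def by simp
  have eqv_diff: "eqv t t' \<Longrightarrow> eqv (t - s) (t' - s)" for t t' s
    unfolding eqv_def by simp
  \<comment> \<open>Each removal of 3 from the direction costs a half turn, that is, a sign.\<close>
  define turn where "turn u t = (if even (u div 3) then t else - t)" for u :: nat and t :: "int \<times> int"
  have turn_Suc: "turn (Suc u) t = (if u mod 3 = 2 then - turn u t else turn u t)" for u t
    by (auto simp: turn_def div_Suc mod_Suc)
  have turn_dir: "turn u (dir u) = dir (u mod 3)" for u
  proof (induction u rule: less_induct)
    case (less u)
    show ?case
    proof (cases "u < 3")
      case False
      then obtain v where v: "u = v + 3" by (metis add.commute le_Suc_ex not_less)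
      have "turn u (dir u) = turn v (dir v)" by (simp add: v turn_def dir_add_3)
      then show ?thesis using less[of v] by (simp add: v)
    qed (simp add: turn_def)
  qed
  have turn_eqv: "eqv (turn u t) (turn u t') \<longleftrightarrow> eqv t t'" for u t t'
    using eqv_uminus[of t t'] eqv_uminus[of "- t" "- t'"] by (auto simp: turn_def)
  define cov where "cov t u = to_nat (red (turn u t), u mod 3)" for t u
  have cov_eq: "cov t u = cov t' u' \<longleftrightarrow> u mod 3 = u' mod 3 \<and> eqv (turn u t) (turn u' t')" for t u t' u'
    by (auto simp: cov_def red_iff)
  define A where "A = {cov t u | t u. True}"
  \<comment> \<open>From direction 2 the next direction is 3, which is direction 0 after a half
    turn; hence the sign in that case.\<close>
  define \<phi> where "\<phi> x = (if x \<in> A then (case from_nat x of (s, r) \<Rightarrow>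
    if r = 2 then to_nat (red (- s), 0 :: nat) else to_nat (red s, Suc r)) else x)" for x
  define \<alpha> where "\<alpha> x = (if x \<in> A then (case from_nat x of (s, r) \<Rightarrow>
    to_nat (red (- s - dir r), r :: nat)) else x)" for x
  have in_A: "cov t u \<in> A" for t u unfolding A_def by blast
  have face: "\<phi> (cov t u) = cov t (Suc u)" for t u
  proof -
    have "\<phi> (cov t u) = (if u mod 3 = 2 then to_nat (red (- red (turn u t)), 0 :: nat)
        else to_nat (red (red (turn u t)), Suc (u mod 3)))"
      using in_A[of t u] by (simp add: \<phi>_def) (simp add: cov_def)
    moreover have "red (- red (turn u t)) = red (- turn u t)" "red (red (turn u t)) = red (turn u t)"
      using red[of "turn u t"] eqv(2) eqv_uminus by (simp_all add: red_iff)
    ultimately show ?thesis by (simp add: cov_def turn_Suc mod_Suc)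
  qed
  have rev: "\<alpha> (cov t u) = cov (- t - dir u) u" for t u
  proof -
    have "\<alpha> (cov t u) = to_nat (red (- red (turn u t) - dir (u mod 3)), u mod 3)"
      using in_A[of t u] by (simp add: \<alpha>_def) (simp add: cov_def)
    moreover have "red (- red (turn u t) - dir (u mod 3)) = red (- turn u t - dir (u mod 3))"
      unfolding red_iff by (intro eqv_diff eqv_uminus eqv(2)[OF red])
    moreover have "- turn u t - dir (u mod 3) = turn u (- t - dir u)"
      unfolding turn_dir[symmetric] by (simp add: turn_def)
    ultimately show ?thesis by (simp add: cov_def)
  qed
  have "hex_cover A \<phi> \<alpha> K cov"
  proof (unfold_locales)
    show "cov t (u + 3) = cov (- t) u" for t u by (simp add: cov_eq turn_def eqv(1))
    show "cov t u = cov t' u \<longleftrightarrow> (\<exists>s\<in>K. t - t' = s + s)" for t t' u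
      unfolding eqv_def[symmetric] by (simp only: cov_eq turn_eqv simp_thms)
    show "u mod 3 = u' mod 3" if "cov t u = cov t' u'" for t t' u u'
      using that by (simp add: cov_eq)
  qed (use K in_A face rev in \<open>auto simp: A_def\<close>)
  then show ?thesis by (intro exI[of _ A] exI[of _ \<phi>] exI[of _ \<alpha>] exI[of _ cov]) (simp add: \<phi>_def \<alpha>_def)
qed

text \<open>Degrees and face sizes come from the cover, connectedness from
  \<open>arcs_subset_closed\<close>, and the sphere from the 12 arcs in \<open>lattice_card\<close>.
  The normal form of \<open>K\<close> supplies finiteness.\<close>

lemma trihex_of_hex_cover:
  fixes A :: "nat set"
  assumes "hex_cover A \<phi> \<alpha> K cov" and outside: "\<And>x. x \<notin> A \<Longrightarrow> \<phi> x = x" "\<And>x. x \<notin> A \<Longrightarrow> \<alpha> x = x"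
    and K: "K = lattice a b d" "0 < a" "0 < d"
  shows "\<exists>M :: (nat, nat) embedded_graph. trihex M \<and> arcs (graph_of M) = A \<and> face_succ M = \<phi> \<and> edge_rev M = \<alpha>"
proof -
  interpret C: hex_cover A \<phi> \<alpha> K cov by fact
  have fin: "finite A" by (rule C.lattice_card(1)[OF K])
  have face_in: "\<phi> x \<in> A" if "x \<in> A" for x using C.cov_surj[OF that] C.cov_in by (auto simp: C.cov_face)
  have rev_in: "\<alpha> x \<in> A" if "x \<in> A" for x using C.cov_surj[OF that] C.cov_in C.cov_rev by metis
  have rev_rev: "\<alpha> (\<alpha> x) = x" for x using C.rev_rev outside by (cases "x \<in> A") auto
  have face_perm: "\<phi> permutes A"
  proof (rule bij_imp_permutes)
    have "inj_on \<phi> A"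
    proof (rule inj_onI)
      fix x y assume xy: "x \<in> A" "y \<in> A" "\<phi> x = \<phi> y"
      have six: "(\<phi> ^^ 5) (\<phi> z) = z" if z_in: "z \<in> A" for z
      proof -
        obtain t u where z: "z = cov t u" using C.cov_surj[OF z_in] by blast
        have "(\<phi> ^^ 5) (\<phi> z) = cov t (u + 6)" by (simp only: z C.cov_face C.cov_face_funpow) (simp add: add.commute)
        then show ?thesis by (simp only: C.cov_period z)
      qed
      show "x = y" using six[OF xy(1)] six[OF xy(2)] unfolding xy(3) by (rule trans[OF sym])
    qed
    moreover have "\<phi> ` A \<subseteq> A" using face_in by blast
    ultimately show "bij_betw \<phi> A A" using endo_inj_surj[OF fin] by (simp add: bij_betw_def)
  qed (rule outside)
  have rev_perm: "\<alpha> permutes A"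
  proof (rule bij_imp_permutes)
    show "bij_betw \<alpha> A A"
      by (rule bij_betw_byWitness[of _ \<alpha>]) (use rev_rev rev_in in auto)
  qed (rule outside)
  define \<sigma> where "\<sigma> = \<phi> \<circ> \<alpha>"
  have succ_perm: "\<sigma> permutes A" unfolding \<sigma>_def using rev_perm face_perm by (rule permutes_compose)
  have self: "x \<in> orbit \<sigma> x" for x
    using succ_perm fin permutation_permutes permutation_self_in_orbit by metis
  have orbit_eq: "orbit \<sigma> y = orbit \<sigma> x" if "y \<in> orbit \<sigma> x" for x y
    using orbit_cyclic_eq3[OF cyclic_on_orbit[OF succ_perm fin] that] .
  have orbit_sub: "orbit \<sigma> x \<subseteq> A" if "x \<in> A" for x
    using permutes_orbit_subset[OF succ_perm that] .
  have orbit_card: "card (orbit \<sigma> x) = 3" if x: "x \<in> A" for x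
  proof -
    have cube: "\<sigma> (\<sigma> (\<sigma> x)) = x" using C.succ_cubed[OF x] by (simp add: \<sigma>_def)
    have neq: "\<sigma> x \<noteq> x" using C.succ_neq[OF x] by (simp add: \<sigma>_def)
    have "(\<sigma> ^^ 3) x = x" using cube by (simp add: numeral_3_eq_3)
    then show ?thesis
    proof (rule card_orbit_eqI)
      fix j :: nat assume "0 < j" "j < 3"
      then have "j = 1 \<or> j = 2" by auto
      then show "(\<sigma> ^^ j) x \<noteq> x" using cube neq by (auto simp: numeral_2_eq_2)
    qed simp
  qed
  \<comment> \<open>A vertex is represented by the least arc of its 3-cycle, so vertices are natural
    numbers too.\<close>
  define base where "base x = Min (orbit \<sigma> x)" for x
  have base_in: "base x \<in> orbit \<sigma> x" if "x \<in> A" for x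
    unfolding base_def using self finite_subset[OF orbit_sub[OF that] fin] by (intro Min_in) auto
  have base_eq: "base x = base y \<longleftrightarrow> x \<in> orbit \<sigma> y" if "x \<in> A" "y \<in> A" for x y
  proof
    assume "base x = base y"
    then have "base x \<in> orbit \<sigma> y" "base x \<in> orbit \<sigma> x" using base_in that by metis+
    then show "x \<in> orbit \<sigma> y" using orbit_eq self by metis
  next
    assume "x \<in> orbit \<sigma> y"
    then show "base x = base y" using orbit_eq by (simp add: base_def)
  qed
  define G where "G = \<lparr>verts = base ` A, arcs = A, tail = base, head = (\<lambda>x. base (\<alpha> x))\<rparr>"
  define M where "M = \<lparr>graph_of = G, edge_rev = \<alpha>, edge_succ = \<sigma>\<rparr>"
  have G [simp]: "verts G = base ` A" "arcs G = A" "tail G = base" "head G = (\<lambda>x. base (\<alpha> x))"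
    by (simp_all add: G_def)
  have M [simp]: "graph_of M = G" "edge_rev M = \<alpha>" "edge_succ M = \<sigma>"
    by (simp_all add: M_def)
  have face: "face_succ M = \<phi>" by (simp add: fun_eq_iff face_succ_def \<sigma>_def rev_rev)
  have out: "out_arcs G (base x) = orbit \<sigma> x" if x: "x \<in> A" for x
    using base_eq[OF _ x] orbit_sub[OF x] by (auto simp: out_arcs_def)
  interpret G: fin_digraph G
    by unfold_locales (use fin rev_in in auto)
  have "bidirected_digraph G \<alpha>"
    by (rule G.bidirected_digraphI) (use C.rev_neq rev_rev outside in auto)
  moreover have "cyclic_on \<sigma> (out_arcs G v)" if "v \<in> verts G" for v
    using that out cyclic_on_orbit[OF succ_perm fin] by auto
  ultimately have rs: "rotation_system M"
    unfolding rotation_system_def using G.fin_digraph_axioms succ_perm by simp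
  have deg: "out_degree G v = 3" if "v \<in> verts G" for v
    using that out orbit_card by (auto simp: out_degree_def)
  interpret M: cubic_map M
    by unfold_locales (use rs deg in auto)
  have faces: "card F = 3 \<or> card F = 6" if "F \<in> faces M" for F
    using that C.card_orbit_face by (auto simp: faces_def face)
  have "Digraph_Component.connected (graph_of M)"
  proof (rule M.connectedI)
    show "cov 0 0 \<in> M.A" using C.cov_in by simp
    fix S assume "cov 0 0 \<in> S" "\<And>y. y \<in> S \<Longrightarrow> y \<in> M.A \<Longrightarrow> M.\<phi> y \<in> S"
      "\<And>y. y \<in> S \<Longrightarrow> y \<in> M.A \<Longrightarrow> M.\<alpha> y \<in> S"
    then show "M.A \<subseteq> S" using C.arcs_subset_closed[of S] by (simp add: face)
  qed
  moreover have "card {x \<in> M.A. M.\<phi> (M.\<phi> (M.\<phi> x)) = x} = 12"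
    using C.lattice_card(3)[OF K] by (simp add: face)
  ultimately have "spherical M"
    unfolding spherical_def using M.euler_characteristic_iff[OF faces] by blast
  then have "trihex M" using rs deg faces by (simp add: trihex_def)
  then show ?thesis using face by (intro exI[of _ M]) simp
qed

lemma cubic_map_trihex: "trihex M \<Longrightarrow> cubic_map M"
  by (simp add: trihex_def cubic_map_def)

lemma hex_covered_card_verts:
  assumes "cubic_map M" "hex_covered M (lattice a b d)" "0 < a" "0 < d"
  shows "int (card (verts (graph_of M))) = 4 * (a * d)"
proof -
  interpret M: cubic_map M by fact
  obtain cov where "hex_cover M.A M.\<phi> M.\<alpha> (lattice a b d) cov"
    using assms(2) by (auto simp: hex_covered_def)
  then have "int (card M.A) = 12 * (a * d)"
    using hex_cover.lattice_card(2)[OF _ refl assms(3,4)] by blast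
  then show ?thesis by (simp add: M.card_arcs)
qed

lemma lattices_imp_trihex:
  assumes "K \<in> lattices n"
  shows "\<exists>M \<in> trihexes (4 * n). hex_covered M K"
proof -
  obtain a b d where K: "0 < a" "0 < d" "a * d = int n" "K = lattice a b d"
    using assms unfolding lattices_def by blast
  obtain A :: "nat set" and \<phi> \<alpha> cov where C: "hex_cover A \<phi> \<alpha> K cov"
    "\<And>x. x \<notin> A \<Longrightarrow> \<phi> x = x" "\<And>x. x \<notin> A \<Longrightarrow> \<alpha> x = x"
    using hex_cover_exists[OF subgroup2_lattices[OF assms]] by blast
  obtain M :: "(nat, nat) embedded_graph" where M: "trihex M" "arcs (graph_of M) = A"
    "face_succ M = \<phi>" "edge_rev M = \<alpha>"
    using trihex_of_hex_cover[OF C K(4,1,2)] by blast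
  have covered: "hex_covered M K" using C(1) M(2-4) by (auto simp: hex_covered_def)
  then have "int (card (verts (graph_of M))) = int (4 * n)"
    using hex_covered_card_verts[OF cubic_map_trihex[OF M(1)]] K by simp
  then have "card (verts (graph_of M)) = 4 * n" by (simp only: of_nat_eq_iff)
  then show ?thesis using covered M(1) by (auto simp: trihexes_def)
qed

section \<open>Sublattices from trihexes\<close>

text \<open>An integer power of \<open>f\<close>, with the inverse passed as \<open>f'\<close>: here
  both are explicit words in \<open>\<phi>\<close> and \<open>\<alpha>\<close>.\<close>

definition int_funpow :: "('b \<Rightarrow> 'b) \<Rightarrow> ('b \<Rightarrow> 'b) \<Rightarrow> int \<Rightarrow> 'b \<Rightarrow> 'b" where
  "int_funpow f f' n = (if n \<ge> 0 then f ^^ nat n else f' ^^ nat (- n))"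

lemma int_funpow_0 [simp]: "int_funpow f f' 0 x = x"
  by (simp add: int_funpow_def)

lemma int_funpow_Suc:
  assumes "\<And>x. f (f' x) = x"
  shows "f (int_funpow f f' n x) = int_funpow f f' (n + 1) x"
proof (cases "n \<ge> 0")
  case True
  then show ?thesis by (simp add: int_funpow_def nat_add_distrib)
next
  case False
  then obtain k where k: "n = - int (Suc k)" by (metis int_cases linorder_not_le negD)
  have "int_funpow f f' (n + 1) x = (f' ^^ k) x"
    by (cases k) (simp_all add: k int_funpow_def nat_add_distrib)
  moreover have "nat (- n) = Suc k" by (simp add: k)
  ultimately show ?thesis using False assms by (simp add: int_funpow_def)
qed

lemma int_funpow_pred:
  assumes "\<And>x. f (f' x) = x" "\<And>x. f' (f x) = x"
  shows "f' (int_funpow f f' n x) = int_funpow f f' (n - 1) x"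
  using int_funpow_Suc[of f f' "n - 1" x] assms by (metis diff_add_cancel)

lemma int_funpow_commute:
  assumes inv: "\<And>x. f (f' x) = x" "\<And>x. f' (f x) = x" and g: "\<And>x. g (f x) = f (g x)"
  shows "g (int_funpow f f' n x) = int_funpow f f' n (g x)"
proof (induction n rule: int_induct[where k = 0])
  case (step1 i)
  then show ?case by (simp add: g flip: int_funpow_Suc[of f f', OF inv(1)])
next
  case (step2 i)
  have "g (f' y) = f' (g y)" for y using g[of "f' y"] inv by metis
  then show ?case using step2 by (simp flip: int_funpow_pred[of f f', OF inv])
qed simp

text \<open>An action of the rotation group of the hexagonal tiling, presented by the half turn
  \<open>\<alpha>\<close> about an edge, the rotation \<open>\<phi>\<close> about a face and their product about a vertex.\<close>

locale hex_action =
  fixes \<phi> \<alpha> :: "'b \<Rightarrow> 'b"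
  assumes rev_rev: "\<alpha> (\<alpha> x) = x"
    and face6: "\<phi> (\<phi> (\<phi> (\<phi> (\<phi> (\<phi> x))))) = x"
    and succ3: "\<phi> (\<alpha> (\<phi> (\<alpha> (\<phi> (\<alpha> x))))) = x"
begin

lemma face_inj: "\<phi> x = \<phi> y \<longleftrightarrow> x = y"
  using face6 by metis

text \<open>The relation of order 3 solved for \<open>\<alpha> (\<phi> (\<alpha> x))\<close>: it is
  the word \<open>\<phi>\<close>^-1 \<open>\<alpha>\<close> \<open>\<phi>\<close>^-1, with
  \<open>\<phi>\<close>^5 written for the inverse. Together with the next lemma it normalises the
  words below.\<close>

lemma rev_face_rev: "\<alpha> (\<phi> (\<alpha> x)) = \<phi> (\<phi> (\<phi> (\<phi> (\<phi> (\<alpha> (\<phi> (\<phi> (\<phi> (\<phi> (\<phi> x))))))))))"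
proof -
  have "\<phi> (\<alpha> (\<phi> (\<alpha> (\<phi> y)))) = \<alpha> y" for y
    using succ3[of "\<alpha> y"] by (simp only: rev_rev)
  from this[of "\<phi> (\<phi> (\<phi> (\<phi> (\<phi> x))))"]
  have "\<phi> (\<alpha> (\<phi> (\<alpha> x))) = \<alpha> (\<phi> (\<phi> (\<phi> (\<phi> (\<phi> x)))))" by (simp only: face6)
  then show ?thesis using face6[of "\<alpha> (\<phi> (\<alpha> x))"] by simp
qed

lemma rev_face5_rev: "\<alpha> (\<phi> (\<phi> (\<phi> (\<phi> (\<phi> (\<alpha> x)))))) = \<phi> (\<alpha> (\<phi> x))"
  using rev_face_rev[of "\<phi> (\<alpha> (\<phi> x))"] by (metis face6 rev_rev succ3)

text \<open>On a dart \<open>(t, u)\<close> of the tiling these words translate by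
  \<open>dir u\<close> and \<open>dir (u + 2)\<close>: the basis vectors as seen in the frame of the
  dart. The primed words are their inverses.\<close>

abbreviation "tx x \<equiv> \<phi> (\<phi> (\<phi> (\<alpha> x)))"
abbreviation "tx' x \<equiv> \<alpha> (\<phi> (\<phi> (\<phi> x)))"
abbreviation "ty x \<equiv> \<phi> (\<alpha> (\<phi> (\<phi> x)))"
abbreviation "ty' x \<equiv> \<phi> (\<phi> (\<phi> (\<phi> (\<alpha> (\<phi> (\<phi> (\<phi> (\<phi> (\<phi> x)))))))))"

lemma tx_inverse: "tx (tx' x) = x" "tx' (tx x) = x"
  by (simp_all add: rev_rev face6)

lemma ty_inverse: "ty (ty' x) = x" "ty' (ty x) = x"
  by (simp_all add: rev_rev face6)

lemma tx_ty: "tx (ty x) = \<phi> (\<phi> (\<alpha> (\<phi> x)))"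
  by (simp add: rev_face_rev face6)

lemma ty_tx: "ty (tx x) = tx (ty x)"
  by (simp add: rev_face5_rev rev_face_rev face6)

definition transl :: "int \<times> int \<Rightarrow> 'b \<Rightarrow> 'b" where
  "transl t x = int_funpow tx tx' (fst t) (int_funpow ty ty' (snd t) x)"

lemma transl_0: "transl 0 x = x"
  by (simp add: transl_def)

lemma tx_transl: "tx (transl t x) = transl (t + (1, 0)) x"
  using int_funpow_Suc[of tx tx', OF tx_inverse(1)] by (simp add: transl_def)

lemma tx'_transl: "tx' (transl t x) = transl (t - (1, 0)) x"
  using int_funpow_pred[of tx tx', OF tx_inverse] by (simp add: transl_def)

lemma ty_transl: "ty (transl t x) = transl (t + (0, 1)) x"
  using int_funpow_Suc[of ty ty', OF ty_inverse(1)]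
    int_funpow_commute[of tx tx' ty, OF tx_inverse ty_tx]
  by (simp add: transl_def)

lemma ty'_transl: "ty' (transl t x) = transl (t - (0, 1)) x"
  using ty_transl[of "t - (0, 1)" x] ty_inverse(2)[of "transl (t - (0, 1)) x"] by simp

lemma transl_transl: "transl s (transl t x) = transl (s + t) x"
proof (induction s rule: int2_induct)
  case (right s)
  then show ?case using tx_transl[of "s + t" x] tx_transl[of s "transl t x"] by (simp add: algebra_simps)
next
  case (left s)
  then show ?case using tx'_transl[of "s + t" x] tx'_transl[of s "transl t x"] by (simp add: algebra_simps)
next
  case (up s)
  then show ?case using ty_transl[of "s + t" x] ty_transl[of s "transl t x"] by (simp add: algebra_simps)
next
  case (down s)
  then show ?case using ty'_transl[of "s + t" x] ty'_transl[of s "transl t x"] by (simp add: algebra_simps)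
qed (simp add: transl_0)

text \<open>Translations act in the frame of the dart, which \<open>\<phi>\<close> turns by 60
  degrees. It suffices to compare the words on the generators: \<open>rot\<close> sends (1, 0) to
  (1, 1) and (0, 1) to (-1, 0).\<close>

lemma transl_face: "transl t (\<phi> x) = \<phi> (transl (rot t) x)"
proof (induction t rule: int2_induct)
  case zero
  then show ?case by (simp add: transl_0 rot_zero)
next
  case (right t)
  have "transl (t + (1, 0)) (\<phi> x) = tx (\<phi> (transl (rot t) x))" by (simp flip: tx_transl add: right)
  also have "\<dots> = \<phi> (tx (ty (transl (rot t) x)))" by (simp only: tx_ty)
  also have "tx (ty (transl (rot t) x)) = transl (rot (t + (1, 0))) x"
    by (simp only: tx_transl ty_transl) (simp add: rot_add add.assoc, simp add: rot_def)
  finally show ?case .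
next
  case (left t)
  have "transl (t - (1, 0)) (\<phi> x) = tx' (\<phi> (transl (rot t) x))" by (simp flip: tx'_transl add: left)
  moreover have "transl (rot t) x = tx (ty (transl (rot (t - (1, 0))) x))"
    by (simp only: tx_transl ty_transl) (simp add: rot_diff add.assoc diff_add_eq, simp add: rot_def)
  ultimately show ?case by (simp only: tx_ty face6 rev_rev)
next
  case (up t)
  have "transl (t + (0, 1)) (\<phi> x) = ty (\<phi> (transl (rot t) x))" by (simp flip: ty_transl add: up)
  \<comment> \<open>The word \<open>ty (\<phi> y)\<close> is literally
    \<open>\<phi> (tx' y)\<close>.\<close>
  also have "tx' (transl (rot t) x) = transl (rot (t + (0, 1))) x"
    unfolding tx'_transl by (simp add: rot_add) (simp add: rot_def prod_eq_iff)
  finally show ?case .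
next
  case (down t)
  have "transl (t - (0, 1)) (\<phi> x) = ty' (\<phi> (transl (rot t) x))" by (simp flip: ty'_transl add: down)
  also have "\<dots> = \<phi> (tx (transl (rot t) x))" by (simp only: face6)
  also have "tx (transl (rot t) x) = transl (rot (t - (0, 1))) x"
    unfolding tx_transl by (simp add: rot_diff) (simp add: rot_def prod_eq_iff)
  finally show ?case .
qed

lemma transl_funpow_face: "transl t ((\<phi> ^^ u) x) = (\<phi> ^^ u) (transl ((rot ^^ u) t) x)"
proof (induction u arbitrary: t)
  case (Suc u)
  then show ?case by (simp only: funpow.simps o_apply transl_face funpow_swap1[of rot])
qed simp

lemma transl_face3: "transl t (\<phi> (\<phi> (\<phi> x))) = \<phi> (\<phi> (\<phi> (transl (- t) x)))"
  by (simp add: transl_face rot_rot_rot)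

lemma face_transl: "\<phi> (transl t x) = transl (- rot (rot t)) (\<phi> x)"
  by (simp add: transl_face rot_uminus rot_rot_rot)

text \<open>As \<open>tx\<close> is \<open>\<phi>\<close>^3 after \<open>\<alpha>\<close>, the
  reversal is \<open>\<phi>\<close>^3 after \<open>tx\<close>; moving it past
  \<open>\<phi>\<close>^u rotates the translation to \<open>dir u\<close>.\<close>

lemma rev_funpow_face: "\<alpha> ((\<phi> ^^ u) x) = (\<phi> ^^ u) (\<phi> (\<phi> (\<phi> (transl (dir u) x))))"
proof -
  have rev: "\<alpha> y = \<phi> (\<phi> (\<phi> (transl (dir 0) y)))" for y
    using tx_transl[of 0 y, symmetric] by (simp add: transl_0 dir_0 face6)
  have "\<alpha> ((\<phi> ^^ u) x) = \<phi> (\<phi> (\<phi> (transl (dir 0) ((\<phi> ^^ u) x))))" by (rule rev)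
  also have "\<dots> = \<phi> (\<phi> (\<phi> ((\<phi> ^^ u) (transl (dir u) x))))"
    by (simp add: transl_funpow_face dir_def)
  finally show ?thesis by (simp add: funpow_swap1)
qed

lemma funpow_face_period: "(\<phi> ^^ (u + 6 * n)) x = (\<phi> ^^ u) x"
proof (induction n)
  case (Suc n)
  have "(\<phi> ^^ (u + 6 * Suc n)) x = (\<phi> ^^ (u + 6 * n + 6)) x" by (simp add: algebra_simps)
  also have "\<dots> = (\<phi> ^^ (u + 6 * n)) ((\<phi> ^^ 6) x)" by (simp only: funpow_add o_apply)
  also have "(\<phi> ^^ 6) x = x" by (simp add: numeral_eq_Suc face6)
  finally show ?case using Suc by simp
qed simp

end

text \<open>The inequalities say that no arc is fixed by the half turn about an edge, by the
  rotation about a vertex, or by the rotation of order 3 about a face. The base arc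
  \<open>x0\<close> lies on a triangle, so the half turn about its face fixes it.\<close>

locale hex_free_action = hex_action \<phi> \<alpha> for \<phi> \<alpha> :: "'b \<Rightarrow> 'b" +
  fixes A :: "'b set" and x0 :: 'b
  assumes face_in: "\<phi> x \<in> A \<longleftrightarrow> x \<in> A" and rev_in: "\<alpha> x \<in> A \<longleftrightarrow> x \<in> A"
    and rev_neq: "x \<in> A \<Longrightarrow> \<alpha> x \<noteq> x" and succ_neq: "x \<in> A \<Longrightarrow> \<phi> (\<alpha> x) \<noteq> x"
    and face2_neq: "x \<in> A \<Longrightarrow> \<phi> (\<phi> x) \<noteq> x"
    and x0: "x0 \<in> A" "\<phi> (\<phi> (\<phi> x0)) = x0"
    and transitive: "\<And>S. S \<subseteq> A \<Longrightarrow> x0 \<in> S \<Longrightarrow> (\<And>y. y \<in> S \<Longrightarrow> \<phi> y \<in> S) \<Longrightarrow>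
      (\<And>y. y \<in> S \<Longrightarrow> \<alpha> y \<in> S) \<Longrightarrow> S = A"
begin

lemma transl_in: "transl t x \<in> A \<longleftrightarrow> x \<in> A"
proof (induction t rule: int2_induct)
  case (right t)
  then show ?case by (simp flip: tx_transl add: face_in rev_in)
next
  case (left t)
  then show ?case by (simp flip: tx'_transl add: face_in rev_in)
next
  case (up t)
  then show ?case by (simp flip: ty_transl add: face_in rev_in)
next
  case (down t)
  then show ?case by (simp flip: ty'_transl add: face_in rev_in)
qed (simp add: transl_0)

lemma funpow_face_in: "(\<phi> ^^ u) x \<in> A \<longleftrightarrow> x \<in> A"
  by (induction u) (simp_all add: face_in)

lemma face3_transl_x0: "\<phi> (\<phi> (\<phi> (transl t x0))) = transl (- t) x0"
  using transl_face3[of "- t" x0] x0 by simp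

text \<open>Otherwise the half turn about \<open>t / 2\<close>, the centre of an edge, would fix an arc.\<close>

lemma stabilizer_even:
  assumes "transl t x0 = x0"
  shows "\<exists>r. t = r + r"
proof (rule ccontr)
  assume odd: "\<nexists>r. t = r + r"
  \<comment> \<open>\<open>t\<close> is split modulo 2 L; a nonzero remainder \<open>e\<close> is
    one of the three unit vectors \<open>dir 0\<close>, \<open>dir 1\<close>,
    \<open>dir 2\<close>.\<close>
  define r where "r = (fst t div 2, snd t div 2)"
  define e where "e = (fst t mod 2, snd t mod 2)"
  have t: "t = r + r + e" by (simp add: r_def e_def prod_eq_iff)
  have "e \<noteq> 0"
  proof
    assume "e = 0"
    then have "t = r + r" using t by simp
    then show False using odd by blast
  qed
  then have "e \<in> {(1, 0), (1, 1), (0, 1)}" by (auto simp: e_def zero_prod_def)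
  then have "e = dir 0 \<or> e = dir 1 \<or> e = dir 2"
    by (auto simp: dir_Suc dir_0 rot_def numeral_2_eq_2)
  then obtain u where u: "e = dir u" by blast
  \<comment> \<open>Both \<open>transl t\<close> and the half turn fix \<open>x0\<close>. Moving the
    base point by \<open>r\<close> replaces \<open>t\<close> by \<open>e\<close> in their product,
    which then is the half turn about an edge at \<open>y\<close>.\<close>
  define y where "y = transl r x0"
  have "y = transl r (\<phi> (\<phi> (\<phi> (transl t x0))))" by (simp add: y_def assms x0)
  also have "\<dots> = \<phi> (\<phi> (\<phi> (transl (dir u) y)))"
    by (simp add: transl_face3 transl_transl y_def t u add_ac)
  finally have "\<alpha> ((\<phi> ^^ u) y) = (\<phi> ^^ u) y" by (simp only: rev_funpow_face)
  moreover have "(\<phi> ^^ u) y \<in> A" using x0 by (simp add: y_def funpow_face_in transl_in)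
  ultimately show False using rev_neq by blast
qed

text \<open>The centre of a rotation of order 3 with translation part \<open>s\<close> is determined up to translations by
  \<open>s\<close> modulo the sublattice \<open>{rot r + r}\<close> of index 3; it is a face or a vertex.\<close>

lemma face2_neq_transl:
  assumes y: "y \<in> A"
  shows "\<phi> (\<phi> y) \<noteq> transl s y"
proof
  assume eq: "\<phi> (\<phi> y) = transl s y"
  \<comment> \<open>The vectors \<open>rot r + r\<close> are those whose coordinate sum is divisible
    by 3, so \<open>s\<close> is reduced to \<open>(e, 0)\<close> with \<open>e\<close> the residue
    of its coordinate sum in {-1, 0, 1}.\<close>
  define e where "e = (fst s + snd s + 1) mod 3 - 1"
  define h where "h = (fst s + snd s - e) div 3"
  define r where "r = (h, snd s - h)"
  have e: "e = 0 \<or> e = 1 \<or> e = - 1"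
    unfolding e_def using pos_mod_bound[of 3 "fst s + snd s + 1"] pos_mod_sign[of 3 "fst s + snd s + 1"] by linarith
  have "3 dvd fst s + snd s - e"
    using dvd_minus_mod[of 3 "fst s + snd s + 1"] by (simp add: e_def algebra_simps)
  then have "fst s + snd s - e = 3 * h" by (simp add: h_def)
  then have s: "- (rot r + r) + s = (e, 0)" by (simp add: r_def rot_def prod_eq_iff)
  define z where "z = transl r y"
  have z: "z \<in> A" using y by (simp add: z_def transl_in)
  have "\<phi> (\<phi> z) = transl (rot (rot (rot (rot r)))) (\<phi> (\<phi> y))"
    by (simp add: z_def face_transl rot_uminus)
  also have "\<dots> = transl (- (rot r + r) + s) z"
    unfolding eq z_def by (simp add: transl_transl rot_rot_rot rot_uminus algebra_simps)
  finally have "\<phi> (\<phi> z) = transl (e, 0) z" by (simp only: s)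
  \<comment> \<open>Cancelling \<open>\<phi>\<close>, the case of \<open>tx\<close> says that the
    vertex rotation fixes \<open>z\<close>, and that of \<open>tx'\<close> that it fixes
    \<open>\<phi> (\<phi> (\<phi> z))\<close>.\<close>
  with e consider "\<phi> (\<phi> z) = z" | "\<phi> (\<phi> z) = tx z" | "\<phi> (\<phi> z) = tx' z"
    using tx_transl[of 0 z] tx'_transl[of 0 z] transl_0[of z] by (auto simp: zero_prod_def)
  then show False
  proof cases
    case 1
    then show ?thesis using face2_neq z by blast
  next
    case 2
    then have "z = \<phi> (\<alpha> z)" by (simp add: face_inj)
    then show ?thesis using succ_neq z by metis
  next
    case 3
    then have "\<phi> (\<alpha> (\<phi> (\<phi> (\<phi> z)))) = \<phi> (\<phi> (\<phi> z))" by simp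
    then show ?thesis using succ_neq[of "\<phi> (\<phi> (\<phi> z))"] z by (simp add: face_in)
  qed
qed

text \<open>Squaring a rotation of order 6 gives one of order 3.\<close>

lemma face_neq_transl:
  assumes y: "y \<in> A"
  shows "\<phi> y \<noteq> transl s y"
proof
  assume eq: "\<phi> y = transl s y"
  then have "\<phi> (\<phi> y) = transl (- rot (rot s)) (transl s y)" by (simp add: face_transl)
  then show False using face2_neq_transl[OF y] by (simp add: transl_transl)
qed

definition cover :: "int \<times> int \<Rightarrow> nat \<Rightarrow> 'b" where
  "cover t u = (\<phi> ^^ u) (transl t x0)"

text \<open>The half turn about \<open>s\<close> is the half turn about the base face followed by
  the translation by \<open>s + s\<close>. As the former fixes \<open>x0\<close>, this is the set of
  centres of half turns in the stabilizer.\<close>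

definition centers :: "(int \<times> int) set" where
  "centers = {s. transl (s + s) x0 = x0}"

lemma transl_eq_iff: "transl t x0 = transl t' x0 \<longleftrightarrow> transl (t - t') x0 = x0"
proof
  assume "transl t x0 = transl t' x0"
  then have "transl (- t') (transl t x0) = transl (- t') (transl t' x0)" by simp
  then show "transl (t - t') x0 = x0" by (simp add: transl_transl transl_0)
next
  assume "transl (t - t') x0 = x0"
  then have "transl t' (transl (t - t') x0) = transl t' x0" by simp
  then show "transl t x0 = transl t' x0" by (simp add: transl_transl)
qed

lemma funpow_face_inj: "(\<phi> ^^ u) x = (\<phi> ^^ u) y \<longleftrightarrow> x = y"
  by (induction u) (simp_all add: face_inj)

lemma hex_cover: "hex_cover A \<phi> \<alpha> centers cover"
proof (unfold_locales)
  show "subgroup2 centers"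
    unfolding subgroup2_def
  proof (intro conjI ballI)
    show "0 \<in> centers" by (simp add: centers_def transl_0)
    fix s t assume "s \<in> centers" "t \<in> centers"
    then have "transl (s + s) x0 = transl (t + t) x0" by (simp add: centers_def)
    moreover have "s - t + (s - t) = s + s - (t + t)" by simp
    ultimately show "s - t \<in> centers" by (simp only: centers_def mem_Collect_eq transl_eq_iff)
  qed
  show in_A: "cover t u \<in> A" for t u using x0 by (simp add: cover_def funpow_face_in transl_in)
  show face: "\<phi> (cover t u) = cover t (Suc u)" for t u by (simp add: cover_def)
  show shift: "cover t (u + 3) = cover (- t) u" for t u
  proof -
    have "cover t (u + 3) = (\<phi> ^^ u) ((\<phi> ^^ 3) (transl t x0))" by (simp only: cover_def funpow_add o_apply)
    also have "(\<phi> ^^ 3) (transl t x0) = transl (- t) x0" by (simp add: numeral_3_eq_3 face3_transl_x0)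
    finally show ?thesis by (simp add: cover_def)
  qed
  show rev: "\<alpha> (cover t u) = cover (- t - dir u) u" for t u
  proof -
    have "- (dir u + t) = - t - dir u" by simp
    then show ?thesis unfolding cover_def rev_funpow_face transl_transl face3_transl_x0 by (simp only:)
  qed
  show "cover t u = cover t' u \<longleftrightarrow> (\<exists>s\<in>centers. t - t' = s + s)" for t t' u
  proof -
    have "cover t u = cover t' u \<longleftrightarrow> transl (t - t') x0 = x0"
      by (simp only: cover_def funpow_face_inj transl_eq_iff)
    also have "\<dots> \<longleftrightarrow> (\<exists>s\<in>centers. t - t' = s + s)"
      using stabilizer_even[of "t - t'"] by (auto simp: centers_def)
    finally show ?thesis .
  qed
  show "u mod 3 = u' mod 3" if eq: "cover t u = cover t' u'" for t t' u u'
  proof -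
    \<comment> \<open>5 u is -u modulo 6, so \<open>j\<close> is the difference u' - u of the
      directions, kept natural.\<close>
    define j where "j = u' + 5 * u"
    have "(\<phi> ^^ (5 * u)) (cover t u) = (\<phi> ^^ (5 * u)) (cover t' u')" using eq by simp
    then have "(\<phi> ^^ (0 + 6 * u)) (transl t x0) = (\<phi> ^^ j) (transl t' x0)"
      by (simp add: cover_def j_def add_ac flip: funpow_add[THEN fun_cong, unfolded o_apply])
    then have "transl t x0 = (\<phi> ^^ j) (transl t' x0)" unfolding funpow_face_period by simp
    also have "\<dots> = (\<phi> ^^ (j mod 3)) ((\<phi> ^^ (3 * (j div 3))) (transl t' x0))"
      by (simp flip: funpow_add[THEN fun_cong, unfolded o_apply])
    finally have j: "(\<phi> ^^ (j mod 3)) ((\<phi> ^^ (3 * (j div 3))) (transl t' x0)) = transl t x0" by (rule sym)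
    \<comment> \<open>Triples of face steps act on translates of \<open>x0\<close> as half turns and
      so yield translates again; only \<open>j mod 3\<close> is left to be excluded.\<close>
    have "\<exists>s. (\<phi> ^^ (3 * q)) (transl t' x0) = transl s x0" for q
    proof (induction q)
      case 0
      show ?case by (rule exI[of _ t']) simp
    next
      case (Suc q)
      then obtain s where "(\<phi> ^^ (3 * q)) (transl t' x0) = transl s x0" by blast
      then show ?case
        using face3_transl_x0[of s] by (intro exI[of _ "- s"]) (simp add: numeral_3_eq_3)
    qed
    then obtain s where "(\<phi> ^^ (3 * (j div 3))) (transl t' x0) = transl s x0" by blast
    then have *: "(\<phi> ^^ (j mod 3)) (transl s x0) = transl (t - s) (transl s x0)"
      using j by (simp add: transl_transl)
    have "transl s x0 \<in> A" using x0 by (simp add: transl_in)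
    then have "j mod 3 \<noteq> 1" "j mod 3 \<noteq> 2"
      using * face_neq_transl[of "transl s x0" "t - s"] face2_neq_transl[of "transl s x0" "t - s"]
      by (auto simp: numeral_2_eq_2)
    moreover have "j mod 3 < 3" by simp
    ultimately have "j mod 3 = 0" by linarith
    then show ?thesis unfolding j_def by presburger
  qed
  show "\<exists>t u. x = cover t u" if "x \<in> A" for x
  proof -
    have "{cover t u | t u. True} = A"
    proof (rule transitive)
      show "x0 \<in> {cover t u | t u. True}"
        by (rule CollectI, rule exI[of _ 0], rule exI[of _ 0]) (simp add: cover_def transl_0)
    qed (use in_A face rev in blast)+
    then show ?thesis using that by blast
  qed
qed

text \<open>Pigeonhole: the translates of \<open>x0\<close> along a line lie in a finite set. If the
  translation by v fixes \<open>x0\<close>, so does that by v + v, and v is a centre. The two axes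
  supply the vectors for \<open>hermite_normal_form_exists\<close>.\<close>

lemma centers_axis:
  assumes "finite A"
  shows "\<exists>k>0. (k * p, k * q) \<in> centers"
proof -
  let ?f = "\<lambda>n::nat. transl (int n * p, int n * q) x0"
  have "range ?f \<subseteq> A" using x0 by (auto simp: transl_in)
  then have "\<not> inj ?f" using assms finite_subset range_inj_infinite by blast
  then obtain m n where mn: "m < n" "?f n = ?f m"
    unfolding inj_def by (metis linorder_neqE_nat)
  define k where "k = int n - int m"
  have k: "k > 0" using mn by (simp add: k_def)
  have "transl (k * p, k * q) x0 = x0"
    using mn(2) unfolding transl_eq_iff by (simp add: k_def algebra_simps)
  moreover have "(k * p, k * q) + (k * p, k * q) = (k * p, k * q) + (k * p, k * q)" ..
  ultimately have "transl ((k * p, k * q) + (k * p, k * q)) x0 = x0"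
    by (metis transl_transl)
  then show ?thesis using k by (auto simp: centers_def)
qed

end

lemma trihex_imp_hex_covered:
  fixes M :: "('a, 'b) embedded_graph"
  assumes "trihex M"
  shows "\<exists>a b d. 0 < a \<and> 0 < d \<and> 0 \<le> b \<and> b < a \<and> hex_covered M (lattice a b d)"
proof -
  interpret M: cubic_map M using assms by (rule cubic_map_trihex)
  have faces: "card F = 3 \<or> card F = 6" if "F \<in> faces M" for F
    using assms that by (auto simp: trihex_def)
  have conn: "Digraph_Component.connected (graph_of M)"
    and euler: "int (card (verts (graph_of M))) - int (card (edges M)) + int (card (faces M)) = 2"
    using assms by (auto simp: trihex_def spherical_def)
  have "card {x \<in> M.A. M.\<phi> (M.\<phi> (M.\<phi> x)) = x} = 12"
    using euler M.euler_characteristic_iff[OF faces] by blast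
  then have "{x \<in> M.A. M.\<phi> (M.\<phi> (M.\<phi> x)) = x} \<noteq> {}" by (metis card.empty zero_neq_numeral)
  then obtain x0 where x0: "x0 \<in> M.A" "M.\<phi> (M.\<phi> (M.\<phi> x0)) = x0" by blast
  have orbit: "card (orbit M.\<phi> x) = 3 \<or> card (orbit M.\<phi> x) = 6" if "x \<in> M.A" for x
    using faces that by (auto simp: faces_def)
  interpret hex_free_action M.\<phi> M.\<alpha> M.A x0
  proof (unfold_locales)
    show "M.\<alpha> (M.\<alpha> x) = x" for x by simp
    show "M.\<phi> (M.\<phi> (M.\<phi> (M.\<phi> (M.\<phi> (M.\<phi> x))))) = x" for x
    proof (cases "x \<in> M.A")
      case True
      have "(M.\<phi> ^^ card (orbit M.\<phi> x)) x = x" by (rule funpow_card_orbit[OF M.self_in_orbit_face])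
      then show ?thesis using orbit[OF True] by (auto simp: numeral_eq_Suc)
    next
      case False
      then show ?thesis using permutes_not_in[OF M.face_permutes] by simp
    qed
    show "M.\<phi> (M.\<alpha> (M.\<phi> (M.\<alpha> (M.\<phi> (M.\<alpha> x))))) = x" for x
      by (simp add: M.face_rev M.succ_cubed)
    show "M.\<phi> (M.\<alpha> x) \<noteq> x" if "x \<in> M.A" for x
      using M.succ_neq[OF that] by (simp add: M.face_rev)
    show "M.\<phi> (M.\<phi> x) \<noteq> x" if "x \<in> M.A" for x
      using funpow_less_card_orbit[OF M.self_in_orbit_face, of 2 x] orbit[OF that]
      by (auto simp: numeral_2_eq_2)
    show "S = M.A" if "S \<subseteq> M.A" "x0 \<in> S" "\<And>y. y \<in> S \<Longrightarrow> M.\<phi> y \<in> S" "\<And>y. y \<in> S \<Longrightarrow> M.\<alpha> y \<in> S" for S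
      using M.connected_closed_set[OF conn that] .
  qed (use x0 M.face_in_arcs_iff M.rev_in_arcs_iff M.arev_neq in auto)
  obtain m n where "m > 0" "(m * 1, m * 0) \<in> centers" "n > 0" "(n * 0, n * 1) \<in> centers"
    using centers_axis[OF M.finite_arcs] by meson
  moreover have "subgroup2 centers" using hex_cover by (simp add: hex_cover_def)
  ultimately obtain a b d where "0 < a" "0 < d" "0 \<le> b" "b < a" "centers = lattice a b d"
    using hermite_normal_form_exists[of centers m n] by auto
  moreover have "hex_covered M centers" using hex_cover by (auto simp: hex_covered_def)
  ultimately show ?thesis by metis
qed

section \<open>Counting\<close>

lemma hex_covered_lattices:
  assumes M: "M \<in> trihexes (4 * n)" and "hex_covered M (lattice a b d)" "0 < a" "0 < d" "0 \<le> b" "b < a"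
  shows "lattice a b d \<in> lattices n"
proof -
  have "cubic_map M" "card (verts (graph_of M)) = 4 * n"
    using M by (auto simp: trihexes_def intro: cubic_map_trihex)
  then have "a * d = int n" using hex_covered_card_verts[OF _ assms(2-4)] by simp
  then show ?thesis using assms unfolding lattices_def by blast
qed

lemma trihexes_imp_lattices:
  assumes "M \<in> trihexes (4 * n)"
  obtains K where "K \<in> lattices n" "hex_covered M K"
proof -
  have "trihex M" using assms by (simp add: trihexes_def)
  then obtain a b d where "0 < a" "0 < d" "0 \<le> b" "b < a" "hex_covered M (lattice a b d)"
    using trihex_imp_hex_covered by blast
  then show thesis using hex_covered_lattices[OF assms] that by blast
qed

lemma finite_lattices: "finite (lattices n)"
proof (cases "n = 0")
  case True
  then have "lattices n = {}" by (auto simp: lattices_def)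
  then show ?thesis by simp
next
  case False
  let ?I = "{0..int n}"
  have "lattices n \<subseteq> (\<lambda>(a, b, d). lattice a b d) ` (?I \<times> ?I \<times> ?I)"
  proof
    fix K assume "K \<in> lattices n"
    then obtain a b d where K: "0 < a" "0 < d" "0 \<le> b" "b < a" "a * d = int n" "K = lattice a b d"
      unfolding lattices_def by blast
    have "a dvd int n" "d dvd int n" unfolding K(5)[symmetric] by (rule dvd_triv_left dvd_triv_right)+
    then have "a \<le> int n" "d \<le> int n" using False by (simp_all add: zdvd_imp_le)
    then show "K \<in> (\<lambda>(a, b, d). lattice a b d) ` (?I \<times> ?I \<times> ?I)"
      using K by (intro image_eqI[of _ _ "(a, b, d)"]) auto
  qed
  then show ?thesis by (rule finite_subset) simp
qed

text \<open>That rotation preserves the index is read off from a trihex: a map covered by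
  \<open>K\<close> is also covered by the rotated lattice, and its number of vertices determines the
  index of both.\<close>

lemma vimage_rot_lattices:
  assumes "K \<in> lattices n"
  shows "rot -` K \<in> lattices n"
proof -
  obtain a b d where K: "0 < a" "0 < d" "K = lattice a b d"
    using assms unfolding lattices_def by blast
  have sub: "subgroup2 K" by (rule subgroup2_lattices[OF assms])
  have "(a * d, 0) \<in> K" "(0, a * d) \<in> K"
    unfolding K by (rule in_latticeI[of _ 0] in_latticeI[of _ a]; simp)+
  then have "(a * d, 0) \<in> rot -` K" "(0, a * d) \<in> rot -` K"
    using subgroup2_add[OF sub, of "(a * d, 0)" "(0, a * d)"] subgroup2_uminus[OF sub, of "(a * d, 0)"]
    by (simp_all add: rot_def)
  then obtain a' b' d' where K': "0 < a'" "0 < d'" "0 \<le> b'" "b' < a'" "rot -` K = lattice a' b' d'"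
    using hermite_normal_form_exists[OF subgroup2_vimage_rot[OF sub]] K by (metis mult_pos_pos)
  obtain M where "M \<in> trihexes (4 * n)" "hex_covered M K"
    using lattices_imp_trihex[OF assms] by blast
  then show ?thesis
    using hex_covered_lattices[of M n a' b' d'] hex_covered_rot[of M K] K' by simp
qed

text \<open>Extended by the identity, so that it is a permutation in the sense of
  \<open>permutes\<close>.\<close>

definition rot_lattice :: "nat \<Rightarrow> (int \<times> int) set \<Rightarrow> (int \<times> int) set" where
  "rot_lattice n K = (if K \<in> lattices n then rot -` K else K)"

lemma rot_lattice_cubed: "rot_lattice n (rot_lattice n (rot_lattice n K)) = K"
  using vimage_rot_lattices vimage_rot_cubed[OF subgroup2_lattices] by (simp add: rot_lattice_def)

lemma rot_lattice_permutes: "rot_lattice n permutes lattices n"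
proof (rule bij_imp_permutes)
  have "rot_lattice n ` lattices n \<subseteq> lattices n"
    by (simp add: image_subset_iff rot_lattice_def vimage_rot_lattices)
  moreover have "inj_on (rot_lattice n) (lattices n)"
    by (rule inj_on_inverseI[of _ "\<lambda>K. rot_lattice n (rot_lattice n K)"]) (rule rot_lattice_cubed)
  ultimately show "bij_betw (rot_lattice n) (lattices n) (lattices n)"
    using endo_inj_surj[OF finite_lattices] by (simp add: bij_betw_def)
qed (simp add: rot_lattice_def)

lemma orbit_rot_lattice:
  assumes "K \<in> lattices n"
  shows "orbit (rot_lattice n) K = {K, rot -` K, rot -` (rot -` K)}"
proof -
  have "orbit (rot_lattice n) K = {rot_lattice n K, rot_lattice n (rot_lattice n K), K}"
  proof (intro equalityI subsetI)
    fix L assume "L \<in> orbit (rot_lattice n) K"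
    then show "L \<in> {rot_lattice n K, rot_lattice n (rot_lattice n K), K}"
      by induction (auto simp: rot_lattice_cubed)
  next
    have "rot_lattice n K \<in> orbit (rot_lattice n) K" by (rule orbit.base)
    moreover from this have "rot_lattice n (rot_lattice n K) \<in> orbit (rot_lattice n) K" by (rule orbit.step)
    moreover from this have "rot_lattice n (rot_lattice n (rot_lattice n K)) \<in> orbit (rot_lattice n) K" by (rule orbit.step)
    ultimately show "L \<in> orbit (rot_lattice n) K" if "L \<in> {rot_lattice n K, rot_lattice n (rot_lattice n K), K}" for L
      using that by (auto simp: rot_lattice_cubed)
  qed
  then show ?thesis using assms vimage_rot_lattices by (auto simp: rot_lattice_def)
qed

lemma hex_covered_eq_orbit:
  assumes M: "M \<in> trihexes (4 * n)" and K: "K \<in> lattices n" "hex_covered M K"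
  shows "{L. hex_covered M L} = orbit (rot_lattice n) K"
  unfolding orbit_rot_lattice[OF K(1)]
proof (intro equalityI subsetI)
  fix L assume "L \<in> {L. hex_covered M L}"
  then obtain u where u: "u < 3" "L = (rot ^^ u) -` K"
    using hex_cover_unique_up_to_rot K(2) unfolding hex_covered_def by blast
  then have "u = 0 \<or> u = 1 \<or> u = 2" by auto
  then show "L \<in> {K, rot -` K, rot -` (rot -` K)}"
    unfolding u(2) by (elim disjE) (simp_all add: numeral_2_eq_2 vimage_comp vimage_id)
next
  fix L assume "L \<in> {K, rot -` K, rot -` (rot -` K)}"
  then show "L \<in> {L. hex_covered M L}" using K(2) hex_covered_rot by blast
qed

text \<open>The set of all covering sublattices is a complete invariant: it is preserved by
  isomorphisms, and a single common member already yields one.\<close>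

lemma trihex_iso_iff:
  assumes "M \<in> trihexes (4 * n)" "N \<in> trihexes (4 * n)"
  shows "(M, N) \<in> trihex_iso (4 * n) \<longleftrightarrow> {K. hex_covered M K} = {K. hex_covered N K}"
proof
  assume "(M, N) \<in> trihex_iso (4 * n)"
  then obtain f g where iso: "oriented_iso M N f g" by (auto simp: trihex_iso_def)
  have rs: "rotation_system M" "rotation_system N"
    using assms by (auto simp: trihexes_def trihex_def)
  show "{K. hex_covered M K} = {K. hex_covered N K}"
    using hex_covered_oriented_iso[OF rs(1) iso] hex_covered_oriented_iso[OF rs(2) oriented_iso_sym[OF rs(1) iso]]
    by blast
next
  assume eq: "{K. hex_covered M K} = {K. hex_covered N K}"
  obtain K where "hex_covered M K" using trihexes_imp_lattices[OF assms(1)] by blast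
  moreover from this have "hex_covered N K" using eq by blast
  moreover have "cubic_map M" "cubic_map N"
    using assms by (auto simp: trihexes_def intro: cubic_map_trihex)
  ultimately have "\<exists>f g. oriented_iso M N f g" by (intro hex_covered_imp_oriented_iso)
  then show "(M, N) \<in> trihex_iso (4 * n)" using assms by (simp add: trihex_iso_def)
qed

lemma card_quotient_kernel:
  assumes "R \<subseteq> X \<times> X" "\<And>x y. x \<in> X \<Longrightarrow> y \<in> X \<Longrightarrow> (x, y) \<in> R \<longleftrightarrow> h x = h y"
  shows "card (X // R) = card (h ` X)"
proof -
  have R: "R `` {x} = {y \<in> X. h y = h x}" if "x \<in> X" for x
    using assms that by auto
  let ?F = "\<lambda>c. {y \<in> X. h y = c}"
  have "X // R = ?F ` h ` X"
    unfolding quotient_def image_image using R by blast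
  moreover have "inj_on ?F (h ` X)"
  proof (rule inj_onI)
    fix c c' assume "c \<in> h ` X" "c' \<in> h ` X" "?F c = ?F c'"
    then show "c = c'" by blast
  qed
  ultimately show ?thesis by (simp add: card_image)
qed

lemma num_trihexes_eq_card_orbits:
  "num_trihexes (4 * n) = card (orbit (rot_lattice n) ` lattices n)"
proof -
  have "num_trihexes (4 * n) = card ((\<lambda>M. {K. hex_covered M K}) ` trihexes (4 * n))"
    unfolding num_trihexes_def
    by (rule card_quotient_kernel) (use trihex_iso_iff in \<open>auto simp: trihex_iso_def\<close>)
  also have "(\<lambda>M. {K. hex_covered M K}) ` trihexes (4 * n) = orbit (rot_lattice n) ` lattices n"
  proof (intro equalityI subsetI)
    fix X assume "X \<in> (\<lambda>M. {K. hex_covered M K}) ` trihexes (4 * n)"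
    then obtain M where M: "M \<in> trihexes (4 * n)" "X = {K. hex_covered M K}" by blast
    obtain K where "K \<in> lattices n" "hex_covered M K" using trihexes_imp_lattices[OF M(1)] .
    then show "X \<in> orbit (rot_lattice n) ` lattices n" using hex_covered_eq_orbit[OF M(1)] M(2) by blast
  next
    fix X assume "X \<in> orbit (rot_lattice n) ` lattices n"
    then obtain K where K: "K \<in> lattices n" "X = orbit (rot_lattice n) K" by blast
    obtain M where "M \<in> trihexes (4 * n)" "hex_covered M K" using lattices_imp_trihex[OF K(1)] by blast
    then show "X \<in> (\<lambda>M. {K. hex_covered M K}) ` trihexes (4 * n)" using hex_covered_eq_orbit[of M n K] K by blast
  qed
  finally show ?thesis .
qed

text \<open>Burnside's count by hand: with x orbits of size 1 and y of size 3 there are x + 3 y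
  sublattices, so 3 (x + y) is their number plus 2 x.\<close>

lemma num_trihexes_eq:
  assumes "n > 0"
  shows "3 * num_trihexes (4 * n) = divisor_sum n + 2 * eisenstein_ideals n"
proof -
  let ?f = "rot_lattice n" and ?L = "lattices n"
  let ?O = "\<lambda>c. {X \<in> orbit ?f ` ?L. card X = c}" and ?K = "\<lambda>c. {K \<in> ?L. card (orbit ?f K) = c}"
  have card_orbit: "card (orbit ?f K) = (if rot -` K = K then 1 else 3)" if "K \<in> ?L" for K
  proof (cases "rot -` K = K")
    case True
    then show ?thesis using that by (simp add: orbit_rot_lattice)
  next
    case False
    have "(?f ^^ 3) K = K" by (simp add: numeral_3_eq_3 rot_lattice_cubed)
    then have "card (orbit ?f K) = 3"
    proof (rule card_orbit_eqI)
      have neq: "?f K \<noteq> K" using False that by (simp add: rot_lattice_def)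
      fix j :: nat assume "0 < j" "j < 3"
      then have "j = 1 \<or> j = 2" by auto
      moreover have "?f (?f K) \<noteq> K" using neq rot_lattice_cubed[of n K] by metis
      ultimately show "(?f ^^ j) K \<noteq> K" using neq by (elim disjE) (simp_all add: numeral_2_eq_2)
    qed simp
    then show ?thesis using False by simp
  qed
  then have card_orbit': "card (orbit ?f K) = 1 \<or> card (orbit ?f K) = 3" if "K \<in> ?L" for K
    using that by presburger
  have O: "c * card (?O c) = card (?K c)" for c
    by (rule card_orbits_of_size[OF finite_lattices rot_lattice_permutes])
  have "orbit ?f ` ?L = ?O 1 \<union> ?O 3" using card_orbit' by blast
  then have "card (orbit ?f ` ?L) = card (?O 1 \<union> ?O 3)" by (rule arg_cong)
  also have "\<dots> = card (?O 1) + card (?O 3)"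
    using finite_lattices by (intro card_Un_disjoint) auto
  finally have "card (orbit ?f ` ?L) = card (?O 1) + card (?O 3)" .
  moreover have "?L = ?K 1 \<union> ?K 3" using card_orbit' by blast
  then have "card ?L = card (?K 1 \<union> ?K 3)" by (rule arg_cong)
  then have "card ?L = card (?K 1) + card (?K 3)"
    using finite_lattices by (subst (asm) card_Un_disjoint) auto
  moreover have "?K 1 = {K \<in> ?L. rot -` K = K}"
    by (intro Collect_cong conj_cong refl) (simp add: card_orbit)
  then have "card (?K 1) = eisenstein_ideals n" using card_rot_invariant_lattices[OF assms] by simp
  moreover have "card ?L = divisor_sum n" by (rule card_lattices[OF assms])
  ultimately show ?thesis
    using O[of 1] O[of 3] by (simp add: num_trihexes_eq_card_orbits)
qed

theorem theorem12:
  fixes V m r s :: nat and p k q l :: "nat \<Rightarrow> nat"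
  assumes "V > 0" and "4 dvd V"
    and "V div 4 = 3 ^ m * (\<Prod>i=1..r. p i ^ k i) * (\<Prod>j=1..s. q j ^ l j)"
    and "inj_on p {1..r}"
    and "\<And>i. i \<in> {1..r} \<Longrightarrow> prime (p i) \<and> [p i = 1] (mod 3) \<and> k i \<ge> 1"
    and "inj_on q {1..s}"
    and "\<And>j. j \<in> {1..s} \<Longrightarrow> prime (q j) \<and> [q j = 2] (mod 3) \<and> l j \<ge> 1"
  shows "((\<exists>j\<in>{1..s}. odd (l j)) \<longrightarrow>
      real (num_trihexes V) =
        1 / 3 * ((3 ^ (m + 1) - 1) / (3 - 1)
          * (\<Prod>i=1..r. (real (p i) ^ (k i + 1) - 1) / (real (p i) - 1))
          * (\<Prod>j=1..s. (real (q j) ^ (l j + 1) - 1) / (real (q j) - 1))))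
    \<and> ((\<forall>j\<in>{1..s}. even (l j)) \<longrightarrow>
      real (num_trihexes V) =
        1 / 3 * ((3 ^ (m + 1) - 1) / (3 - 1)
          * (\<Prod>i=1..r. (real (p i) ^ (k i + 1) - 1) / (real (p i) - 1))
          * (\<Prod>j=1..s. (real (q j) ^ (l j + 1) - 1) / (real (q j) - 1)))
        + 2 / 3 * (\<Prod>i=1..r. real (k i + 1)))"
proof -
  define n where "n = V div 4"
  have n: "n > 0" "V = 4 * n" using assms(1,2) by (auto simp: n_def)
  have p: "prime (p i)" "[p i = 1] (mod 3)" if "i \<in> {1..r}" for i using assms(5)[OF that] by auto
  have q: "prime (q j)" "[q j = 2] (mod 3)" if "j \<in> {1..s}" for j using assms(7)[OF that] by auto
  have factor: "f n = f (3 ^ m) * (\<Prod>i=1..r. f (p i ^ k i)) * (\<Prod>j=1..s. f (q j ^ l j))"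
    if "multiplicative f" for f
    unfolding n_def assms(3)
    by (rule multiplicative_factorization_mod_3[OF that assms(4) _ assms(6)]) (use p q in auto)
  let ?S = "(3 ^ (m + 1) - 1) / (3 - 1)
      * (\<Prod>i=1..r. (real (p i) ^ (k i + 1) - 1) / (real (p i) - 1))
      * (\<Prod>j=1..s. (real (q j) ^ (l j + 1) - 1) / (real (q j) - 1))"
  have sigma: "real (divisor_sum n) = ?S"
  proof -
    have "real (divisor_sum (3 ^ m)) = (3 ^ (m + 1) - 1) / (3 - 1)"
      using divisor_sum_prime_power[of 3 m] by simp
    moreover have "real (\<Prod>i=1..r. divisor_sum (p i ^ k i))
        = (\<Prod>i=1..r. (real (p i) ^ (k i + 1) - 1) / (real (p i) - 1))"
      unfolding of_nat_prod by (intro prod.cong refl divisor_sum_prime_power p)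
    moreover have "real (\<Prod>j=1..s. divisor_sum (q j ^ l j))
        = (\<Prod>j=1..s. (real (q j) ^ (l j + 1) - 1) / (real (q j) - 1))"
      unfolding of_nat_prod by (intro prod.cong refl divisor_sum_prime_power q)
    ultimately show ?thesis
      unfolding factor[OF multiplicative_divisor_sum] of_nat_mult by (simp only:)
  qed
  have ideals: "eisenstein_ideals n = (\<Prod>i=1..r. k i + 1) * (\<Prod>j=1..s. if even (l j) then 1 else 0)"
  proof -
    have "(\<Prod>i=1..r. eisenstein_ideals (p i ^ k i)) = (\<Prod>i=1..r. k i + 1)"
      by (intro prod.cong refl eisenstein_ideals_power_1_mod_3 p)
    moreover have "(\<Prod>j=1..s. eisenstein_ideals (q j ^ l j)) = (\<Prod>j=1..s. if even (l j) then 1 else 0)"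
      by (intro prod.cong refl eisenstein_ideals_power_2_mod_3 q)
    ultimately show ?thesis
      unfolding factor[OF multiplicative_eisenstein_ideals] by (simp add: eisenstein_ideals_power_3)
  qed
  have "real (3 * num_trihexes V) = real (divisor_sum n + 2 * eisenstein_ideals n)"
    unfolding n(2) num_trihexes_eq[OF n(1)] ..
  then have num: "real (num_trihexes V) = 1 / 3 * ?S + 2 / 3 * real (eisenstein_ideals n)"
    unfolding sigma[symmetric] by simp
  show ?thesis
  proof (intro conjI impI)
    assume "\<exists>j\<in>{1..s}. odd (l j)"
    then have "eisenstein_ideals n = 0" unfolding ideals by (auto intro!: prod_zero)
    then show "real (num_trihexes V) = 1 / 3 * ?S" using num by simp
  next
    assume "\<forall>j\<in>{1..s}. even (l j)"
    then have "eisenstein_ideals n = (\<Prod>i=1..r. k i + 1)" unfolding ideals by simp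
    then have "real (eisenstein_ideals n) = (\<Prod>i=1..r. real (k i + 1))" by (simp only: of_nat_prod)
    then show "real (num_trihexes V) = 1 / 3 * ?S + 2 / 3 * (\<Prod>i=1..r. real (k i + 1))" using num by (simp only:)
  qed
qed

end
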